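(* Let $\Delta\in\mathbb{Z}_{\ge1}$ be a constant. There is an algorithm that, given a finite simple graph $G$ with $\Delta(G)\le\Delta$ and weights $w(v)\in\mathbb{R}$ for $v\in V(G)$ and $w(e)\in\mathbb{R}$ for $e\in E(G)$, finds a total matching of $G$ of maximum weight in time $O(2^{O(\Delta\log\Delta)}(|V(G)|+|E(G)|))$.
   Context: For a finite simple graph $G$, the elements of $G$ are its vertices and edges. Two elements $\alpha,\beta\in V(G)\cup E(G)$ are incident if $\alpha=\beta$, or one is an edge and the other is an endpoint of that edge. A total matching of $G$ is a set $T\subseteq V(G)\cup E(G)$ that is the union of a stable set $S$ and a matching $F$ such that no vertex of $S$ is an endpoint of an edge of $F$ (equivalently, no two distinct elements of $T$ are incident). Its weight is $\sum_{\alpha\in T}w(\alpha)$. $M(G)$ is the $0/1$ matrix with rows and columns indexed by $V(G)\cup E(G)$ whose $(\alpha,\beta)$ entry is $1$ iff $\alpha$ and $\beta$ are incident; equivalently $M(G)=\begin{bmatrix} I & B\\ B^\intercal & I\end{bmatrix}$ where $B$ is the vertex-edge incidence matrix of $G$ (this is the constraint matrix of the natural integer programming formulation of the maximum weight total matching problem). $\Delta(G)$ denotes the maximum of $|\det M'|$ over all square submatrices $M'$ of $M(G)$. *)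

theory Defs
  imports "HOL-Library.Landau_Symbols" "Jordan_Normal_Form.Determinant"
begin

section \<open>Graphs and total matchings\<close>

definition simple_graph :: "'a set \<Rightarrow> 'a set set \<Rightarrow> bool" where
  "simple_graph V E \<longleftrightarrow> finite V \<and> (\<forall>e\<in>E. e \<subseteq> V \<and> card e = 2)"

text \<open>An element is \<^term>\<open>Inl v\<close> for a vertex \<open>v\<close> or \<^term>\<open>Inr e\<close> for an edge \<open>e\<close>; the
  set of all elements of \<open>(V, E)\<close> is \<^term>\<open>V <+> E\<close>.\<close>

type_synonym 'a element = "'a + 'a set"

definition stable_set :: "'a set \<Rightarrow> 'a set set \<Rightarrow> 'a set \<Rightarrow> bool" where
  "stable_set V E S \<longleftrightarrow> S \<subseteq> V \<and> (\<forall>u\<in>S. \<forall>v\<in>S. {u, v} \<notin> E)"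

definition matching :: "'a set set \<Rightarrow> 'a set set \<Rightarrow> bool" where
  "matching E F \<longleftrightarrow> F \<subseteq> E \<and> (\<forall>e\<in>F. \<forall>e'\<in>F. e \<noteq> e' \<longrightarrow> e \<inter> e' = {})"

definition total_matching :: "'a set \<Rightarrow> 'a set set \<Rightarrow> 'a element set \<Rightarrow> bool" where
  "total_matching V E T \<longleftrightarrow>
     (\<exists>S F. T = S <+> F \<and> stable_set V E S \<and> matching E F \<and> (\<forall>v\<in>S. \<forall>e\<in>F. v \<notin> e))"

definition max_weight_total_matching ::
    "'a set \<Rightarrow> 'a set set \<Rightarrow> ('a element \<Rightarrow> real) \<Rightarrow> 'a element set \<Rightarrow> bool" where
  "max_weight_total_matching V E w T \<longleftrightarrow>
     total_matching V E T \<and> (\<forall>T'. total_matching V E T' \<longrightarrow> sum w T' \<le> sum w T)"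


section \<open>The constraint matrix and its subdeterminants\<close>

fun incident :: "'a element \<Rightarrow> 'a element \<Rightarrow> bool" where
  "incident (Inl u) (Inl v) \<longleftrightarrow> u = v"
| "incident (Inl v) (Inr e) \<longleftrightarrow> v \<in> e"
| "incident (Inr e) (Inl v) \<longleftrightarrow> v \<in> e"
| "incident (Inr e) (Inr e') \<longleftrightarrow> e = e'"

definition M_entry :: "'a element \<Rightarrow> 'a element \<Rightarrow> int" where
  "M_entry \<alpha> \<beta> = (if incident \<alpha> \<beta> then 1 else 0)"

text \<open>The submatrix with rows \<open>rs\<close> and columns \<open>cs\<close>, in the listed order. The order only affects
  the sign of the determinant.\<close>

definition M_sub :: "'a element list \<Rightarrow> 'a element list \<Rightarrow> int mat" where
  "M_sub rs cs = mat (length rs) (length cs) (\<lambda>(i, j). M_entry (rs ! i) (cs ! j))"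

definition abs_subdets :: "'a set \<Rightarrow> 'a set set \<Rightarrow> int set" where
  "abs_subdets V E =
     {\<bar>det (M_sub rs cs)\<bar> | rs cs.
        distinct rs \<and> distinct cs \<and> length rs = length cs \<and>
        set rs \<subseteq> V <+> E \<and> set cs \<subseteq> V <+> E}"

definition max_subdet :: "'a set \<Rightarrow> 'a set set \<Rightarrow> int" where
  "max_subdet V E = Max (abs_subdets V E)"

lemma abs_subdets_nonempty:
  fixes V :: "'a set"
  shows "abs_subdets V E \<noteq> {}"
proof -
  have "\<bar>det (M_sub ([] :: 'a element list) ([] :: 'a element list))\<bar> \<in> abs_subdets V E"
    unfolding abs_subdets_def by (rule CollectI, rule exI[of _ "[]"], rule exI[of _ "[]"]) simp
  then show ?thesis by blast
qed

lemma finite_abs_subdets: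
  assumes "simple_graph V E"
  shows "finite (abs_subdets V E)"
proof -
  let ?L = "{xs. set xs \<subseteq> V <+> E \<and> distinct xs}"
  have "finite V" and "E \<subseteq> Pow V"
    using assms unfolding simple_graph_def by auto
  then have "finite (V <+> E)"
    by (meson finite_Plus finite_Pow_iff finite_subset)
  then have "finite ?L"
    by (rule finite_subset_distinct)
  then have "finite ((\<lambda>(rs, cs). \<bar>det (M_sub rs cs)\<bar>) ` (?L \<times> ?L))"
    by blast
  moreover have "abs_subdets V E \<subseteq> (\<lambda>(rs, cs). \<bar>det (M_sub rs cs)\<bar>) ` (?L \<times> ?L)"
    unfolding abs_subdets_def by auto
  ultimately show ?thesis by (rule finite_subset[rotated])
qed


section \<open>The machine model\<close>

text \<open>A real random-access machine: registers and arrays of natural numbers (control and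
  addressing) and registers and arrays of real numbers (weights), all referred to by fixed names in
  the program. Every primitive operation and every test costs one step. Two restrictions keep the
  unit-cost measure honest. Natural numbers are only changed by one at a time, so within \<open>t\<close> steps
  they exceed the input and the program constants by at most \<open>t\<close>, and no work can be hidden in
  large integers. Reals are only added, subtracted and compared, and the only real constant is 0,
  so a program cannot carry advice in a real constant; there is no rounding.\<close>

type_synonym name = string

record store =
  ireg :: "name \<Rightarrow> nat"
  iarr :: "name \<Rightarrow> nat \<Rightarrow> nat"
  rreg :: "name \<Rightarrow> real"
  rarr :: "name \<Rightarrow> nat \<Rightarrow> real"

datatype instr =
    IConst name nat
  | IMove name name
  | ISucc name
  | IPred name
  | ILoad name name name
  | IStore name name name
  | RZero name
  | RMove name name
  | RAdd name name name
  | RSub name name name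
  | RLoad name name name
  | RStore name name name

fun step :: "instr \<Rightarrow> store \<Rightarrow> store" where
  "step (IConst x c) s = s\<lparr>ireg := (ireg s)(x := c)\<rparr>"
| "step (IMove x y) s = s\<lparr>ireg := (ireg s)(x := ireg s y)\<rparr>"
| "step (ISucc x) s = s\<lparr>ireg := (ireg s)(x := ireg s x + 1)\<rparr>"
| "step (IPred x) s = s\<lparr>ireg := (ireg s)(x := ireg s x - 1)\<rparr>"
| "step (ILoad x a i) s = s\<lparr>ireg := (ireg s)(x := iarr s a (ireg s i))\<rparr>"
| "step (IStore a i x) s = s\<lparr>iarr := (iarr s)(a := (iarr s a)(ireg s i := ireg s x))\<rparr>"
| "step (RZero x) s = s\<lparr>rreg := (rreg s)(x := 0)\<rparr>"
| "step (RMove x y) s = s\<lparr>rreg := (rreg s)(x := rreg s y)\<rparr>"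
| "step (RAdd x y z) s = s\<lparr>rreg := (rreg s)(x := rreg s y + rreg s z)\<rparr>"
| "step (RSub x y z) s = s\<lparr>rreg := (rreg s)(x := rreg s y - rreg s z)\<rparr>"
| "step (RLoad x a i) s = s\<lparr>rreg := (rreg s)(x := rarr s a (ireg s i))\<rparr>"
| "step (RStore a i x) s = s\<lparr>rarr := (rarr s)(a := (rarr s a)(ireg s i := rreg s x))\<rparr>"

datatype test = IEq name name | ILess name name | RLess name name

fun holds :: "test \<Rightarrow> store \<Rightarrow> bool" where
  "holds (IEq x y) s \<longleftrightarrow> ireg s x = ireg s y"
| "holds (ILess x y) s \<longleftrightarrow> ireg s x < ireg s y"
| "holds (RLess x y) s \<longleftrightarrow> rreg s x < rreg s y"

datatype prog =
    Skip
  | Do instr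
  | Seq prog prog
  | Cond test prog prog
  | While test prog

text \<open>\<open>exec p s t s'\<close>: started in \<open>s\<close>, program \<open>p\<close> terminates in \<open>s'\<close> after exactly \<open>t\<close> steps.\<close>

inductive exec :: "prog \<Rightarrow> store \<Rightarrow> nat \<Rightarrow> store \<Rightarrow> bool" where
  Skip: "exec Skip s 1 s"
| Do: "exec (Do c) s 1 (step c s)"
| Seq: "exec p s t s' \<Longrightarrow> exec q s' t' s'' \<Longrightarrow> exec (Seq p q) s (t + t') s''"
| CondTrue: "holds b s \<Longrightarrow> exec p s t s' \<Longrightarrow> exec (Cond b p q) s (t + 1) s'"
| CondFalse: "\<not> holds b s \<Longrightarrow> exec q s t s' \<Longrightarrow> exec (Cond b p q) s (t + 1) s'"
| WhileFalse: "\<not> holds b s \<Longrightarrow> exec (While b p) s 1 s"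
| WhileTrue: "holds b s \<Longrightarrow> exec p s t s' \<Longrightarrow> exec (While b p) s' t' s'' \<Longrightarrow>
    exec (While b p) s (t + t' + 1) s''"

inductive_cases SkipE: "exec Skip s t s'"
inductive_cases DoE: "exec (Do c) s t s'"
inductive_cases SeqE: "exec (Seq p q) s t s'"
inductive_cases CondE: "exec (Cond b p q) s t s'"
inductive_cases WhileE: "exec (While b p) s t s'"

lemma exec_deterministic:
  "exec p s t s' \<Longrightarrow> exec p s u s'' \<Longrightarrow> u = t \<and> s'' = s'"
proof (induction arbitrary: u s'' rule: exec.induct)
  case (Skip s)
  then show ?case by (auto elim: SkipE)
next
  case (Do c s)
  then show ?case by (auto elim: DoE)
next
  case (Seq p s t s' q t' r)
  from Seq.prems obtain a x b where "exec p s a x" "exec q x b s''" "u = a + b"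
    by (rule SeqE)
  with Seq.IH show ?case by metis
next
  case (CondTrue b s p t s' q)
  from CondTrue.prems CondTrue.hyps(1) obtain a where "exec p s a s''" "u = a + 1"
    by (auto elim: CondE)
  with CondTrue.IH show ?case by metis
next
  case (CondFalse b s q t s' p)
  from CondFalse.prems CondFalse.hyps(1) obtain a where "exec q s a s''" "u = a + 1"
    by (auto elim: CondE)
  with CondFalse.IH show ?case by metis
next
  case (WhileFalse b s p)
  then show ?case by (auto elim: WhileE)
next
  case (WhileTrue b s p t s' t' r)
  from WhileTrue.prems WhileTrue.hyps(1)
  obtain a x c where "exec p s a x" "exec (While b p) x c s''" "u = a + c + 1"
    by (auto elim: WhileE)
  with WhileTrue.IH show ?case by metis
qed


section \<open>Input and output conventions\<close>

text \<open>A graph is presented by a list \<open>vs\<close> of its vertices and a list \<open>ps\<close> of pairs of positions in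
  \<open>vs\<close>, one pair for each edge, in any order and with either endpoint first. The program sees
  only the positions.\<close>

definition edge_list :: "'a list \<Rightarrow> (nat \<times> nat) list \<Rightarrow> 'a set list" where
  "edge_list vs ps = map (\<lambda>(i, j). {vs ! i, vs ! j}) ps"

definition presents :: "'a list \<Rightarrow> (nat \<times> nat) list \<Rightarrow> 'a set \<Rightarrow> 'a set set \<Rightarrow> bool" where
  "presents vs ps V E \<longleftrightarrow>
     distinct vs \<and> set vs = V \<and>
     (\<forall>(i, j) \<in> set ps. i < length vs \<and> j < length vs) \<and>
     distinct (edge_list vs ps) \<and> set (edge_list vs ps) = E"

definition padded :: "'b::zero list \<Rightarrow> nat \<Rightarrow> 'b" where
  "padded xs i = (if i < length xs then xs ! i else 0)"

definition input_store :: "'a list \<Rightarrow> (nat \<times> nat) list \<Rightarrow> ('a element \<Rightarrow> real) \<Rightarrow> store" where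
  "input_store vs ps w =
     \<lparr> ireg = (\<lambda>_. 0)(''n'' := length vs, ''m'' := length ps),
       iarr = (\<lambda>_ _. 0)(''end1'' := padded (map fst ps), ''end2'' := padded (map snd ps)),
       rreg = (\<lambda>_. 0),
       rarr = (\<lambda>_ _. 0)(''wv'' := padded (map (\<lambda>v. w (Inl v)) vs),
                        ''we'' := padded (map (\<lambda>e. w (Inr e)) (edge_list vs ps))) \<rparr>"

definition output_set :: "'a list \<Rightarrow> (nat \<times> nat) list \<Rightarrow> store \<Rightarrow> 'a element set" where
  "output_set vs ps s =
     {Inl (vs ! i) | i. i < length vs \<and> iarr s ''outv'' i \<noteq> 0} \<union>
     {Inr (edge_list vs ps ! j) | j. j < length ps \<and> iarr s ''oute'' j \<noteq> 0}"

end

theory Submission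
  imports Defs
begin

text \<open>A star with \<open>k\<close> edges contributes a subdeterminant \<open>1 - k\<close>, and stars around pairwise
  nonadjacent centres form a block-diagonal submatrix. Hence all degrees are at most \<open>\<Delta> + 1\<close> and,
  taking a maximal stable set of vertices of degree at least 3, there are at most \<open>2 \<Delta>\<close> such vertices.
  Deleting them leaves paths and cycles; every cycle contributes a factor 2, so there are at most
  \<open>log 2 \<Delta>\<close> of them, and one more deleted vertex per cycle leaves only paths. The elements of a path, taken
  alternately as vertices and edges, conflict iff they are at distance at most 2 in this order, so that a
  one-dimensional dynamic program finds an optimum in linear time. What remains is to enumerate the status of the at
  most \<open>3 \<Delta>\<close> deleted vertices (uncovered, selected, or matched along one of at most \<open>\<Delta> + 1\<close> edges),
  which gives \<open>(\<Delta> + 3) ^ (3 \<Delta>)\<close> cases.\<close>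


section \<open>Subdeterminants of stars and cycles\<close>

text \<open>The program never evaluates a determinant. The bound on subdeterminants enters only
  through three facts about the graph: degrees are at most \<open>d + 1\<close>, at most
  \<open>2 * d\<close> vertices have degree at least 3, and there are at most \<open>d\<close>
  disjoint cycles (weaker than the logarithm, but enough for \<open>3 * d\<close> labels). The
  delicate determinant is that of an even cycle, whose vertex-edge incidence matrix is singular; the
  identity blocks of the constraint matrix repair this by providing a cyclic matrix of odd order.
  Two empty positions between consecutive paths merge all of them into a single line, so one run of
  the dynamic program serves every path. Walking along the paths is linear by amortisation: each
  step is charged to the vertex that it places. Since the program may depend on \<open>d\<close> but
  not on the graph, the enumeration is a fixed nest of \<open>3 * d\<close> loops, and the overhead
  of the loops turns the base \<open>d + 3\<close> into \<open>6 * d + 22\<close>.\<close>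

lemma det_M_sub_append:
  assumes l1: "length rs1 = length cs1" and l2: "length rs2 = length cs2"
    and z: "\<forall>a\<in>set rs1. \<forall>b\<in>set cs2. \<not> incident a b"
  shows "det (M_sub (rs1 @ rs2) (cs1 @ cs2)) = det (M_sub rs1 cs1) * det (M_sub rs2 cs2)"
proof -
  let ?A = "M_sub rs1 cs1" and ?B = "0\<^sub>m (length cs1) (length cs2) :: int mat"
    and ?C = "M_sub rs2 cs1" and ?D = "M_sub rs2 cs2"
  have "M_sub (rs1 @ rs2) (cs1 @ cs2) = four_block_mat ?A ?B ?C ?D"
    using assms unfolding M_sub_def
    by (intro eq_matI) (auto simp: nth_append M_entry_def)
  moreover have "det (four_block_mat ?A ?B ?C ?D) = det ?A * det ?D"
    by (rule det_four_block_mat_upper_right_zero[of _ "length cs1" _ "length cs2"])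
      (auto simp: M_sub_def l1 l2)
  ultimately show ?thesis by simp
qed

text \<open>A block triangular matrix suffices, so only rows of earlier blocks are compared with
  columns of later ones; this is the reason for the one-sided condition
  \<open>sorted_wrt\<close>.\<close>

lemma det_M_sub_concat:
  assumes "\<forall>g\<in>set gs. length (fst g) = length (snd g)"
    and "sorted_wrt (\<lambda>g h. \<forall>a\<in>set (fst g). \<forall>b\<in>set (snd h). \<not> incident a b) gs"
  shows "\<bar>det (M_sub (concat (map fst gs)) (concat (map snd gs)))\<bar> =
    (\<Prod>g\<leftarrow>gs. \<bar>det (M_sub (fst g) (snd g))\<bar>)"
    and "length (concat (map fst gs)) = length (concat (map snd gs))"
  using assms
proof (induction gs)
  case Nil
  { case 1 show ?case by (simp add: M_sub_def) }
  { case 2 show ?case by simp }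
next
  case (Cons g gs)
  { case 1
    with Cons.IH show ?case by (simp add: det_M_sub_append abs_mult) }
  { case 2 with Cons.IH show ?case by simp }
qed

lemma abs_det_le_max_subdet:
  assumes "simple_graph V E" "distinct rs" "distinct cs" "length rs = length cs"
    "set rs \<subseteq> V <+> E" "set cs \<subseteq> V <+> E"
  shows "\<bar>det (M_sub rs cs)\<bar> \<le> max_subdet V E"
  unfolding max_subdet_def using assms
  by (intro Max_ge finite_abs_subdets) (auto simp: abs_subdets_def)

section \<open>Stars: bounds on the degrees and on the number of vertices of degree at least
  3\<close>

definition degree_in :: "'a set set \<Rightarrow> 'a \<Rightarrow> nat" where
  "degree_in E v = card {e \<in> E. v \<in> e}"

text \<open>Subtracting every edge row from the row of the centre clears that row except for its
  first entry, which becomes 1 minus the number of edges. \<open>U\<close> is this row operation of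
  determinant 1 and \<open>N\<close> is the triangular result.\<close>

lemma det_star:
  assumes "distinct es" "\<forall>e\<in>set es. v \<in> e"
  shows "det (M_sub (Inl v # map Inr es) (Inl v # map Inr es)) = 1 - int (length es)"
proof -
  let ?k = "Suc (length es)" and ?M = "M_sub (Inl v # map Inr es) (Inl v # map Inr es)"
  define U :: "int mat" where
    "U = mat ?k ?k (\<lambda>(i, j). if i = j then 1 else if i = 0 then - 1 else 0)"
  define N :: "int mat" where
    "N = mat ?k ?k (\<lambda>(i, j). if i = 0 then (if j = 0 then 1 - int (length es) else 0)
       else if j = 0 \<or> i = j then 1 else 0)"
  have "\<And>i. i < length es \<Longrightarrow> v \<in> es ! i" using assms by simp
  then have M: "?M = mat ?k ?k (\<lambda>(i, j). if i = j \<or> i = 0 \<or> j = 0 then 1 else 0)"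
    using assms by (intro eq_matI) (auto simp: M_sub_def M_entry_def nth_Cons nth_eq_iff_index_eq
        split: nat.splits)
  have "U * ?M = N"
  proof (rule eq_matI)
    fix i j assume "i < dim_row N" "j < dim_col N"
    then have ij: "i < ?k" "j < ?k" by (auto simp: N_def)
    define g :: "nat \<Rightarrow> int" where "g l = (if i = l then 1 else if i = 0 then - 1 else 0)
        * (if l = j \<or> l = 0 \<or> j = 0 then 1 else 0)" for l
    have eq: "(U * ?M) $$ (i, j) = (\<Sum>l\<in>{0..<?k}. g l)"
      using ij by (simp add: U_def M scalar_prod_def g_def)
    show "(U * ?M) $$ (i, j) = N $$ (i, j)"
    proof (cases "i = 0")
      case True
      have "(\<Sum>l\<in>{0..<?k}. g l) = g 0 + (\<Sum>l\<in>{Suc 0..<?k}. g l)"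
        by (rule sum.atLeast_Suc_lessThan) simp
      also have "(\<Sum>l\<in>{Suc 0..<?k}. g l) = (\<Sum>l\<in>{Suc 0..<?k}. if j = 0 then - 1 else if l = j then - 1 else 0)"
        using True by (intro sum.cong) (auto simp: g_def)
      also have "g 0 + \<dots> = N $$ (i, j)"
        using ij True by (cases "j = 0") (auto simp: N_def g_def)
      finally show ?thesis using eq by simp
    next
      case False
      have "(\<Sum>l\<in>{0..<?k}. g l) = (\<Sum>l\<in>{0..<?k}. if i = l then g i else 0)"
        using False by (intro sum.cong) (auto simp: g_def)
      then show ?thesis using ij False eq by (auto simp: N_def g_def)
    qed
  qed (auto simp: U_def N_def M)
  moreover have "det (U * ?M) = det U * det ?M"
    by (rule det_mult[of _ ?k]) (auto simp: U_def M)
  moreover have "det U = 1"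
    by (subst det_upper_triangular[of _ ?k])
      (auto simp: U_def upper_triangular_def prod_list_diag_prod)
  moreover have "det N = 1 - int (length es)"
  proof -
    have "det N = (\<Prod>i = 0..<?k. N $$ (i, i))"
      by (subst det_lower_triangular[of ?k]) (auto simp: N_def prod_list_diag_prod)
    also have "\<dots> = N $$ (0, 0) * (\<Prod>i = 1..<?k. N $$ (i, i))"
      by (subst prod.atLeast_Suc_lessThan) auto
    also have "(\<Prod>i = 1..<?k. N $$ (i, i)) = 1"
      by (intro prod.neutral) (auto simp: N_def)
    finally show ?thesis by (simp add: N_def)
  qed
  ultimately show ?thesis by simp
qed

lemma simple_graph_finite_edges: "simple_graph V E \<Longrightarrow> finite E"
  unfolding simple_graph_def by (meson Pow_iff finite_Pow_iff finite_subset subsetI)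

text \<open>An edge through two centres would be the edge joining them, which stability excludes.
  Hence different stars have no common element and no incidences between them, and their
  determinants multiply.\<close>

lemma stars_subdet:
  assumes G: "simple_graph V E" and S: "S \<subseteq> V" "\<forall>u\<in>S. \<forall>v\<in>S. {u, v} \<notin> E"
  shows "(\<Prod>v\<in>S. \<bar>1 - int (degree_in E v)\<bar>) \<le> max_subdet V E"
proof -
  have fin: "finite S" using G S(1) by (auto simp: simple_graph_def intro: finite_subset)
  then obtain xs where xs: "set xs = S" "distinct xs" using finite_distinct_list by blast
  have "\<forall>v. \<exists>es. set es = {e \<in> E. v \<in> e} \<and> distinct es"
    using simple_graph_finite_edges[OF G] by (auto intro: finite_distinct_list)
  then obtain es where es: "\<And>v. set (es v) = {e \<in> E. v \<in> e}" "\<And>v. distinct (es v)" by metis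
  have sub: "set (es v) \<inter> set (es u) = {}" if "u \<in> S" "v \<in> S" "u \<noteq> v" for u v
  proof -
    have False if "e \<in> E" "u \<in> e" "v \<in> e" for e
    proof -
      have "card e = 2" using G that by (auto simp: simple_graph_def)
      then have "e = {u, v}" using that \<open>u \<noteq> v\<close> by (auto simp: card_2_iff)
      then show False using S \<open>u \<in> S\<close> \<open>v \<in> S\<close> that by auto
    qed
    then show ?thesis using es by auto
  qed
  define st where "st v = (Inl v # map Inr (es v) :: 'a element list)" for v
  define gs where "gs = map (\<lambda>v. (st v, st v)) xs"
  have len: "length (es v) = degree_in E v" for v
    using es[of v] unfolding degree_in_def by (metis distinct_card)
  have ninc: "\<not> incident a b" if "a \<in> set (st u)" "b \<in> set (st v)" "u \<in> S" "v \<in> S" "u \<noteq> v" for a b u v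
    using that(1,2,5) sub[OF that(3,4,5)] es(1)
    by (cases a; cases b) (auto simp: st_def simp del: es(1))
  have "sorted_wrt (\<lambda>g h. \<forall>a\<in>set (fst g). \<forall>b\<in>set (snd h). \<not> incident a b) gs"
    unfolding gs_def sorted_wrt_map fst_conv snd_conv
  proof (rule sorted_wrt_mono_rel[of _ "(\<noteq>)"])
    show "sorted_wrt (\<noteq>) xs" using xs(2) by (induction xs) auto
  qed (use ninc xs in blast)
  then have "\<bar>det (M_sub (concat (map fst gs)) (concat (map snd gs)))\<bar> =
    (\<Prod>g\<leftarrow>gs. \<bar>det (M_sub (fst g) (snd g))\<bar>)"
    by (rule det_M_sub_concat(1)[rotated]) (auto simp: gs_def)
  also have "\<dots> = (\<Prod>v\<leftarrow>xs. \<bar>1 - int (degree_in E v)\<bar>)"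
    unfolding gs_def map_map o_def st_def fst_conv snd_conv
    using es by (subst det_star) (auto simp: len)
  also have "\<dots> = (\<Prod>v\<in>S. \<bar>1 - int (degree_in E v)\<bar>)"
    using xs prod.distinct_set_conv_list[OF xs(2)] by metis
  finally have eq: "\<bar>det (M_sub (concat (map fst gs)) (concat (map snd gs)))\<bar> =
    (\<Prod>v\<in>S. \<bar>1 - int (degree_in E v)\<bar>)" .
  have dist: "distinct (concat (map st xs))"
  proof -
    have "set (st u) \<inter> set (st v) = {}" if "u \<in> S" "v \<in> S" "u \<noteq> v" for u v
      using that sub[of u v] by (auto simp: st_def)
    moreover have "distinct (st v)" for v using es by (auto simp: st_def distinct_map)
    moreover have "inj_on st S" by (auto simp: st_def inj_on_def)
    ultimately show ?thesis using xs by (intro distinct_concat) (auto simp: distinct_map)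
  qed
  have gseq: "map fst gs = map st xs" "map snd gs = map st xs" by (auto simp: gs_def)
  show ?thesis unfolding eq[symmetric] gseq
    using dist S xs es by (intro abs_det_le_max_subdet G) (auto simp: st_def)
qed

lemma degree_le:
  assumes "simple_graph V E" "max_subdet V E \<le> int d" "v \<in> V"
  shows "degree_in E v \<le> d + 1"
proof -
  have "{v, v} \<notin> E" using assms(1) by (auto simp: simple_graph_def)
  then have "(\<Prod>v\<in>{v}. \<bar>1 - int (degree_in E v)\<bar>) \<le> max_subdet V E"
    using assms by (intro stars_subdet) auto
  then show ?thesis using assms(2) by simp
qed

text \<open>For \<open>a, b \<ge> 2\<close> the inequality \<open>(a - 1) * (b - 1) \<ge> 1\<close>
  says \<open>a + b \<le> a * b\<close>. It converts a sum over degrees into the product that a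
  subdeterminant controls.\<close>

lemma sum_le_prod_ge_2:
  assumes "finite S" "\<forall>x\<in>S. f x \<ge> (2::int)"
  shows "sum f S \<le> prod f S"
proof (cases "S = {}")
  case False
  from assms(1) False assms(2) show ?thesis
  proof (induction S rule: finite_ne_induct)
    case (insert x F)
    obtain y where "y \<in> F" using insert by auto
    then have "f y \<le> sum f F" using insert(1,5) by (intro member_le_sum) force+
    then have 2: "2 \<le> prod f F" using insert \<open>y \<in> F\<close> by force
    have "0 \<le> (f x - 1) * (prod f F - 1) - 1"
      using insert(5) 2 mult_mono[of 1 "f x - 1" 1 "prod f F - 1"] by auto
    then show ?case using insert by (simp add: algebra_simps)
  qed auto
qed auto

text \<open>By maximality of \<open>S\<close>, the closed neighbourhoods of its vertices cover all
  vertices of degree at least 3. Each has at most \<open>deg + 1\<close> elements, and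
  \<open>deg + 1 \<le> 2 * (deg - 1)\<close> holds exactly from degree 3 on; this is the origin of
  the factor 2.\<close>

lemma card_high_degree_le:
  assumes G: "simple_graph V E" and d: "max_subdet V E \<le> int d"
  shows "card {v \<in> V. degree_in E v \<ge> 3} \<le> 2 * d"
proof -
  define Hi where "Hi = {v \<in> V. degree_in E v \<ge> 3}"
  define F where "F = {S. S \<subseteq> Hi \<and> (\<forall>u\<in>S. \<forall>v\<in>S. {u, v} \<notin> E)}"
  have fHi: "finite Hi" using G by (auto simp: Hi_def simple_graph_def)
  then have "finite F" unfolding F_def by auto
  moreover have "{} \<in> F" by (auto simp: F_def)
  ultimately obtain S where S: "S \<in> F" "\<And>T. T \<in> F \<Longrightarrow> S \<subseteq> T \<Longrightarrow> S = T"
    by (metis finite_has_maximal empty_iff)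
  have fS: "finite S" using S(1) fHi by (auto simp: F_def intro: finite_subset)
  define N where "N v = insert v {u. {v, u} \<in> E}" for v
  have cov: "Hi \<subseteq> (\<Union>v\<in>S. N v)"
  proof
    fix x assume x: "x \<in> Hi"
    show "x \<in> (\<Union>v\<in>S. N v)"
    proof (rule ccontr)
      assume no: "x \<notin> (\<Union>v\<in>S. N v)"
      have "{x, x} \<notin> E" using G by (auto simp: simple_graph_def)
      then have "insert x S \<in> F" using no x S(1) by (auto simp: F_def N_def insert_commute)
      then have "x \<in> S" using S(2) by blast
      then show False using no by (auto simp: N_def)
    qed
  qed
  have fN: "finite {u. {v, u} \<in> E}" and cN: "card {u. {v, u} \<in> E} \<le> degree_in E v" for v
  proof -
    have inj: "inj_on (\<lambda>u. {v, u}) {u. {v, u} \<in> E}" by (auto simp: inj_on_def doubleton_eq_iff)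
    have sub: "(\<lambda>u. {v, u}) ` {u. {v, u} \<in> E} \<subseteq> {e \<in> E. v \<in> e}" by auto
    have fin: "finite {e \<in> E. v \<in> e}" using simple_graph_finite_edges[OF G] by auto
    show "finite {u. {v, u} \<in> E}" using inj sub fin by (meson finite_imageD finite_subset)
    show "card {u. {v, u} \<in> E} \<le> degree_in E v"
      unfolding degree_in_def using card_inj_on_le[OF inj sub fin] .
  qed
  have "card Hi \<le> card (\<Union>v\<in>S. N v)" using fS fN cov by (intro card_mono) (auto simp: N_def)
  also have "\<dots> \<le> (\<Sum>v\<in>S. card (N v))" by (rule card_UN_le[OF fS])
  also have "\<dots> \<le> (\<Sum>v\<in>S. 2 * (degree_in E v - 1))"
  proof (rule sum_mono)
    fix v assume "v \<in> S"
    then have "3 \<le> degree_in E v" using S(1) by (auto simp: F_def Hi_def)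
    moreover have "card (N v) \<le> Suc (degree_in E v)" unfolding N_def
      using cN[of v] by (simp add: card_insert_if fN)
    ultimately show "card (N v) \<le> 2 * (degree_in E v - 1)" by linarith
  qed
  finally have le: "card Hi \<le> (\<Sum>v\<in>S. 2 * (degree_in E v - 1))" .
  have "int (card Hi) \<le> 2 * (\<Sum>v\<in>S. \<bar>1 - int (degree_in E v)\<bar>)"
  proof -
    have "int (\<Sum>v\<in>S. 2 * (degree_in E v - 1)) = 2 * (\<Sum>v\<in>S. \<bar>1 - int (degree_in E v)\<bar>)"
      unfolding of_nat_sum sum_distrib_left
    proof (rule sum.cong)
      fix v assume "v \<in> S"
      then have "3 \<le> degree_in E v" using S(1) by (auto simp: F_def Hi_def)
      then show "int (2 * (degree_in E v - 1)) = 2 * \<bar>1 - int (degree_in E v)\<bar>" by simp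
    qed simp
    then show ?thesis using le by linarith
  qed
  also have "(\<Sum>v\<in>S. \<bar>1 - int (degree_in E v)\<bar>) \<le> (\<Prod>v\<in>S. \<bar>1 - int (degree_in E v)\<bar>)"
    using S(1) fS by (intro sum_le_prod_ge_2) (auto simp: F_def Hi_def)
  also have "\<dots> \<le> int d"
    using S(1) d by (intro order_trans[OF stars_subdet[OF G]]) (auto simp: F_def Hi_def)
  finally show ?thesis by (simp add: Hi_def)
qed

text \<open>This is the edge-vertex incidence matrix of an odd cycle. Column 0 contains two ones;
  deleting it with either of their rows leaves a triangular matrix with unit diagonal, and both
  cofactors are \<open>+1\<close> because \<open>k - 1\<close> is even.\<close>

lemma det_cyclic_bidiagonal:
  assumes "odd k" "k \<ge> 3"
  shows "det (mat k k (\<lambda>(i, j). if j = i \<or> j = Suc i mod k then 1 else 0) :: int mat) = 2"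
proof -
  define A :: "int mat" where "A = mat k k (\<lambda>(i, j). if j = i \<or> j = Suc i mod k then 1 else 0)"
  obtain r where k: "k = Suc r" using assms(2) by (cases k) auto
  have r: "even r" "r \<ge> 2" using assms k by auto
  have A: "A \<in> carrier_mat k k" by (simp add: A_def)
  have ent: "A $$ (i, j) = (if j = i \<or> j = Suc i \<or> (j = 0 \<and> i = r) then 1 else 0)"
    if "i < k" "j < k" for i j
    using that r k by (cases "i = r") (auto simp: A_def)
  have col: "A $$ (i, 0) * cofactor A i 0 = (if i = 0 \<or> i = r then cofactor A i 0 else 0)" if "i < k" for i
    using ent[of i 0] that k by auto
  have "det A = (\<Sum>i<k. A $$ (i, 0) * cofactor A i 0)"
    using laplace_expansion_column[OF A, of 0] k by simp
  also have "\<dots> = (\<Sum>i<k. if i = 0 \<or> i = r then cofactor A i 0 else 0)"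
    using col by (intro sum.cong) auto
  also have "\<dots> = (\<Sum>i\<in>{0, r}. cofactor A i 0)"
    using k by (intro sum.mono_neutral_cong_right) auto
  also have "\<dots> = cofactor A 0 0 + cofactor A r 0" using r by simp
  also have "cofactor A 0 0 = 1"
  proof -
    have D: "mat_delete A 0 0 \<in> carrier_mat r r" using A k by (auto simp: mat_delete_def)
    have e: "mat_delete A 0 0 $$ (i, j) = A $$ (Suc i, Suc j)" if "i < r" "j < r" for i j
      using that A k by (simp add: mat_delete_def)
    have "det (mat_delete A 0 0) = prod_list (diag_mat (mat_delete A 0 0))"
      using D k e ent by (intro det_upper_triangular[OF _ D]) (auto simp: upper_triangular_def)
    also have "\<dots> = 1"
      unfolding prod_list_diag_prod using D k e ent by (intro prod.neutral) auto
    finally show ?thesis by (simp add: cofactor_def)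
  qed
  also have "cofactor A r 0 = 1"
  proof -
    have D: "mat_delete A r 0 \<in> carrier_mat r r" using A k by (auto simp: mat_delete_def)
    have e: "mat_delete A r 0 $$ (i, j) = A $$ (i, Suc j)" if "i < r" "j < r" for i j
      using that A k by (simp add: mat_delete_def)
    have "det (mat_delete A r 0) = prod_list (diag_mat (mat_delete A r 0))"
      using k e ent by (intro det_lower_triangular[OF _ D]) auto
    also have "\<dots> = 1"
      unfolding prod_list_diag_prod using D k e ent by (intro prod.neutral) auto
    finally show ?thesis using r by (simp add: cofactor_def)
  qed
  finally show ?thesis by (simp add: A_def)
qed

section \<open>Cycles: each contributes a subdeterminant 2\<close>

definition is_cycle :: "'a set set \<Rightarrow> 'a list \<Rightarrow> bool" where
  "is_cycle E c \<longleftrightarrow> 3 \<le> length c \<and> distinct c \<and> (\<forall>i<length c. {c ! i, c ! (Suc i mod length c)} \<in> E)"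

text \<open>The incidence matrix of the cycle serves when the length is odd. It is singular for even
  length; there the column of \<open>c ! 1\<close> is replaced by the two edges at
  \<open>c ! 1\<close>, and \<open>c ! 1\<close> itself becomes an additional row, which makes the
  order odd. Distinct vertices are never incident, so chords of the cycle do not show.\<close>

lemma cycle_gadget:
  assumes c: "is_cycle E c"
  obtains rs cs where "length rs = length cs" "distinct rs" "distinct cs"
    "set rs \<union> set cs \<subseteq> set c <+> {e \<in> E. e \<subseteq> set c}" "det (M_sub rs cs) = 2"
proof -
  define n where "n = length c"
  define ed where "ed i = {c ! i, c ! (Suc i mod n)}" for i
  have n: "3 \<le> n" and dc: "distinct c" and E: "\<And>i. i < n \<Longrightarrow> ed i \<in> E"
    using c by (auto simp: is_cycle_def n_def ed_def)
  have ci: "c ! i = c ! j \<longleftrightarrow> i = j" if "i < n" "j < n" for i j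
    using that dc by (simp add: nth_eq_iff_index_eq n_def)
  have inc: "c ! j \<in> ed i \<longleftrightarrow> j = i \<or> j = Suc i mod n" if "i < n" "j < n" for i j
    using that ci n by (auto simp: ed_def)
  have edi: "ed i = ed j \<longleftrightarrow> i = j" if ij: "i < n" "j < n" for i j
  proof
    assume eq: "ed i = ed j"
    have "j = i \<or> j = Suc i mod n" using inc[of i j] ij eq by (auto simp: ed_def)
    moreover have "i = j \<or> i = Suc j mod n" using inc[of j i] ij eq by (auto simp: ed_def)
    ultimately show "i = j" using ij n
      by (cases "Suc i = n"; cases "Suc j = n") auto
  qed simp
  have mem: "c ! i \<in> set c" "ed i \<subseteq> set c" if "i < n" for i
    using that n by (auto simp: n_def ed_def intro!: nth_mem mod_less_divisor)
  show thesis
  proof (cases "odd n")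
    case True
    let ?rs = "map (\<lambda>i. Inr (ed i)) [0..<n]" and ?cs = "map (\<lambda>i. Inl (c ! i)) [0..<n] :: 'a element list"
    have "M_sub ?rs ?cs = mat n n (\<lambda>(i, j). if j = i \<or> j = Suc i mod n then 1 else 0)"
      by (intro eq_matI) (auto simp: M_sub_def M_entry_def inc)
    then have "det (M_sub ?rs ?cs) = 2" using det_cyclic_bidiagonal[OF True n] by simp
    then show thesis using mem(1) subsetD[OF mem(2)] E by (intro that[of ?rs ?cs]) (auto simp: distinct_map inj_on_def edi ci)
  next
    case False
    then have n4: "4 \<le> n" using n by (cases "n = 3") auto
    define k where "k = Suc n"
    have k: "odd k" "3 \<le> k" using False n by (auto simp: k_def)
    \<comment> \<open>Rows in order: \<open>ed 0, c ! 1, ed 1, ..., ed (n - 1)\<close>. Columns in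
      order: \<open>c ! 0, ed 0, ed 1, c ! 2, ..., c ! (n - 1)\<close>. Row \<open>i\<close> meets
      exactly the columns \<open>i\<close> and \<open>i + 1\<close> modulo
      \<open>n + 1\<close>.\<close>
    define R :: "nat \<Rightarrow> 'a element" where
      "R i = (if i = 0 then Inr (ed 0) else if i = 1 then Inl (c ! 1) else Inr (ed (i - 1)))" for i
    define S :: "nat \<Rightarrow> 'a element" where
      "S j = (if j = 0 then Inl (c ! 0) else if j = 1 then Inr (ed 0) else if j = 2 then Inr (ed 1)
        else Inl (c ! (j - 1)))" for j
    have ent: "incident (R i) (S j) \<longleftrightarrow> j = i \<or> j = Suc i mod k" if ij: "i < k" "j < k" for i j
    proof -
      have md: "Suc i mod k = (if i = n then 0 else Suc i)" "Suc (i - 1) mod n = (if i = n then 0 else i)" if "2 \<le> i"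
        using ij that by (auto simp: k_def)
      have kk: "Suc 0 mod k = 1" "Suc (Suc 0) mod k = 2" "Suc 0 mod n = 1" using n by (auto simp: k_def)
      consider "i = 0" | "i = 1" | "2 \<le> i" by linarith
      then show ?thesis
      proof cases
        case 1
        then show ?thesis using ij n4 kk unfolding R_def S_def
          by (auto simp: inc edi ci k_def)
      next
        case 2
        then show ?thesis using ij n4 kk unfolding R_def S_def
          by (auto simp: inc edi ci k_def)
      next
        case 3
        then show ?thesis using ij n4 md unfolding R_def S_def
          by (auto simp: inc edi ci k_def)
      qed
    qed
    have Ri: "R i = R j \<Longrightarrow> i = j" if "i < k" "j < k" for i j
      using that n4 by (auto simp: R_def edi k_def split: if_splits)
    have Si: "S i = S j \<Longrightarrow> i = j" if "i < k" "j < k" for i j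
      using that n4 by (auto simp: S_def edi ci k_def split: if_splits)
    let ?rs = "map R [0..<k]" and ?cs = "map S [0..<k]"
    have "M_sub ?rs ?cs = mat k k (\<lambda>(i, j). if j = i \<or> j = Suc i mod k then 1 else 0)"
      by (intro eq_matI) (auto simp: M_sub_def M_entry_def ent)
    then have "det (M_sub ?rs ?cs) = 2" using det_cyclic_bidiagonal[OF k] by simp
    moreover have "R i \<in> set c <+> {e \<in> E. e \<subseteq> set c}" "S i \<in> set c <+> {e \<in> E. e \<subseteq> set c}" if "i < k" for i
      using that mem(1) E n4 by (auto simp: R_def S_def k_def dest: subsetD[OF mem(2), rotated])
    ultimately show thesis
      by (intro that[of ?rs ?cs]) (auto simp: distinct_map inj_on_def Ri Si)
  qed
qed

text \<open>The gadget of a cycle stays within its vertices and the edges spanned by them, so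
  gadgets of disjoint cycles have no incidences between them. Edges are nonempty, which keeps the
  edges of two gadgets distinct as well.\<close>

lemma disjoint_cycles_le:
  assumes G: "simple_graph V E" and d: "max_subdet V E \<le> int d"
    and cyc: "\<forall>c\<in>set cs. is_cycle E c" and disj: "sorted_wrt (\<lambda>c c'. set c \<inter> set c' = {}) cs"
  shows "2 ^ length cs \<le> d"
proof -
  define P where "P c g \<longleftrightarrow> length (fst g) = length (snd g) \<and> distinct (fst g) \<and> distinct (snd g) \<and>
    set (fst g) \<union> set (snd g) \<subseteq> set c <+> {e \<in> E. e \<subseteq> set c} \<and> det (M_sub (fst g) (snd g)) = 2"
    for c and g :: "'a element list \<times> 'a element list"
  have "\<exists>g. P c g" if c: "is_cycle E c" for c
  proof -
    obtain rs cs where "length rs = length cs" "distinct rs" "distinct cs"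
      "set rs \<union> set cs \<subseteq> set c <+> {e \<in> E. e \<subseteq> set c}" "det (M_sub rs cs) = 2"
      by (rule cycle_gadget[OF c])
    then show ?thesis by (intro exI[of _ "(rs, cs)"]) (simp add: P_def)
  qed
  then obtain g where "\<And>c. is_cycle E c \<Longrightarrow> P c (g c)" by metis
  note g = this[unfolded P_def]
  have ninc: "\<not> incident a b" and neq: "a \<noteq> b" if "set c \<inter> set c' = {}" "a \<in> set c <+> {e \<in> E. e \<subseteq> set c}"
    "b \<in> set c' <+> {e \<in> E. e \<subseteq> set c'}" for a b :: "'a element" and c c'
  proof -
    have ne: "e \<noteq> {}" if "e \<in> E" for e using that G by (auto simp: simple_graph_def)
    have "e \<noteq> e'" if "e \<in> E" "e \<subseteq> set c" "e' \<subseteq> set c'" for e e'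
      using ne[of e] that \<open>set c \<inter> set c' = {}\<close> by blast
    then show "\<not> incident a b" "a \<noteq> b" using that by (cases a; cases b; auto)+
  qed
  have "\<bar>det (M_sub (concat (map fst (map g cs))) (concat (map snd (map g cs))))\<bar> =
    (\<Prod>g\<leftarrow>map g cs. \<bar>det (M_sub (fst g) (snd g))\<bar>)"
  proof (rule det_M_sub_concat(1))
    show "sorted_wrt (\<lambda>g h. \<forall>a\<in>set (fst g). \<forall>b\<in>set (snd h). \<not> incident a b) (map g cs)"
      unfolding sorted_wrt_map
    proof (rule sorted_wrt_mono_rel[OF _ disj])
      fix c c' assume "c \<in> set cs" "c' \<in> set cs" "set c \<inter> set c' = {}"
      then show "\<forall>a\<in>set (fst (g c)). \<forall>b\<in>set (snd (g c')). \<not> incident a b"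
        using ninc[of c c'] g[of c] g[of c'] cyc by (meson Un_iff subsetD)
    qed
  qed (use g cyc in auto)
  also have "\<dots> = 2 ^ length cs"
    using cyc g by (induction cs) auto
  finally have eq: "\<bar>det (M_sub (concat (map fst (map g cs))) (concat (map snd (map g cs))))\<bar> = 2 ^ length cs" .
  have V: "set c \<subseteq> V" if "is_cycle E c" for c
  proof
    fix x assume "x \<in> set c"
    then obtain i where "i < length c" "x = c ! i" by (auto simp: in_set_conv_nth)
    then have "x \<in> {c ! i, c ! (Suc i mod length c)}" "{c ! i, c ! (Suc i mod length c)} \<in> E"
      using that by (auto simp: is_cycle_def)
    then show "x \<in> V" using G unfolding simple_graph_def by blast
  qed
  have props: "distinct (concat (map fst (map g cs))) \<and> distinct (concat (map snd (map g cs))) \<and>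
    length (concat (map fst (map g cs))) = length (concat (map snd (map g cs))) \<and>
    set (concat (map fst (map g cs))) \<subseteq> V <+> E \<and> set (concat (map snd (map g cs))) \<subseteq> V <+> E"
    using cyc disj
  proof (induction cs)
    case (Cons c cs)
    have gc: "set (fst (g c)) \<subseteq> set c <+> {e \<in> E. e \<subseteq> set c}" "set (snd (g c)) \<subseteq> set c <+> {e \<in> E. e \<subseteq> set c}"
      if "is_cycle E c" for c using g[OF that] by auto
    have sub: "set c' <+> {e \<in> E. e \<subseteq> set c'} \<subseteq> V <+> E" if "is_cycle E c'" for c' using V[OF that] by auto
    have d1: "set (fst (g c)) \<inter> set (fst (g c')) = {}" "set (snd (g c)) \<inter> set (snd (g c')) = {}"
      if "c' \<in> set cs" for c'
    proof -
      have c: "is_cycle E c" "is_cycle E c'" "set c \<inter> set c' = {}" using Cons.prems that by auto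
      show "set (fst (g c)) \<inter> set (fst (g c')) = {}" "set (snd (g c)) \<inter> set (snd (g c')) = {}"
        using neq[OF c(3) subsetD[OF gc(1)[OF c(1)]] subsetD[OF gc(1)[OF c(2)]]]
          neq[OF c(3) subsetD[OF gc(2)[OF c(1)]] subsetD[OF gc(2)[OF c(2)]]] by (auto simp: disjoint_iff)
    qed
    have c: "is_cycle E c" using Cons.prems by simp
    have "set (fst (g c)) \<subseteq> V <+> E" "set (snd (g c)) \<subseteq> V <+> E"
      using gc[OF c] sub[OF c] by (meson order_trans)+
    moreover have "set (fst (g c)) \<inter> (\<Union>c'\<in>set cs. set (fst (g c'))) = {}"
      "set (snd (g c)) \<inter> (\<Union>c'\<in>set cs. set (snd (g c'))) = {}" using d1 by blast+
    ultimately show ?case using Cons.IH Cons.prems g[OF c] by simp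
  qed simp
  then have "2 ^ length cs \<le> max_subdet V E"
    unfolding eq[symmetric] by (intro abs_det_le_max_subdet[OF G]) auto
  then have "(2::int) ^ length cs \<le> int d" using d by linarith
  then show ?thesis by (metis of_nat_le_iff of_nat_numeral of_nat_power)
qed

section \<open>Laying out paths on a line\<close>

fun dp_val :: "(nat \<Rightarrow> real) \<Rightarrow> nat \<Rightarrow> real" where
  "dp_val a 0 = 0"
| "dp_val a (Suc p) = max (dp_val a p) (a p + dp_val a (p - 2))"

text \<open>The comparison is strict so that only positions of positive weight are taken. Positions
  that are empty or hold a blocked element later get weight 0 and thereby drop out by
  themselves.\<close>

fun dp_set :: "(nat \<Rightarrow> real) \<Rightarrow> nat \<Rightarrow> nat set" where
  "dp_set a 0 = {}"
| "dp_set a (Suc p) = (if dp_val a p < a p + dp_val a (p - 2) then insert p (dp_set a (p - 2)) else dp_set a p)"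

definition separated :: "nat set \<Rightarrow> bool" where
  "separated Q \<longleftrightarrow> (\<forall>x\<in>Q. \<forall>y\<in>Q. x \<noteq> y \<longrightarrow> x + 2 < y \<or> y + 2 < x)"

lemma dp_val_mono: "p \<le> q \<Longrightarrow> dp_val a p \<le> dp_val a q"
  by (rule lift_Suc_mono_le[of "dp_val a"]) auto

text \<open>Position \<open>r\<close> is taken only if
  \<open>dp_val a r < a r + dp_val a (r - 2)\<close>; as
  \<open>dp_val a (r - 2) \<le> dp_val a r\<close> by monotonicity, \<open>a r\<close> is
  positive.\<close>

lemma dp_set_bound: "q \<in> dp_set a p \<Longrightarrow> q < p \<and> 0 < a q"
proof (induction p arbitrary: q rule: less_induct)
  case (less p)
  show ?case
  proof (cases p)
    case (Suc r)
    have "dp_val a (r - 2) \<le> dp_val a r" by (rule dp_val_mono) simp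
    then show ?thesis using less.prems less.IH[of "r - 2" q] less.IH[of r q] Suc
      by (fastforce split: if_splits)
  qed (use less in simp)
qed

lemma finite_dp_set: "finite (dp_set a p)"
  by (rule finite_subset[of _ "{..<p}"]) (auto dest: dp_set_bound)

lemma separated_dp_set: "separated (dp_set a p)"
proof (induction p rule: less_induct)
  case (less p)
  show ?case
  proof (cases p)
    case (Suc r)
    have "separated (dp_set a (r - 2))" "separated (dp_set a r)" using less Suc by auto
    moreover have "x + 2 < r" if "x \<in> dp_set a (r - 2)" for x using dp_set_bound[OF that] by linarith
    ultimately show ?thesis using Suc by (auto simp: separated_def)
  qed (simp add: separated_def)
qed

lemma sum_dp_set: "sum a (dp_set a p) = dp_val a p"
proof (induction p rule: less_induct)
  case (less p)
  show ?case
  proof (cases p)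
    case (Suc r)
    have "sum a (dp_set a (r - 2)) = dp_val a (r - 2)" "sum a (dp_set a r) = dp_val a r"
      using less Suc by auto
    moreover have "r \<notin> dp_set a (r - 2)" using dp_set_bound[of r a "r - 2"] by auto
    ultimately show ?thesis using Suc finite_dp_set by auto
  qed simp
qed

text \<open>If the last position \<open>r\<close> is used, separation pushes all others below
  \<open>r - 2\<close>. Truncated subtraction covers the start of the line: for
  \<open>r \<le> 2\<close> that range is empty.\<close>

lemma dp_val_upper: "Q \<subseteq> {..<p} \<Longrightarrow> separated Q \<Longrightarrow> sum a Q \<le> dp_val a p"
proof (induction p arbitrary: Q rule: less_induct)
  case (less p)
  show ?case
  proof (cases p)
    case 0
    then show ?thesis using less.prems by auto
  next
    case (Suc r)
    have fin: "finite Q" using less.prems(1) by (rule finite_subset) simp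
    show ?thesis
    proof (cases "r \<in> Q")
      case True
      have "Q - {r} \<subseteq> {..<r - 2}"
      proof
        fix x assume x: "x \<in> Q - {r}"
        then have "x < r" using less.prems(1) Suc by force
        then have "x + 2 < r" using less.prems(2) x True unfolding separated_def
          by (metis DiffD1 add.commute less_asym nat_neq_iff not_add_less2 trans_less_add2)
        then show "x \<in> {..<r - 2}" by auto
      qed
      then have "sum a (Q - {r}) \<le> dp_val a (r - 2)"
        using less.prems(2) Suc by (intro less.IH) (auto simp: separated_def)
      then show ?thesis using True fin Suc by (simp add: sum.remove)
    next
      case False
      then have "Q \<subseteq> {..<r}" using less.prems(1) Suc by (auto simp: less_Suc_eq)
      then have "sum a Q \<le> dp_val a r" using less.prems(2) Suc by (intro less.IH) auto
      then show ?thesis using Suc by simp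
    qed
  qed
qed

section \<open>Graphs on indices, edge ranks and conflicts\<close>

type_synonym elem = "nat + nat"

locale igraph =
  fixes n m :: nat and X Y :: "nat \<Rightarrow> nat"
  assumes X_less: "j < m \<Longrightarrow> X j < n" and Y_less: "j < m \<Longrightarrow> Y j < n"
    and X_neq_Y: "j < m \<Longrightarrow> X j \<noteq> Y j"
    and edge_inj: "i < m \<Longrightarrow> j < m \<Longrightarrow> {X i, Y i} = {X j, Y j} \<Longrightarrow> i = j"
begin

definition inc :: "nat \<Rightarrow> nat \<Rightarrow> bool" where "inc j v \<longleftrightarrow> X j = v \<or> Y j = v"

definition adj :: "nat \<Rightarrow> nat \<Rightarrow> bool" where "adj u v \<longleftrightarrow> (\<exists>j<m. {X j, Y j} = {u, v})"

definition nbrs :: "nat \<Rightarrow> nat set" where "nbrs v = {u. adj v u}"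

text \<open>The place of edge \<open>j\<close> in the list of edges at \<open>v\<close>. It names
  the edge by a number below the degree, which keeps the number of options per vertex
  bounded.\<close>

definition rk :: "nat \<Rightarrow> nat \<Rightarrow> nat" where "rk v j = card {i. i < j \<and> inc i v}"

definition deg :: "nat \<Rightarrow> nat" where "deg v = rk v m"

text \<open>Irreflexive, since there are no loops; therefore \<open>tmatch\<close> can quantify over
  all pairs.\<close>

fun conf :: "elem \<Rightarrow> elem \<Rightarrow> bool" where
  "conf (Inl u) (Inl v) \<longleftrightarrow> adj u v"
| "conf (Inl u) (Inr j) \<longleftrightarrow> inc j u"
| "conf (Inr j) (Inl u) \<longleftrightarrow> inc j u"
| "conf (Inr i) (Inr j) \<longleftrightarrow> i \<noteq> j \<and> (\<exists>v. inc i v \<and> inc j v)"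

definition tmatch :: "elem set \<Rightarrow> bool" where
  "tmatch T \<longleftrightarrow> T \<subseteq> {..<n} <+> {..<m} \<and> (\<forall>x\<in>T. \<forall>y\<in>T. \<not> conf x y)"

lemma adj_sym: "adj u v \<longleftrightarrow> adj v u" by (auto simp: adj_def insert_commute)

lemma adj_irrefl [simp]: "\<not> adj u u"
  unfolding adj_def by (metis X_neq_Y insert_absorb2 insert_iff singletonD)

lemma adj_less: "adj u v \<Longrightarrow> u < n \<and> v < n"
  using X_less Y_less by (auto simp: adj_def doubleton_eq_iff)

lemma conf_sym: "conf x y \<longleftrightarrow> conf y x" by (cases x; cases y) (auto simp: adj_sym)

lemma adj_edge: "j < m \<Longrightarrow> adj (X j) (Y j)" by (auto simp: adj_def)

lemma inc_edge: "j < m \<Longrightarrow> inc j u \<Longrightarrow> inc j v \<Longrightarrow> u \<noteq> v \<Longrightarrow> {X j, Y j} = {u, v}"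
  by (auto simp: inc_def)

lemma edge_unique: "i < m \<Longrightarrow> j < m \<Longrightarrow> inc i u \<Longrightarrow> inc i v \<Longrightarrow> inc j u \<Longrightarrow> inc j v \<Longrightarrow> u \<noteq> v \<Longrightarrow> i = j"
  using inc_edge[of i u v] inc_edge[of j u v] edge_inj by metis

lemma rk_0 [simp]: "rk v 0 = 0" by (simp add: rk_def)

lemma rk_Suc: "rk v (Suc j) = rk v j + (if inc j v then 1 else 0)"
proof -
  have "{i. i < Suc j \<and> inc i v} = {i. i < j \<and> inc i v} \<union> (if inc j v then {j} else {})"
    by (auto simp: less_Suc_eq)
  then show ?thesis by (auto simp: rk_def)
qed

lemma rk_mono: "i \<le> j \<Longrightarrow> rk v i \<le> rk v j"
  by (rule lift_Suc_mono_le[of "rk v"]) (auto simp: rk_Suc)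

lemma rk_strict: "i < j \<Longrightarrow> inc i v \<Longrightarrow> rk v i < rk v j"
  using rk_mono[of "Suc i" j v] by (simp add: rk_Suc)

lemma rk_inj: "inc i v \<Longrightarrow> inc j v \<Longrightarrow> rk v i = rk v j \<Longrightarrow> i = j"
  using rk_strict[of i j v] rk_strict[of j i v] by (metis less_irrefl linorder_neqE_nat)

lemma rk_less_deg: "j < m \<Longrightarrow> inc j v \<Longrightarrow> rk v j < deg v"
  by (simp add: deg_def rk_strict)

lemma finite_nbrs [simp]: "finite (nbrs v)"
  by (rule finite_subset[of _ "{..<n}"]) (auto simp: nbrs_def dest: adj_less)

text \<open>Sending an edge at \<open>v\<close> to its other end is a bijection onto the neighbours,
  because parallel edges are excluded.\<close>

lemma card_nbrs: "card (nbrs v) = deg v"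
proof -
  let ?J = "{j. j < m \<and> inc j v}" and ?o = "\<lambda>j. if X j = v then Y j else X j"
  have "inj_on ?o ?J"
  proof (rule inj_onI)
    fix i j assume ij: "i \<in> ?J" "j \<in> ?J" "?o i = ?o j"
    then have "inc i (?o i)" "inc j (?o i)" "?o i \<noteq> v" using X_neq_Y[of i] by (auto simp: inc_def)
    then show "i = j" using edge_unique[of i j v "?o i"] ij by auto
  qed
  moreover have "?o ` ?J = nbrs v"
  proof
    show "?o ` ?J \<subseteq> nbrs v" using adj_edge adj_sym by (auto simp: nbrs_def inc_def)
    show "nbrs v \<subseteq> ?o ` ?J"
    proof
      fix u assume "u \<in> nbrs v"
      then obtain j where "j < m" "{X j, Y j} = {v, u}" by (auto simp: nbrs_def adj_def)
      then have "j \<in> ?J" "u = ?o j" using X_neq_Y[of j] by (auto simp: inc_def doubleton_eq_iff)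
      then show "u \<in> ?o ` ?J" by blast
    qed
  qed
  ultimately have "card ?J = card (nbrs v)" using card_image[of ?o ?J] by simp
  then show ?thesis by (simp add: deg_def rk_def)
qed

section \<open>Layouts on a line and their growth along walks\<close>

abbreviation pos :: "(nat \<Rightarrow> nat) \<Rightarrow> (nat \<Rightarrow> nat) \<Rightarrow> elem \<Rightarrow> nat" where
  "pos pv pe \<equiv> case_sum pv pe"

text \<open>Elements are laid out on a line so that conflicts become closeness; position 0 means ``not placed''.\<close>

definition layout :: "(nat \<Rightarrow> nat) \<Rightarrow> (nat \<Rightarrow> nat) \<Rightarrow> (nat \<Rightarrow> nat) \<Rightarrow> bool" where
  "layout hx pv pe \<longleftrightarrow>
     (\<forall>v. pv v \<noteq> 0 \<longrightarrow> v < n \<and> hx v = 0) \<and>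
     (\<forall>j. pe j \<noteq> 0 \<longleftrightarrow> j < m \<and> pv (X j) \<noteq> 0 \<and> pv (Y j) \<noteq> 0) \<and>
     (\<forall>x y. pos pv pe x \<noteq> 0 \<longrightarrow> pos pv pe x = pos pv pe y \<longrightarrow> x = y) \<and>
     (\<forall>x y. x \<noteq> y \<longrightarrow> pos pv pe x \<noteq> 0 \<longrightarrow> pos pv pe y \<noteq> 0 \<longrightarrow>
        (conf x y \<longleftrightarrow> pos pv pe x \<le> pos pv pe y + 2 \<and> pos pv pe y \<le> pos pv pe x + 2))"

definition free_nbrs :: "(nat \<Rightarrow> nat) \<Rightarrow> (nat \<Rightarrow> nat) \<Rightarrow> nat \<Rightarrow> nat set" where
  "free_nbrs hx pv v = {u. adj v u \<and> hx u = 0 \<and> pv u = 0}"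

text \<open>The state between two walks. The margin below \<open>L\<close> makes position
  \<open>L\<close> too far away to conflict with anything placed. A path on \<open>k\<close>
  vertices takes \<open>2 * k - 1\<close> positions and two empty ones, at most \<open>3 * k\<close>
  in all; this gives the bound on \<open>L\<close>.\<close>

definition closed_layout :: "(nat \<Rightarrow> nat) \<Rightarrow> (nat \<Rightarrow> nat) \<Rightarrow> (nat \<Rightarrow> nat) \<Rightarrow> nat \<Rightarrow> bool" where
  "closed_layout hx pv pe L \<longleftrightarrow> layout hx pv pe \<and>
     (\<forall>v. pv v \<noteq> 0 \<longrightarrow> free_nbrs hx pv v = {}) \<and>
     (\<forall>x. pos pv pe x \<noteq> 0 \<longrightarrow> pos pv pe x + 2 < L) \<and> 3 \<le> L \<and>
     L \<le> 3 + 3 * card {v. pv v \<noteq> 0}"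

text \<open>The state during a walk, with the last vertex \<open>cur\<close> at position
  \<open>L - 1\<close>. Only the edge through which \<open>cur\<close> was reached may sit at
  \<open>L - 2\<close>. The bound on \<open>L\<close> already reserves the two empty positions
  behind the path.\<close>

definition walk_layout :: "(nat \<Rightarrow> nat) \<Rightarrow> (nat \<Rightarrow> nat) \<Rightarrow> (nat \<Rightarrow> nat) \<Rightarrow> nat \<Rightarrow> nat \<Rightarrow> bool" where
  "walk_layout hx pv pe L cur \<longleftrightarrow> layout hx pv pe \<and> pv cur \<noteq> 0 \<and> Suc (pv cur) = L \<and> 3 \<le> L \<and>
     (\<forall>v. pv v \<noteq> 0 \<longrightarrow> v \<noteq> cur \<longrightarrow> free_nbrs hx pv v = {}) \<and>
     (\<forall>x. pos pv pe x \<noteq> 0 \<longrightarrow> x \<noteq> Inl cur \<longrightarrow>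
        Suc (pos pv pe x) < L \<and> (L \<le> pos pv pe x + 2 \<longleftrightarrow> (\<exists>j. x = Inr j \<and> inc j cur))) \<and>
     card (free_nbrs hx pv cur) \<le> 1 \<and>
     L + 2 \<le> 3 + 3 * card {v. pv v \<noteq> 0}"

lemma finite_free_nbrs [simp]: "finite (free_nbrs hx pv v)"
  by (rule finite_subset[OF _ finite_nbrs[of v]]) (auto simp: free_nbrs_def nbrs_def)

lemma finite_placed: "layout hx pv pe \<Longrightarrow> finite {v. pv v \<noteq> 0}"
  by (rule finite_subset[of _ "{..<n}"]) (auto simp: layout_def)

text \<open>Placed vertices have no free neighbours, so the unplaced \<open>cur\<close> has no
  placed neighbour and conflicts with nothing on the line. With at most one free neighbour it is an
  end of what remains of its path.\<close>

lemma walk_start: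
  assumes C: "closed_layout hx pv pe L" and cur: "cur < n" "hx cur = 0" "pv cur = 0"
    and N: "card (free_nbrs hx pv cur) \<le> 1"
  shows "walk_layout hx (pv(cur := L)) pe (Suc L) cur"
proof -
  have L: "layout hx pv pe" and clo: "\<And>v. pv v \<noteq> 0 \<Longrightarrow> free_nbrs hx pv v = {}"
    and gap: "\<And>x. pos pv pe x \<noteq> 0 \<Longrightarrow> pos pv pe x + 2 < L" and L3: "3 \<le> L"
    and Lc: "L \<le> 3 + 3 * card {v. pv v \<noteq> 0}"
    using C by (auto simp: closed_layout_def)
  have noadj: "\<not> adj v cur" if "pv v \<noteq> 0" for v
    using clo[OF that] cur by (auto simp: free_nbrs_def)
  have pe: "pe j \<noteq> 0 \<longleftrightarrow> j < m \<and> pv (X j) \<noteq> 0 \<and> pv (Y j) \<noteq> 0" for j using L by (auto simp: layout_def)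
  have noinc: "\<not> inc j cur" if "pe j \<noteq> 0" for j using pe[of j] that cur by (auto simp: inc_def)
  have pos': "pos (pv(cur := L)) pe x = (if x = Inl cur then L else pos pv pe x)" for x
    by (cases x) auto
  have noconf: "\<not> conf (Inl cur) x" "\<not> conf x (Inl cur)" if "pos pv pe x \<noteq> 0" for x
    using that noadj noinc by (cases x; auto simp: adj_sym)+
  have pcur: "pos pv pe (Inl cur) = 0" using cur by simp
  have lay: "layout hx (pv(cur := L)) pe"
    unfolding layout_def
  proof (intro conjI allI impI)
    fix v assume "(pv(cur := L)) v \<noteq> 0"
    then show "v < n" "hx v = 0" using L cur by (auto simp: layout_def split: if_splits)
  next
    fix j show "pe j \<noteq> 0 \<longleftrightarrow> j < m \<and> (pv(cur := L)) (X j) \<noteq> 0 \<and> (pv(cur := L)) (Y j) \<noteq> 0"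
    proof (cases "j < m \<and> inc j cur")
      case True
      then have "adj (X j) (Y j)" "X j = cur \<or> Y j = cur" "X j \<noteq> Y j"
        using adj_edge X_neq_Y by (auto simp: inc_def)
      then show ?thesis using pe[of j] noadj[of "X j"] noadj[of "Y j"] cur by (auto simp: adj_sym)
    next
      case False
      then show ?thesis using pe[of j] by (auto simp: inc_def)
    qed
  next
    fix x y assume "pos (pv(cur := L)) pe x \<noteq> 0" "pos (pv(cur := L)) pe x = pos (pv(cur := L)) pe y"
    then show "x = y" using L gap[of x] gap[of y] unfolding pos'
      by (auto simp: layout_def split: if_splits)
  next
    fix x y assume *: "x \<noteq> y" "pos (pv(cur := L)) pe x \<noteq> 0" "pos (pv(cur := L)) pe y \<noteq> 0"
    show "conf x y \<longleftrightarrow> pos (pv(cur := L)) pe x \<le> pos (pv(cur := L)) pe y + 2 \<and>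
      pos (pv(cur := L)) pe y \<le> pos (pv(cur := L)) pe x + 2"
    proof (cases "x = Inl cur \<or> y = Inl cur")
      case True
      then show ?thesis using * gap[of x] gap[of y] noconf[of x] noconf[of y] unfolding pos'
        by (auto split: if_splits)
    next
      case False
      then show ?thesis using * L unfolding pos' layout_def by auto
    qed
  qed
  have "{v. (pv(cur := L)) v \<noteq> 0} = insert cur {v. pv v \<noteq> 0}" using L3 by auto
  then have card: "card {v. (pv(cur := L)) v \<noteq> 0} = Suc (card {v. pv v \<noteq> 0})"
    using finite_placed[OF L] cur by simp
  have fn: "free_nbrs hx (pv(cur := L)) v = free_nbrs hx pv v - {cur}" for v
    using L3 by (auto simp: free_nbrs_def)
  have fc: "free_nbrs hx pv cur - {cur} = free_nbrs hx pv cur" by (auto simp: free_nbrs_def)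
  show ?thesis unfolding walk_layout_def
  proof (intro conjI allI impI)
    fix x assume *: "pos (pv(cur := L)) pe x \<noteq> 0" "x \<noteq> Inl cur"
    then have "pos pv pe x \<noteq> 0" by (simp add: pos')
    from gap[OF this] show "Suc (pos (pv(cur := L)) pe x) < Suc L" using * by (simp add: pos')
    show "Suc L \<le> pos (pv(cur := L)) pe x + 2 \<longleftrightarrow> (\<exists>j. x = Inr j \<and> inc j cur)"
      using gap[OF \<open>pos pv pe x \<noteq> 0\<close>] * noinc \<open>pos pv pe x \<noteq> 0\<close> by (auto simp: pos')
  qed (use lay L3 Lc card fn fc clo N in \<open>auto split: if_splits\<close>)
qed

text \<open>The new edge conflicts with \<open>cur\<close> and the edge before it, the new vertex
  with the new edge and \<open>cur\<close>: exactly the elements at distance at most 2. No other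
  placed vertex is adjacent to \<open>u\<close>, since it would have a free neighbour. One of the at
  most two neighbours of \<open>u\<close> is \<open>cur\<close>, so the walk can continue in at most
  one direction.\<close>

lemma walk_extend:
  assumes W: "walk_layout hx pv pe L cur" and u: "u \<in> free_nbrs hx pv cur"
    and j: "j < m" "{X j, Y j} = {cur, u}" and du: "deg u \<le> 2"
  shows "walk_layout hx (pv(u := Suc L)) (pe(j := L)) (Suc (Suc L)) u"
proof -
  have L: "layout hx pv pe" and clo: "\<And>v. pv v \<noteq> 0 \<Longrightarrow> v \<noteq> cur \<Longrightarrow> free_nbrs hx pv v = {}"
    and gap: "\<And>x. pos pv pe x \<noteq> 0 \<Longrightarrow> x \<noteq> Inl cur \<Longrightarrow>
        Suc (pos pv pe x) < L \<and> (L \<le> pos pv pe x + 2 \<longleftrightarrow> (\<exists>j. x = Inr j \<and> inc j cur))"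
    and cur: "pv cur \<noteq> 0" "Suc (pv cur) = L" and L3: "3 \<le> L" and N: "card (free_nbrs hx pv cur) \<le> 1"
    and Lc: "L + 2 \<le> 3 + 3 * card {v. pv v \<noteq> 0}"
    using W by (auto simp: walk_layout_def)
  have u': "adj cur u" "hx u = 0" "pv u = 0" "u < n" using u adj_less by (auto simp: free_nbrs_def)
  have uc: "u \<noteq> cur" using u' cur by auto
  have Nu: "free_nbrs hx pv cur = {u}"
    using N u card_le_Suc0_iff_eq[of "free_nbrs hx pv cur"] by auto
  have adju: "adj v u \<longleftrightarrow> v = cur" if "pv v \<noteq> 0" for v
    using clo[OF that] u' by (auto simp del: neq0_conv simp: free_nbrs_def)
  have pe: "pe j \<noteq> 0 \<longleftrightarrow> j < m \<and> pv (X j) \<noteq> 0 \<and> pv (Y j) \<noteq> 0" for j using L by (auto simp: layout_def)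
  have noinc: "\<not> inc i u" if "pe i \<noteq> 0" for i using pe[of i] that u' by (auto simp: inc_def)
  have incj: "inc j v \<longleftrightarrow> v = cur \<or> v = u" for v using j(2) by (auto simp: inc_def doubleton_eq_iff)
  have pj: "pe j = 0" using noinc[of j] incj by auto
  have pos': "pos (pv(u := Suc L)) (pe(j := L)) x =
    (if x = Inl u then Suc L else if x = Inr j then L else pos pv pe x)" for x
    by (cases x) auto
  let ?pos = "pos (pv(u := Suc L)) (pe(j := L))"
  have le: "Suc (pos pv pe x) \<le> L" if "pos pv pe x \<noteq> 0" for x
    using gap[OF that] cur by (cases "x = Inl cur") auto
  have cj: "conf x (Inr j) \<longleftrightarrow> L \<le> pos pv pe x + 2" if x: "pos pv pe x \<noteq> 0" for x
  proof (cases x)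
    case (Inl v)
    have "v \<noteq> u" using x Inl u' by auto
    then show ?thesis using Inl x cur gap[of x] incj[of v] by (cases "v = cur") auto
  next
    case (Inr i)
    have "i \<noteq> j" "\<not> inc i u" using x Inr pj noinc[of i] by auto
    then have "conf x (Inr j) \<longleftrightarrow> inc i cur" using Inr incj by auto
    then show ?thesis using gap[OF x] Inr by auto
  qed
  have cu: "conf x (Inl u) \<longleftrightarrow> L \<le> Suc (pos pv pe x)" if x: "pos pv pe x \<noteq> 0" for x
  proof (cases x)
    case (Inl v)
    then show ?thesis using x cur gap[of x] adju[of v] by (cases "v = cur") auto
  next
    case (Inr i)
    then show ?thesis using x gap[of x] noinc[of i] by auto
  qed
  have lay: "layout hx (pv(u := Suc L)) (pe(j := L))"
    unfolding layout_def
  proof (intro conjI allI impI)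
    fix v assume "(pv(u := Suc L)) v \<noteq> 0"
    then show "v < n" "hx v = 0" using L u' by (auto simp: layout_def split: if_splits)
  next
    \<comment> \<open>Placing \<open>u\<close> completes no edge except \<open>j\<close>: an edge
      from \<open>u\<close> to a placed vertex leads to \<open>cur\<close>, and there is only one
      such edge.\<close>
    fix i show "(pe(j := L)) i \<noteq> 0 \<longleftrightarrow> i < m \<and> (pv(u := Suc L)) (X i) \<noteq> 0 \<and> (pv(u := Suc L)) (Y i) \<noteq> 0"
    proof (cases "i < m \<and> inc i u \<and> i \<noteq> j")
      case True
      then have pi: "pe i = 0" using noinc by auto
      obtain w where w: "{X i, Y i} = {u, w}" using True by (auto simp: inc_def)
      then have "adj w u" "w \<noteq> u" using True X_neq_Y[of i] by (auto simp: adj_def doubleton_eq_iff)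
      moreover have "w \<noteq> cur"
        using w edge_inj[of i j] True j by (metis insert_commute)
      ultimately have "pv w = 0" using adju[of w] by auto
      then show ?thesis using w True \<open>w \<noteq> u\<close> pi by (auto simp: doubleton_eq_iff)
    next
      case False
      then show ?thesis using pe[of i] j cur L3 by (cases "i = j") (auto simp: inc_def doubleton_eq_iff)
    qed
  next
    fix x y assume "?pos x \<noteq> 0" "?pos x = ?pos y"
    then show "x = y" using L le[of x] le[of y] unfolding pos'
      by (auto simp: layout_def split: if_splits)
  next
    fix x y assume *: "x \<noteq> y" "?pos x \<noteq> 0" "?pos y \<noteq> 0"
    have old: "conf x y \<longleftrightarrow> ?pos x \<le> ?pos y + 2 \<and> ?pos y \<le> ?pos x + 2"
      if "x \<notin> {Inl u, Inr j}" "y \<notin> {Inl u, Inr j}"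
      using that * L unfolding pos' layout_def by auto
    have new: "conf x (Inr j) \<longleftrightarrow> L \<le> ?pos x + 2" "conf x (Inl u) \<longleftrightarrow> Suc L \<le> ?pos x + 2"
      "Suc (?pos x) \<le> L"
      if "x \<notin> {Inl u, Inr j}" "?pos x \<noteq> 0" for x
      using that cj[of x] cu[of x] le[of x] unfolding pos' by auto
    have uj: "conf (Inl u) (Inr j)" "conf (Inr j) (Inl u)" using incj by auto
    consider "x \<notin> {Inl u, Inr j}" "y \<notin> {Inl u, Inr j}" | "x \<in> {Inl u, Inr j}" "y \<notin> {Inl u, Inr j}"
      | "x \<notin> {Inl u, Inr j}" "y \<in> {Inl u, Inr j}" | "x \<in> {Inl u, Inr j}" "y \<in> {Inl u, Inr j}" by blast
    then show "conf x y \<longleftrightarrow> ?pos x \<le> ?pos y + 2 \<and> ?pos y \<le> ?pos x + 2"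
    proof cases
      case 1 then show ?thesis by (rule old)
    next
      case 2
      then show ?thesis using new[OF 2(2) *(3)] conf_sym[of x y] by (auto simp: pos')
    next
      case 3
      then show ?thesis using new[OF 3(1) *(2)] by (auto simp: pos')
    next
      case 4
      then show ?thesis using uj *(1) by (auto simp: pos')
    qed
  qed
  have "{v. (pv(u := Suc L)) v \<noteq> 0} = insert u {v. pv v \<noteq> 0}" by auto
  then have card: "card {v. (pv(u := Suc L)) v \<noteq> 0} = Suc (card {v. pv v \<noteq> 0})"
    using finite_placed[OF L] u' by simp
  have fn: "free_nbrs hx (pv(u := Suc L)) v = free_nbrs hx pv v - {u}" for v
    by (auto simp: free_nbrs_def)
  have "free_nbrs hx (pv(u := Suc L)) u \<subseteq> nbrs u - {cur}"
    using cur uc by (auto simp: free_nbrs_def nbrs_def)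
  then have "card (free_nbrs hx (pv(u := Suc L)) u) \<le> card (nbrs u - {cur})"
    by (intro card_mono) auto
  also have "\<dots> = deg u - 1"
    using u' adj_sym[of cur u] by (subst card_Diff_singleton) (auto simp: nbrs_def card_nbrs[unfolded nbrs_def])
  finally have cN: "card (free_nbrs hx (pv(u := Suc L)) u) \<le> 1" using du by simp
  show ?thesis unfolding walk_layout_def
  proof (intro conjI allI impI)
    fix x assume *: "?pos x \<noteq> 0" "x \<noteq> Inl u"
    show "Suc (?pos x) < Suc (Suc L)" using * le[of x] by (auto simp: pos')
    show "Suc (Suc L) \<le> ?pos x + 2 \<longleftrightarrow> (\<exists>j. x = Inr j \<and> inc j u)"
      using * le[of x] noinc incj by (cases x) (auto simp: pos')
  next
    fix v assume "(pv(u := Suc L)) v \<noteq> 0" "v \<noteq> u"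
    then show "free_nbrs hx (pv(u := Suc L)) v = {}" using clo[of v] Nu fn by (cases "v = cur") auto
  qed (use lay L3 Lc card cN in auto)
qed

lemma walk_close:
  assumes W: "walk_layout hx pv pe L cur" and N: "free_nbrs hx pv cur = {}"
  shows "closed_layout hx pv pe (Suc (Suc L))"
proof -
  have gap: "\<And>x. pos pv pe x \<noteq> 0 \<Longrightarrow> x \<noteq> Inl cur \<Longrightarrow> Suc (pos pv pe x) < L"
    and cur: "pv cur \<noteq> 0" "Suc (pv cur) = L"
    and clo: "\<And>v. pv v \<noteq> 0 \<Longrightarrow> v \<noteq> cur \<Longrightarrow> free_nbrs hx pv v = {}"
    using W by (auto simp: walk_layout_def)
  have "pos pv pe x + 2 < Suc (Suc L)" if "pos pv pe x \<noteq> 0" for x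
    using gap[OF that] cur by (cases "x = Inl cur") auto
  moreover have "free_nbrs hx pv v = {}" if "pv v \<noteq> 0" for v
    using clo[OF that] N by (cases "v = cur") auto
  ultimately show ?thesis using W by (simp add: closed_layout_def walk_layout_def)
qed

text \<open>An edge from \<open>cur\<close> to a placed vertex is itself placed, and it must lie at
  \<open>L - 2\<close>; positions are injective. This will show that a walk around an opened cycle
  ends next to the deleted vertex and not next to its own path.\<close>

lemma walk_one_placed_nbr:
  assumes W: "walk_layout hx pv pe L cur" and "adj cur a" "adj cur b" "pv a \<noteq> 0" "pv b \<noteq> 0"
  shows "a = b"
proof -
  have lay: "layout hx pv pe" and cur: "pv cur \<noteq> 0" using W by (auto simp: walk_layout_def)
  have gap: "pe j \<noteq> 0 \<Longrightarrow> inc j cur \<Longrightarrow> pe j + 2 = L" for j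
    using W unfolding walk_layout_def by (auto dest!: spec[of _ "Inr j"])
  have ed: "\<exists>j<m. {X j, Y j} = {cur, c} \<and> inc j cur \<and> pe j + 2 = L" if c: "adj cur c" "pv c \<noteq> 0" for c
  proof -
    obtain j where j: "j < m" "{X j, Y j} = {cur, c}" using c(1) unfolding adj_def by blast
    then have "pe j \<noteq> 0" "inc j cur" using lay c cur by (auto simp: layout_def inc_def doubleton_eq_iff)
    then show ?thesis using j gap by blast
  qed
  obtain i where i: "{X i, Y i} = {cur, a}" "pe i + 2 = L" "i < m" "inc i cur" using ed assms by blast
  obtain j where j: "{X j, Y j} = {cur, b}" "pe j + 2 = L" "j < m" "inc j cur" using ed assms by blast
  have "pe i \<noteq> 0" using i lay cur assms(4) by (auto simp: layout_def doubleton_eq_iff)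
  then have "(Inr i :: elem) = Inr j" using lay i j unfolding layout_def
    by (metis add_right_cancel old.sum.simps(6))
  then have "{cur, a} = {cur, b}" using i j by simp
  then show "a = b" using assms adj_irrefl by (auto simp: doubleton_eq_iff)
qed

section \<open>The cycles that remain after the paths have been placed\<close>

definition edge_sets :: "nat set set" where "edge_sets = {{X j, Y j} | j. j < m}"

lemma adj_edge_sets: "adj u v \<longleftrightarrow> {u, v} \<in> edge_sets"
  by (auto simp: adj_def edge_sets_def)

lemma path_closes_to_cycle:
  assumes "2 \<le> length pth" "distinct pth" "\<And>i. Suc i < length pth \<Longrightarrow> adj (pth ! i) (pth ! Suc i)"
    and "adj v (hd pth)" "adj (last pth) v" "v \<notin> set pth"
  shows "is_cycle edge_sets (v # pth)"
  unfolding is_cycle_def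
proof (intro conjI allI impI)
  fix i assume i: "i < length (v # pth)"
  have ne: "pth \<noteq> []" using assms(1) by auto
  consider "i = 0" | "i = length pth" "i \<noteq> 0" | k where "i = Suc k" "Suc k < length pth"
    using i ne by (cases i) (auto simp: less_Suc_eq)
  then show "{(v # pth) ! i, (v # pth) ! (Suc i mod length (v # pth))} \<in> edge_sets"
  proof cases
    case 1
    then show ?thesis using assms(4) ne by (auto simp: adj_edge_sets hd_conv_nth)
  next
    case 2
    then show ?thesis using assms(5) ne by (auto simp: adj_edge_sets last_conv_nth nth_Cons')
  next
    case (3 k)
    then show ?thesis using assms(3)[of k] by (auto simp: adj_edge_sets)
  qed
qed (use assms in auto)

definition low :: "nat \<Rightarrow> bool" where "low v \<longleftrightarrow> v < n \<and> deg v \<le> 2"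

text \<open>Deleted vertices of degree at least 3 are left out: a deleted vertex counts only if it
  has degree at most 2, that is, if its deletion opened a cycle.\<close>

definition processed :: "(nat \<Rightarrow> nat) \<Rightarrow> (nat \<Rightarrow> nat) \<Rightarrow> nat set" where
  "processed hx pv = {v. pv v \<noteq> 0 \<or> low v \<and> hx v \<noteq> 0}"

text \<open>The unprocessed low vertices induce a 2-regular graph without edges to the processed ones, i.e. a
  disjoint union of cycles.\<close>

definition cycles_left :: "(nat \<Rightarrow> nat) \<Rightarrow> (nat \<Rightarrow> nat) \<Rightarrow> bool" where
  "cycles_left hx pv \<longleftrightarrow> (\<forall>v<n. \<not> low v \<longrightarrow> hx v \<noteq> 0) \<and>
     (\<forall>u v. adj u v \<longrightarrow> u \<in> processed hx pv \<longrightarrow> low v \<longrightarrow> v \<in> processed hx pv) \<and>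
     (\<forall>v. low v \<longrightarrow> v \<notin> processed hx pv \<longrightarrow> deg v = 2 \<and> (\<forall>u\<in>nbrs v. low u))"

text \<open>A ghost record of a walk. The program stores only positions; the list of newly placed
  vertices exists to exhibit the cycle afterwards.\<close>

definition path_of :: "(nat \<Rightarrow> nat) \<Rightarrow> (nat \<Rightarrow> nat) \<Rightarrow> nat \<Rightarrow> nat \<Rightarrow> nat list \<Rightarrow> bool" where
  "path_of pv pv' a b pth \<longleftrightarrow> pth \<noteq> [] \<and> hd pth = a \<and> last pth = b \<and> distinct pth \<and>
     (\<forall>i. Suc i < length pth \<longrightarrow> adj (pth ! i) (pth ! Suc i)) \<and>
     (\<forall>v. pv' v \<noteq> 0 \<longleftrightarrow> pv v \<noteq> 0 \<or> v \<in> set pth) \<and> (\<forall>v\<in>set pth. pv v = 0)"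

lemma path_of_start: "pv a = 0 \<Longrightarrow> l \<noteq> 0 \<Longrightarrow> path_of pv (pv(a := l)) a a [a]"
  by (auto simp: path_of_def)

lemma path_of_extend:
  assumes p: "path_of pv pv' a b pth" and u: "adj b u" "pv' u = 0" "l \<noteq> 0"
  shows "path_of pv (pv'(u := l)) a u (pth @ [u])"
proof -
  have "u \<notin> set pth" "pv u = 0" using p u(2) unfolding path_of_def by metis+
  moreover have "adj ((pth @ [u]) ! i) ((pth @ [u]) ! Suc i)" if "Suc i < length (pth @ [u])" for i
  proof (cases "Suc i = length pth")
    case True
    then have "i = length pth - 1" by simp
    then have "(pth @ [u]) ! i = b" using p by (auto simp: path_of_def last_conv_nth nth_append)
    then show ?thesis using True u by (auto simp: nth_append)
  next
    case False
    then show ?thesis using p that by (auto simp: path_of_def nth_append)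
  qed
  ultimately show ?thesis using p u by (auto simp: path_of_def)
qed

text \<open>The walk starts at a neighbour \<open>u\<close> of the deleted \<open>v\<close>. At its
  last vertex \<open>t\<close> nothing is free and only one neighbour is placed, but
  \<open>t\<close> has degree 2, so its other neighbour is \<open>v\<close> and the cycle closes.
  Then \<open>u\<close> and \<open>t\<close> are all the neighbours of \<open>v\<close>, and no
  unprocessed vertex is adjacent to the cycle.\<close>

lemma walk_around_cycle:
  assumes S: "cycles_left hx pv" and v: "v < n" "hx v = 0" "pv v = 0" and k: "k \<noteq> 0"
    and W: "walk_layout (hx(v := k)) pv' pe' L t" and N: "free_nbrs (hx(v := k)) pv' t = {}"
    and p: "path_of pv pv' u t pth" and u: "adj v u"
  shows "is_cycle edge_sets (v # pth)" "cycles_left (hx(v := k)) pv'"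
    "processed (hx(v := k)) pv' = processed hx pv \<union> set (v # pth)" "set (v # pth) \<inter> processed hx pv = {}"
proof -
  have lv: "low v" using S v by (auto simp: cycles_left_def)
  have pl: "w < n" "(hx(v := k)) w = 0" if "pv' w \<noteq> 0" for w
    using W that by (auto simp: walk_layout_def layout_def)
  have vp: "v \<notin> set pth" using pl(2)[of v] p k by (auto simp: path_of_def)
  have nvp: "v \<notin> processed hx pv" using v by (auto simp: processed_def)
  have pth_un: "w \<notin> processed hx pv" "low w" if "w \<in> set pth" for w
  proof -
    have "pv' w \<noteq> 0" "pv w = 0" using p that by (auto simp: path_of_def)
    moreover have "w \<noteq> v" using that vp by auto
    ultimately have "hx w = 0" "w < n" using pl[of w] by auto
    then show "w \<notin> processed hx pv" "low w" using \<open>pv w = 0\<close> S by (auto simp: processed_def cycles_left_def)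
  qed
  show proc: "processed (hx(v := k)) pv' = processed hx pv \<union> set (v # pth)"
    using p lv k by (auto simp: processed_def path_of_def)
  show "set (v # pth) \<inter> processed hx pv = {}" using nvp pth_un by auto
  have un_nbr: "low a \<and> a \<notin> processed hx pv" if "adj w a" "w \<notin> processed hx pv" "low w" for w a
  proof -
    have "low a" using S that by (auto simp: cycles_left_def nbrs_def)
    then show ?thesis using S that adj_sym by (auto simp: cycles_left_def)
  qed
  have tp: "t \<in> set pth" using p by (auto simp: path_of_def)
  have clo: "free_nbrs (hx(v := k)) pv' w = {}" if "pv' w \<noteq> 0" for w
    using W N that by (cases "w = t") (auto simp: walk_layout_def)
  have nb: "a = v \<or> a \<in> set pth" if "w \<in> set pth" "adj w a" for w a
  proof (rule ccontr)
    assume a: "\<not> ?thesis"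
    have "low a" "a \<notin> processed hx pv" using un_nbr[OF that(2) pth_un[OF that(1)]] by auto
    then have "hx a = 0" "pv a = 0" by (auto simp: processed_def)
    moreover have "pv' a = 0" using a p \<open>pv a = 0\<close> unfolding path_of_def by metis
    ultimately have "hx a = 0" "pv' a = 0" by auto
    then have "a \<in> free_nbrs (hx(v := k)) pv' w" using a that by (auto simp: free_nbrs_def)
    moreover have "pv' w \<noteq> 0" using p that by (auto simp: path_of_def)
    ultimately show False using clo by auto
  qed
  have card2: "card (nbrs w) = 2" if "w \<notin> processed hx pv" "low w" for w
    using S that by (auto simp: cycles_left_def card_nbrs)
  have "adj t v"
  proof (rule ccontr)
    assume "\<not> adj t v"
    then have "nbrs t \<subseteq> set pth" using nb[OF tp] by (auto simp: nbrs_def)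
    then have "\<forall>a\<in>nbrs t. pv' a \<noteq> 0" using p by (auto simp: path_of_def)
    then have "\<forall>a\<in>nbrs t. \<forall>b\<in>nbrs t. a = b"
      using walk_one_placed_nbr[OF W] by (auto simp: nbrs_def)
    then have "card (nbrs t) \<le> 1" using card_le_Suc0_iff_eq[OF finite_nbrs] by auto
    then show False using card2[OF pth_un[OF tp]] by simp
  qed
  \<comment> \<open>On a path with the single vertex \<open>t\<close>, the only possible neighbour
    of \<open>t\<close> would be \<open>v\<close>, against degree 2.\<close>
  moreover have "2 \<le> length pth"
  proof (rule ccontr)
    assume "\<not> 2 \<le> length pth"
    then have "set pth \<subseteq> {t}" using tp p by (cases pth; cases "tl pth") (auto simp: path_of_def)
    then have "nbrs t \<subseteq> {v}" using nb[OF tp] adj_irrefl[of t] by (auto simp: nbrs_def dest!: subsetD)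
    then have "card (nbrs t) \<le> 1" using card_mono[of "{v}"] by auto
    then show False using card2[OF pth_un[OF tp]] by simp
  qed
  ultimately show cyc: "is_cycle edge_sets (v # pth)"
    using p u vp by (intro path_closes_to_cycle) (auto simp: path_of_def)
  have ut: "u \<in> set pth" "u \<noteq> t"
  proof -
    show "u \<in> set pth" using p by (auto simp: path_of_def)
    obtain xs where xs: "pth = u # xs" using p by (cases pth) (auto simp: path_of_def)
    then have "xs \<noteq> []" using \<open>2 \<le> length pth\<close> by auto
    then have "t \<in> set xs" using p xs last_in_set[of xs] by (simp add: path_of_def)
    then show "u \<noteq> t" using p xs by (auto simp: path_of_def)
  qed
  have nbv: "nbrs v = {u, t}"
  proof (rule card_subset_eq[symmetric])
    show "{u, t} \<subseteq> nbrs v" using u \<open>adj t v\<close> adj_sym[of t v] by (auto simp: nbrs_def)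
    show "card {u, t} = card (nbrs v)" using card2[OF nvp lv] ut by simp
  qed simp
  show "cycles_left (hx(v := k)) pv'"
    unfolding cycles_left_def proc
  proof (intro conjI allI impI)
    fix a b assume ab: "adj a b" "a \<in> processed hx pv \<union> set (v # pth)" "low b"
    show "b \<in> processed hx pv \<union> set (v # pth)"
    proof (cases "a \<in> processed hx pv")
      case True
      then show ?thesis using S ab by (auto simp: cycles_left_def)
    next
      case False
      moreover have "b \<in> {u, t}" if "a = v" using that ab(1) nbv by (auto simp: nbrs_def)
      ultimately show ?thesis using ab nb[of a b] ut tp by auto
    qed
  qed (use S k in \<open>auto simp: cycles_left_def\<close>)
qed

section \<open>Option vectors and optimality of the candidates built from them\<close>

text \<open>An option vector \<open>opt\<close> prescribes for the vertex \<open>v\<close> with label \<open>hx v \<noteq> 0\<close> whether it is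
  uncovered (0), selected (1), or matched along its incident edge of rank \<open>r\<close> (\<open>r + 2\<close>).\<close>

definition sel :: "(nat \<Rightarrow> nat) \<Rightarrow> (nat \<Rightarrow> nat) \<Rightarrow> nat \<Rightarrow> bool" where
  "sel hx opt v \<longleftrightarrow> v < n \<and> opt (hx v) = 1"

text \<open>Every deleted end has to name the edge, so an edge between two deleted vertices needs
  two agreeing options. An option without such an agreement leaves its vertex uncovered; the vector
  still decodes to a set of elements.\<close>

definition chosen :: "(nat \<Rightarrow> nat) \<Rightarrow> (nat \<Rightarrow> nat) \<Rightarrow> nat \<Rightarrow> bool" where
  "chosen hx opt j \<longleftrightarrow> j < m \<and> (hx (X j) \<noteq> 0 \<or> hx (Y j) \<noteq> 0) \<and>
     (hx (X j) \<noteq> 0 \<longrightarrow> opt (hx (X j)) = rk (X j) j + 2) \<and>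
     (hx (Y j) \<noteq> 0 \<longrightarrow> opt (hx (Y j)) = rk (Y j) j + 2)"

definition decode :: "(nat \<Rightarrow> nat) \<Rightarrow> (nat \<Rightarrow> nat) \<Rightarrow> elem set" where
  "decode hx opt = {v. sel hx opt v} <+> {j. chosen hx opt j}"

text \<open>A selected vertex and a chosen edge cannot clash when \<open>opt 0 = 0\<close>, since
  option 1 differs from every \<open>r + 2\<close>. Only the other two kinds of conflict have to be
  tested.\<close>

definition bad :: "(nat \<Rightarrow> nat) \<Rightarrow> (nat \<Rightarrow> nat) \<Rightarrow> bool" where
  "bad hx opt \<longleftrightarrow> (\<exists>j<m. sel hx opt (X j) \<and> sel hx opt (Y j)) \<or>
     (\<exists>i j v. i \<noteq> j \<and> chosen hx opt i \<and> chosen hx opt j \<and> inc i v \<and> inc j v)"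

definition cov :: "(nat \<Rightarrow> nat) \<Rightarrow> (nat \<Rightarrow> nat) \<Rightarrow> nat \<Rightarrow> bool" where
  "cov hx opt v \<longleftrightarrow> (\<exists>j. chosen hx opt j \<and> inc j v)"

definition avail :: "(nat \<Rightarrow> nat) \<Rightarrow> (nat \<Rightarrow> nat) \<Rightarrow> elem \<Rightarrow> bool" where
  "avail hx opt x \<longleftrightarrow> (case x of
      Inl v \<Rightarrow> \<not> cov hx opt v \<and> \<not> (\<exists>u. adj u v \<and> sel hx opt u)
    | Inr j \<Rightarrow> \<not> cov hx opt (X j) \<and> \<not> cov hx opt (Y j))"

definition complete_layout :: "(nat \<Rightarrow> nat) \<Rightarrow> (nat \<Rightarrow> nat) \<Rightarrow> (nat \<Rightarrow> nat) \<Rightarrow> nat \<Rightarrow> bool" where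
  "complete_layout hx pv pe L \<longleftrightarrow> layout hx pv pe \<and> (\<forall>x. pos pv pe x < L) \<and>
     (\<forall>v<n. hx v = 0 \<longrightarrow> pv v \<noteq> 0)"

text \<open>Weight 0 stands for every position that must not be taken; the dynamic program takes
  positive weights only, so no separate availability test is made there.\<close>

definition line_weights :: "(nat \<Rightarrow> nat) \<Rightarrow> (nat \<Rightarrow> nat) \<Rightarrow> (nat \<Rightarrow> nat) \<Rightarrow> (nat \<Rightarrow> nat) \<Rightarrow> nat \<Rightarrow>
    (elem \<Rightarrow> real) \<Rightarrow> (nat \<Rightarrow> real) \<Rightarrow> bool" where
  "line_weights hx opt pv pe L w a \<longleftrightarrow>
     (\<forall>x. pos pv pe x \<noteq> 0 \<longrightarrow> a (pos pv pe x) = (if avail hx opt x then w x else 0)) \<and>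
     (\<forall>p<L. a p \<noteq> 0 \<longrightarrow> p \<noteq> 0 \<and> (\<exists>x. pos pv pe x = p))"

definition candidate :: "(nat \<Rightarrow> nat) \<Rightarrow> (nat \<Rightarrow> nat) \<Rightarrow> (nat \<Rightarrow> nat) \<Rightarrow> (nat \<Rightarrow> nat) \<Rightarrow> nat set \<Rightarrow> elem set" where
  "candidate hx opt pv pe Q = decode hx opt \<union> {x. pos pv pe x \<noteq> 0 \<and> pos pv pe x \<in> Q}"

lemma decode_unplaced:
  assumes "layout hx pv pe" "opt 0 = 0" "x \<in> decode hx opt"
  shows "pos pv pe x = 0"
proof (cases x)
  case (Inl v)
  then have "hx v \<noteq> 0" using assms(2,3) by (auto simp: decode_def sel_def intro: gr0I)
  then show ?thesis using Inl assms by (auto simp: layout_def)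
next
  case (Inr j)
  then have "hx (X j) \<noteq> 0 \<or> hx (Y j) \<noteq> 0" using assms by (auto simp: decode_def chosen_def)
  then have "pv (X j) = 0 \<or> pv (Y j) = 0" using assms(1) unfolding layout_def by metis
  then have "pe j = 0" using assms(1) unfolding layout_def by metis
  then show ?thesis using Inr by simp
qed

lemma decode_elems: "decode hx opt \<subseteq> {..<n} <+> {..<m}"
  by (auto simp: decode_def sel_def chosen_def)

lemma placed_elems: "layout hx pv pe \<Longrightarrow> pos pv pe x \<noteq> 0 \<Longrightarrow> x \<in> {..<n} <+> {..<m}"
  by (cases x) (auto simp: layout_def)

lemma decode_no_conf:
  assumes "\<not> bad hx opt" "opt 0 = 0" "x \<in> decode hx opt" "y \<in> decode hx opt"
  shows "\<not> conf x y"
proof -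
  have sc: "\<not> inc j v" if "sel hx opt v" "chosen hx opt j" for v j
    using that assms(2) by (auto simp: sel_def chosen_def inc_def)
  have ss: "\<not> adj u v" if "sel hx opt u" "sel hx opt v" for u v
    using that assms(1) by (auto simp: bad_def adj_def doubleton_eq_iff)
  have cc: "\<not> (i \<noteq> j \<and> inc i v \<and> inc j v)" if "chosen hx opt i" "chosen hx opt j" for i j v
    using that assms(1) by (auto simp: bad_def)
  show ?thesis using assms(3,4) sc ss cc by (cases x; cases y) (auto simp: decode_def, blast+)
qed

text \<open>A placed edge has two undeleted ends. Hence it is not chosen and neither of its ends is
  selected, so that coverage of its ends is the only source of conflict.\<close>

lemma avail_iff:
  assumes "opt 0 = 0" "layout hx pv pe" "pos pv pe x \<noteq> 0"
  shows "avail hx opt x \<longleftrightarrow> (\<forall>y\<in>decode hx opt. \<not> conf x y)"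
proof (cases x)
  case (Inl v)
  then show ?thesis using adj_sym[of v] by (auto simp: avail_def decode_def cov_def Plus_def ball_Un)
next
  case (Inr j)
  have j: "j < m" "pv (X j) \<noteq> 0" "pv (Y j) \<noteq> 0" using assms Inr by (auto simp: layout_def)
  then have h: "hx (X j) = 0" "hx (Y j) = 0" using assms(2) by (auto simp: layout_def)
  then have nc: "\<not> chosen hx opt j" by (simp add: chosen_def)
  have ns: "\<not> sel hx opt (X j)" "\<not> sel hx opt (Y j)" using h assms(1) by (auto simp: sel_def)
  have "avail hx opt x \<longleftrightarrow> (\<forall>i. chosen hx opt i \<longrightarrow> \<not> (\<exists>v. inc j v \<and> inc i v))"
    using Inr by (auto simp: avail_def cov_def inc_def)
  moreover have "(\<forall>v. sel hx opt v \<longrightarrow> \<not> inc j v)" using ns by (auto simp: inc_def)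
  moreover have "i \<noteq> j" if "chosen hx opt i" for i using that nc by auto
  ultimately show ?thesis using Inr by (auto simp add: decode_def Plus_def ball_Un)
qed

text \<open>Taken positions have positive weight and thus hold available elements, which excludes
  conflicts with the decoded part; separation of the positions excludes conflicts among the placed
  elements.\<close>

lemma candidate_tmatch:
  assumes lay: "complete_layout hx pv pe L" and o: "opt 0 = 0" "\<not> bad hx opt"
    and lw: "line_weights hx opt pv pe L w a"
  shows "tmatch (candidate hx opt pv pe (dp_set a L))"
proof -
  have L: "layout hx pv pe" using lay by (simp add: complete_layout_def)
  let ?P = "{x. pos pv pe x \<noteq> 0 \<and> pos pv pe x \<in> dp_set a L}"
  have av: "avail hx opt x" if "x \<in> ?P" for x
  proof -
    have "0 < a (pos pv pe x)" using that dp_set_bound by blast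
    then show ?thesis using lw that by (auto simp: line_weights_def split: if_splits)
  qed
  have dp: "\<not> conf x y" if "x \<in> ?P" "y \<in> decode hx opt" for x y
    using av[OF that(1)] avail_iff[where opt = opt, OF o(1) L, of x] that by blast
  have pp: "\<not> conf x y" if "x \<in> ?P" "y \<in> ?P" for x y
  proof (cases "x = y")
    case True
    then show ?thesis by (cases x) auto
  next
    case False
    then have "pos pv pe x \<noteq> pos pv pe y" using L that unfolding layout_def by blast
    then have "pos pv pe x + 2 < pos pv pe y \<or> pos pv pe y + 2 < pos pv pe x"
      using separated_dp_set that unfolding separated_def by blast
    moreover have "conf x y \<longleftrightarrow> pos pv pe x \<le> pos pv pe y + 2 \<and> pos pv pe y \<le> pos pv pe x + 2"
      using L that False unfolding layout_def by blast
    ultimately show ?thesis by linarith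
  qed
  show ?thesis unfolding tmatch_def candidate_def
  proof (intro conjI ballI)
    show "decode hx opt \<union> ?P \<subseteq> {..<n} <+> {..<m}"
      using decode_elems placed_elems[OF L] by blast
  next
    fix x y assume "x \<in> decode hx opt \<union> ?P" "y \<in> decode hx opt \<union> ?P"
    then show "\<not> conf x y"
      using decode_no_conf[OF o(2,1)] dp[of x y] dp[of y x] conf_sym[of x y] pp[of x y] by blast
  qed
qed

lemma finite_elems: "finite ({..<n} <+> {..<m} :: elem set)" by simp

text \<open>The placed part of \<open>T\<close> occupies a separated set of positions, and its
  elements are available because \<open>T\<close> contains the decoded part. Its weight is therefore
  bounded by the value of the dynamic program. Consistency of the options is inherited from
  \<open>T\<close>.\<close>

lemma candidate_optimal:
  assumes lay: "complete_layout hx pv pe L" and o: "opt 0 = 0"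
    and lw: "line_weights hx opt pv pe L w a"
    and T: "tmatch T" "{x \<in> T. pos pv pe x = 0} = decode hx opt"
  shows "\<not> bad hx opt" "sum w T \<le> sum w (candidate hx opt pv pe (dp_set a L))"
proof -
  have L: "layout hx pv pe" using lay by (simp add: complete_layout_def)
  let ?P = "{x. pos pv pe x \<noteq> 0 \<and> pos pv pe x \<in> dp_set a L}" and ?R = "{x \<in> T. pos pv pe x \<noteq> 0}"
  have D: "decode hx opt \<subseteq> T" using T(2) by auto
  show "\<not> bad hx opt"
  proof
    assume "bad hx opt"
    then consider j where "j < m" "sel hx opt (X j)" "sel hx opt (Y j)"
      | i j v where "i \<noteq> j" "chosen hx opt i" "chosen hx opt j" "inc i v" "inc j v"
      unfolding bad_def by blast
    then show False
    proof cases
      case 1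
      then have "Inl (X j) \<in> T" "Inl (Y j) \<in> T" using D by (auto simp: decode_def)
      then have "\<not> conf (Inl (X j)) (Inl (Y j))" using T(1) unfolding tmatch_def by blast
      then show False using 1 adj_edge by simp
    next
      case 2
      then have "Inr i \<in> T" "Inr j \<in> T" using D by (auto simp: decode_def)
      then have "\<not> conf (Inr i) (Inr j)" using T(1) unfolding tmatch_def by blast
      then show False using 2 by auto
    qed
  qed
  have fT: "finite T" using T(1) finite_elems by (auto simp: tmatch_def intro: finite_subset)
  have fP: "finite ?P" by (rule finite_subset[OF _ finite_elems]) (use placed_elems[OF L] in blast)
  have inj: "inj_on (pos pv pe) {x. pos pv pe x \<noteq> 0}" using L unfolding layout_def inj_on_def by blast
  have av: "avail hx opt x" if "x \<in> ?R" for x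
    using that T(1) D avail_iff[where opt = opt, OF o L, of x]
    unfolding tmatch_def by blast
  have "sum w ?R = (\<Sum>x\<in>?R. a (pos pv pe x))"
    using av lw by (intro sum.cong) (auto simp: line_weights_def)
  also have "\<dots> = sum a (pos pv pe ` ?R)"
    using inj by (subst sum.reindex) (auto intro: inj_on_subset)
  also have "\<dots> \<le> dp_val a L"
  proof (rule dp_val_upper)
    show "pos pv pe ` ?R \<subseteq> {..<L}" using lay by (auto simp: complete_layout_def)
    show "separated (pos pv pe ` ?R)"
      unfolding separated_def
    proof (intro ballI impI)
      fix p q assume "p \<in> pos pv pe ` ?R" "q \<in> pos pv pe ` ?R" "p \<noteq> q"
      then obtain x y where xy: "x \<in> ?R" "y \<in> ?R" "p = pos pv pe x" "q = pos pv pe y" "x \<noteq> y" by blast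
      then have "\<not> conf x y" using T(1) by (auto simp: tmatch_def)
      then have "\<not> (p \<le> q + 2 \<and> q \<le> p + 2)" using L xy unfolding layout_def by blast
      then show "p + 2 < q \<or> q + 2 < p" by linarith
    qed
  qed
  also have "dp_val a L = sum a (dp_set a L)" by (simp add: sum_dp_set)
  also have "\<dots> = sum a (pos pv pe ` ?P)"
  proof (rule arg_cong[where f = "sum a"])
    show "dp_set a L = pos pv pe ` ?P"
    proof
      show "dp_set a L \<subseteq> pos pv pe ` ?P"
      proof
        fix p assume p: "p \<in> dp_set a L"
        then have "p < L" "a p \<noteq> 0" using dp_set_bound[of p a L] by auto
        then obtain x where "pos pv pe x = p" "p \<noteq> 0" using lw unfolding line_weights_def by blast
        then show "p \<in> pos pv pe ` ?P" using p by blast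
      qed
    qed auto
  qed
  also have "\<dots> = (\<Sum>x\<in>?P. a (pos pv pe x))"
    using inj by (subst sum.reindex) (auto intro: inj_on_subset)
  also have "\<dots> = sum w ?P"
  proof (rule sum.cong)
    fix x assume x: "x \<in> ?P"
    then have "0 < a (pos pv pe x)" using dp_set_bound by blast
    then show "a (pos pv pe x) = w x" using lw x by (auto simp: line_weights_def split: if_splits)
  qed simp
  finally have main: "sum w ?R \<le> sum w ?P" .
  have "T = decode hx opt \<union> ?R" "decode hx opt \<inter> ?R = {}" unfolding T(2)[symmetric] by blast+
  then have "sum w T = sum w (decode hx opt) + sum w ?R"
    using sum.union_disjoint[of "decode hx opt" ?R w] finite_subset[OF D fT] fT by simp
  moreover have "sum w (candidate hx opt pv pe (dp_set a L)) = sum w (decode hx opt) + sum w ?P"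
    unfolding candidate_def using decode_unplaced[where opt = opt, OF L o] fP finite_subset[OF D fT]
    by (intro sum.union_disjoint) auto
  ultimately show "sum w T \<le> sum w (candidate hx opt pv pe (dp_set a L))" using main by simp
qed

text \<open>The option of a deleted vertex is read off from what \<open>T\<close> does there. Every
  unplaced edge of \<open>T\<close> has a deleted end and is recorded there, and a rank determines
  the edge at its vertex, so that no foreign edge is decoded.\<close>

lemma decode_surj:
  assumes lay: "complete_layout hx pv pe L" and T: "tmatch T"
    and hx: "\<And>v. hx v \<noteq> 0 \<Longrightarrow> v < n" "\<And>u v. hx u \<noteq> 0 \<Longrightarrow> hx u = hx v \<Longrightarrow> u = v" "\<And>v. hx v \<le> k"
    and D: "\<And>v. v < n \<Longrightarrow> deg v + 2 \<le> D" "2 \<le> D"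
  obtains opt where "opt 0 = 0" "\<And>i. opt i < D" "\<And>i. k < i \<Longrightarrow> opt i = 0"
    "{x \<in> T. pos pv pe x = 0} = decode hx opt"
proof -
  have L: "layout hx pv pe" using lay by (simp add: complete_layout_def)
  define choice where "choice v = (if Inl v \<in> T then 1 else if \<exists>j. Inr j \<in> T \<and> inc j v
    then rk v (SOME j. Inr j \<in> T \<and> inc j v) + 2 else 0)" for v
  \<comment> \<open>Labels are injective, so the description recovers the vertex; label 0 and labels
    carried by no vertex get option 0.\<close>
  define opt where "opt i = (if i \<noteq> 0 \<and> (\<exists>v. hx v = i) then choice (THE v. hx v = i) else 0)" for i
  have opt: "opt (hx v) = choice v" if "hx v \<noteq> 0" for v
  proof -
    have "(THE u. hx u = hx v) = v" using hx(2)[of v] that by (intro the_equality) metis+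
    then show ?thesis using that by (auto simp: opt_def)
  qed
  have Tconf: "\<not> conf x y" if "x \<in> T" "y \<in> T" for x y using T that by (auto simp: tmatch_def)
  have Tj: "j < m" if "Inr j \<in> T" for j using T that by (auto simp: tmatch_def)
  have Tv: "v < n" if "Inl v \<in> T" for v using T that by (auto simp: tmatch_def)
  have uniq: "i = j" if "Inr i \<in> T" "Inr j \<in> T" "inc i v" "inc j v" for i j v
    using Tconf[OF that(1,2)] that by auto
  have ch: "choice v = rk v j + 2" if "Inr j \<in> T" "inc j v" for j v
  proof -
    have "(SOME j. Inr j \<in> T \<and> inc j v) = j" using that uniq by (intro some_equality) auto
    moreover have "Inl v \<notin> T" using Tconf[of "Inl v" "Inr j"] that by auto
    ultimately show ?thesis using that by (auto simp: choice_def)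
  qed
  have ch': "Inr j \<in> T" if "choice v = rk v j + 2" "inc j v" for j v
  proof -
    have "\<exists>i. Inr i \<in> T \<and> inc i v" using that by (auto simp: choice_def split: if_splits)
    then obtain i where i: "Inr i \<in> T" "inc i v" by blast
    then have "rk v i = rk v j" using ch that by auto
    then have "i = j" using rk_inj i that by blast
    then show ?thesis using i by simp
  qed
  have ch1: "choice v = 1 \<longleftrightarrow> Inl v \<in> T" for v by (auto simp: choice_def)
  have chD: "choice v < D" if "v < n" for v
  proof (cases "\<exists>j. Inr j \<in> T \<and> inc j v")
    case True
    then obtain j where j: "Inr j \<in> T" "inc j v" by blast
    then have "rk v j < deg v" using rk_less_deg Tj by blast
    then show ?thesis using ch[OF j] D(1)[OF that] by simp
  next
    case False
    then show ?thesis using D(2) by (auto simp: choice_def)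
  qed
  have "opt i < D" for i
  proof (cases "i \<noteq> 0 \<and> (\<exists>v. hx v = i)")
    case True
    then obtain v where "hx v = i" "hx v \<noteq> 0" by auto
    then show ?thesis using opt[of v] chD hx(1) by auto
  next
    case False
    then show ?thesis using D(2) by (auto simp: opt_def)
  qed
  moreover have "opt i = 0" if "k < i" for i
    using that hx(3) by (auto simp: opt_def leD)
  moreover have "{x \<in> T. pos pv pe x = 0} = decode hx opt"
  proof (rule Set.set_eqI)
    fix x
    show "x \<in> {x \<in> T. pos pv pe x = 0} \<longleftrightarrow> x \<in> decode hx opt"
    proof (cases x)
      case (Inl v)
      have "Inl v \<in> T \<and> pv v = 0 \<longleftrightarrow> v < n \<and> opt (hx v) = 1"
      proof (cases "hx v = 0")
        case True
        then show ?thesis using lay Tv[of v] by (auto simp: complete_layout_def opt_def)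
      next
        case False
        then have "pv v = 0" using L by (auto simp: layout_def)
        then show ?thesis using opt[OF False] ch1[of v] Tv[of v] by auto
      qed
      then show ?thesis using Inl by (auto simp: decode_def sel_def)
    next
      case (Inr j)
      have "Inr j \<in> T \<and> pe j = 0 \<longleftrightarrow> chosen hx opt j"
      proof
        assume j: "Inr j \<in> T \<and> pe j = 0"
        then have jm: "j < m" using Tj by auto
        have "pv (X j) = 0 \<or> pv (Y j) = 0" using L j jm unfolding layout_def by blast
        then have "hx (X j) \<noteq> 0 \<or> hx (Y j) \<noteq> 0"
          using lay X_less[OF jm] Y_less[OF jm] unfolding complete_layout_def by blast
        then show "chosen hx opt j" using j jm opt[of "X j"] opt[of "Y j"] ch[of j "X j"] ch[of j "Y j"]
          by (auto simp: chosen_def inc_def)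
      next
        assume c: "chosen hx opt j"
        then have "Inr j \<in> T" using opt[of "X j"] opt[of "Y j"] ch'[of "X j" j] ch'[of "Y j" j]
          by (auto simp: chosen_def inc_def)
        moreover have "pe j = 0"
          using decode_unplaced[OF L, of opt "Inr j"] c by (auto simp: decode_def opt_def)
        ultimately show "Inr j \<in> T \<and> pe j = 0" by simp
      qed
      then show ?thesis using Inr by (auto simp: decode_def)
    qed
  qed
  ultimately show thesis using that[of opt] by (auto simp: opt_def)
qed

end

section \<open>Total correctness and cost of programs\<close>

datatype var = VI name | VA name | VR name | VF name

fun wr_instr :: "instr \<Rightarrow> var" where
  "wr_instr (IConst x c) = VI x"
| "wr_instr (IMove x y) = VI x"
| "wr_instr (ISucc x) = VI x"
| "wr_instr (IPred x) = VI x"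
| "wr_instr (ILoad x a i) = VI x"
| "wr_instr (IStore a i x) = VA a"
| "wr_instr (RZero x) = VR x"
| "wr_instr (RMove x y) = VR x"
| "wr_instr (RAdd x y z) = VR x"
| "wr_instr (RSub x y z) = VR x"
| "wr_instr (RLoad x a i) = VR x"
| "wr_instr (RStore a i x) = VF a"

fun wr :: "prog \<Rightarrow> var set" where
  "wr Skip = {}"
| "wr (Do c) = {wr_instr c}"
| "wr (Seq p q) = wr p \<union> wr q"
| "wr (Cond b p q) = wr p \<union> wr q"
| "wr (While b p) = wr p"

text \<open>The frame condition: with the syntactic set \<open>wr\<close>, facts about names that a
  program cannot write pass through it without being part of an invariant.\<close>

definition agree :: "var set \<Rightarrow> store \<Rightarrow> store \<Rightarrow> bool" where
  "agree W s s' \<longleftrightarrow> (\<forall>x. VI x \<notin> W \<longrightarrow> ireg s' x = ireg s x) \<and> (\<forall>x. VA x \<notin> W \<longrightarrow> iarr s' x = iarr s x) \<and>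
     (\<forall>x. VR x \<notin> W \<longrightarrow> rreg s' x = rreg s x) \<and> (\<forall>x. VF x \<notin> W \<longrightarrow> rarr s' x = rarr s x)"

lemma agreeD:
  assumes "agree W s s'"
  shows "VI x \<notin> W \<Longrightarrow> ireg s' x = ireg s x" "VA x \<notin> W \<Longrightarrow> iarr s' x = iarr s x"
    "VR x \<notin> W \<Longrightarrow> rreg s' x = rreg s x" "VF x \<notin> W \<Longrightarrow> rarr s' x = rarr s x"
  using assms by (auto simp: agree_def)

lemma agree_refl [simp]: "agree W s s" by (simp add: agree_def)

lemma agree_trans: "agree W s s' \<Longrightarrow> agree W s' s'' \<Longrightarrow> agree W s s''" by (auto simp: agree_def)

lemma agree_mono: "agree W s s' \<Longrightarrow> W \<subseteq> W' \<Longrightarrow> agree W' s s'" by (auto simp: agree_def)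

lemma agree_step: "agree {wr_instr c} s (step c s)" by (cases c) (auto simp: agree_def)

lemma exec_agree: "exec c s t s' \<Longrightarrow> agree (wr c) s s'"
proof (induction rule: exec.induct)
  case (Seq p s t s' q t' s'')
  then show ?case by (auto intro: agree_trans agree_mono)
next
  case (WhileTrue b s p t s' t' s'')
  then show ?case by (auto intro: agree_trans)
qed (auto simp: agree_step intro: agree_mono)

text \<open>\<open>runP \<Phi> c s B Q\<close>: total correctness with amortised running time \<open>B\<close> relative to the potential \<open>\<Phi>\<close>.\<close>

definition runP :: "(store \<Rightarrow> nat) \<Rightarrow> prog \<Rightarrow> store \<Rightarrow> nat \<Rightarrow> (store \<Rightarrow> bool) \<Rightarrow> bool" where
  "runP \<Phi> c s B Q \<longleftrightarrow> (\<exists>t s'. exec c s t s' \<and> t + \<Phi> s' \<le> B + \<Phi> s \<and> Q s')"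

abbreviation run :: "prog \<Rightarrow> store \<Rightarrow> nat \<Rightarrow> (store \<Rightarrow> bool) \<Rightarrow> bool" where
  "run \<equiv> runP (\<lambda>_. 0)"

abbreviation seq_prog :: "prog \<Rightarrow> prog \<Rightarrow> prog" (infixr ";;" 55) where
  "p ;; q \<equiv> Seq p q"

lemma runP_mono:
  assumes "runP \<Phi> c s B Q" "B \<le> B'" "\<And>s'. agree (wr c) s s' \<Longrightarrow> Q s' \<Longrightarrow> Q' s'"
  shows "runP \<Phi> c s B' Q'"
proof -
  obtain t s' where "exec c s t s'" "t + \<Phi> s' \<le> B + \<Phi> s" "Q s'"
    using assms(1) unfolding runP_def by blast
  then show ?thesis using exec_agree assms(2,3) unfolding runP_def
    by (intro exI[of _ t] exI[of _ s']) auto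
qed

lemma runP_Seq:
  assumes "runP \<Phi> p s B1 Q1" "\<And>s'. agree (wr p) s s' \<Longrightarrow> Q1 s' \<Longrightarrow> runP \<Phi> q s' B2 Q"
  shows "runP \<Phi> (p ;; q) s (B1 + B2) Q"
proof -
  obtain t s' where 1: "exec p s t s'" "t + \<Phi> s' \<le> B1 + \<Phi> s" "Q1 s'"
    using assms(1) unfolding runP_def by blast
  then obtain t' s'' where "exec q s' t' s''" "t' + \<Phi> s'' \<le> B2 + \<Phi> s'" "Q s''"
    using assms(2)[OF exec_agree] unfolding runP_def by blast
  then show ?thesis using 1 unfolding runP_def
    by (intro exI[of _ "t + t'"] exI[of _ s'']) (auto intro: exec.Seq)
qed

lemma runP_Cond:
  assumes "holds b s \<Longrightarrow> runP \<Phi> p s B Q" "\<not> holds b s \<Longrightarrow> runP \<Phi> q s B Q"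
  shows "runP \<Phi> (Cond b p q) s (B + 1) Q"
proof (cases "holds b s")
  case True
  with assms(1) obtain t s' where "exec p s t s'" "t + \<Phi> s' \<le> B + \<Phi> s" "Q s'"
    unfolding runP_def by blast
  then show ?thesis using True unfolding runP_def
    by (intro exI[of _ "t + 1"] exI[of _ s']) (auto intro: exec.CondTrue[simplified])
next
  case False
  with assms(2) obtain t s' where "exec q s t s'" "t + \<Phi> s' \<le> B + \<Phi> s" "Q s'"
    unfolding runP_def by blast
  then show ?thesis using False unfolding runP_def
    by (intro exI[of _ "t + 1"] exI[of _ s']) (auto intro: exec.CondFalse[simplified])
qed

lemma runP_potential:
  assumes "run c s B Q" "\<And>s'. agree (wr c) s s' \<Longrightarrow> Q s' \<Longrightarrow> \<Phi> s' \<le> A + \<Phi> s"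
  shows "runP \<Phi> c s (B + A) Q"
proof -
  obtain t s' where 1: "exec c s t s'" "t \<le> B" "Q s'"
    using assms(1) unfolding runP_def by auto
  then show ?thesis using assms(2)[OF exec_agree[OF 1(1)]] unfolding runP_def
    by (intro exI[of _ t] exI[of _ s']) auto
qed

lemma run_of_runP: "runP \<Phi> c s B Q \<Longrightarrow> run c s (B + \<Phi> s) Q"
  unfolding runP_def by fastforce

text \<open>Each round, including its test, is paid for by a drop of the potential, which leaves
  only the final test to be charged. The same potential serves as termination measure.\<close>

lemma runP_While:
  assumes "Inv s"
    and "\<And>s. Inv s \<Longrightarrow> holds b s \<Longrightarrow> \<exists>t s'. exec p s t s' \<and> t + 1 + \<Phi> s' \<le> \<Phi> s \<and> Inv s'"
  shows "runP \<Phi> (While b p) s 1 (\<lambda>s'. Inv s' \<and> \<not> holds b s')"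
  using assms(1)
proof (induction "\<Phi> s" arbitrary: s rule: less_induct)
  case less
  show ?case
  proof (cases "holds b s")
    case True
    then obtain t s' where 1: "exec p s t s'" "t + 1 + \<Phi> s' \<le> \<Phi> s" "Inv s'"
      using assms(2) less.prems by blast
    then obtain t' s'' where "exec (While b p) s' t' s''" "t' + \<Phi> s'' \<le> 1 + \<Phi> s'" "Inv s''" "\<not> holds b s''"
      using less.hyps[of s'] unfolding runP_def by auto
    then show ?thesis using 1 True unfolding runP_def
      by (intro exI[of _ "t + t' + 1"] exI[of _ s'']) (auto intro: exec.WhileTrue[simplified])
  next
    case False
    then show ?thesis using less.prems unfolding runP_def
      by (intro exI[of _ 1] exI[of _ s]) (auto intro: exec.WhileFalse[simplified])
  qed
qed

text \<open>Both functions are meant for loop-free programs only: the precondition of a loop is taken to be False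
  and its cost is a dummy value.\<close>

fun wp :: "prog \<Rightarrow> (store \<Rightarrow> bool) \<Rightarrow> store \<Rightarrow> bool" where
  "wp Skip Q s = Q s"
| "wp (Do c) Q s = Q (step c s)"
| "wp (Seq p q) Q s = wp p (wp q Q) s"
| "wp (Cond b p q) Q s = ((holds b s \<longrightarrow> wp p Q s) \<and> (\<not> holds b s \<longrightarrow> wp q Q s))"
| "wp (While b p) Q s = False"

fun cost :: "prog \<Rightarrow> nat" where
  "cost Skip = 1"
| "cost (Do c) = 1"
| "cost (Seq p q) = cost p + cost q"
| "cost (Cond b p q) = max (cost p) (cost q) + 1"
| "cost (While b p) = 0"

lemma run_wp: "wp c Q s \<Longrightarrow> run c s (cost c) Q"
proof (induction c arbitrary: Q s)
  case Skip
  then show ?case unfolding runP_def by (auto intro: exec.Skip[simplified])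
next
  case (Do c)
  then show ?case unfolding runP_def by (auto intro: exec.Do[simplified])
next
  case (Seq p q)
  then show ?case unfolding cost.simps wp.simps by (blast intro: runP_Seq)
next
  case (Cond b p q)
  show ?case unfolding cost.simps
    using Cond.prems by (intro runP_Cond) (auto intro!: runP_mono[OF Cond.IH(1)] runP_mono[OF Cond.IH(2)])
qed simp

definition FOR :: "name \<Rightarrow> name \<Rightarrow> prog \<Rightarrow> prog" where
  "FOR i N p = Do (IConst i 0) ;; While (ILess i N) (p ;; Do (ISucc i))"

lemma wr_FOR [simp]: "wr (FOR i N p) = insert (VI i) (wr p)"
  by (auto simp: FOR_def)

text \<open>The body's invariant refers to the store after the index has been increased. Each round
  adds 2 for test and increment, and the outer 2 are the initial assignment and the last
  test.\<close>

lemma runP_FOR: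
  assumes iN: "i \<noteq> N" "VI i \<notin> wr p" "VI N \<notin> wr p"
    and init: "Inv 0 (s0\<lparr>ireg := (ireg s0)(i := 0)\<rparr>)"
    and body: "\<And>k s. Inv k s \<Longrightarrow> k < ireg s0 N \<Longrightarrow> ireg s i = k \<Longrightarrow> agree (insert (VI i) (wr p)) s0 s \<Longrightarrow>
      runP \<Phi> p s B (\<lambda>s'. Inv (Suc k) (s'\<lparr>ireg := (ireg s')(i := Suc k)\<rparr>))"
    and pot: "\<And>s f. \<Phi> (s\<lparr>ireg := f\<rparr>) = \<Phi> s"
  shows "runP \<Phi> (FOR i N p) s0 (ireg s0 N * (B + 2) + 2) (Inv (ireg s0 N))"
proof -
  let ?n = "ireg s0 N"
  have loop: "runP \<Phi> (While (ILess i N) (p ;; Do (ISucc i))) s ((?n - k) * (B + 2) + 1) (Inv ?n)"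
    if "Inv k s" "k \<le> ?n" "ireg s i = k" "agree (insert (VI i) (wr p)) s0 s" for k s
    using that
  proof (induction "?n - k" arbitrary: k s)
    case 0
    then have "\<not> holds (ILess i N) s" using iN agreeD(1)[OF 0(5), of N] by auto
    then show ?case using 0 unfolding runP_def
      by (intro exI[of _ 1] exI[of _ s]) (auto intro: exec.WhileFalse[simplified])
  next
    case (Suc d)
    then have k: "k < ?n" by simp
    have h: "holds (ILess i N) s" using iN agreeD(1)[OF Suc(6), of N] k Suc.prems by auto
    obtain t s' where 1: "exec p s t s'" "t + \<Phi> s' \<le> B + \<Phi> s"
      "Inv (Suc k) (s'\<lparr>ireg := (ireg s')(i := Suc k)\<rparr>)"
      using body[OF Suc(3) k Suc(5,6)] unfolding runP_def by blast
    define s1 where "s1 = s'\<lparr>ireg := (ireg s')(i := Suc k)\<rparr>"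
    have ag: "agree (wr p) s s'" by (rule exec_agree[OF 1(1)])
    have "ireg s' i = k" using agreeD(1)[OF ag, of i] iN Suc.prems by simp
    then have st: "step (ISucc i) s' = s1" by (simp add: s1_def)
    have "agree (insert (VI i) (wr p)) s s1"
      using agree_trans[OF agree_mono[OF ag] agree_mono[OF agree_step[of "ISucc i" s', unfolded st]], of "insert (VI i) (wr p)"]
      by auto
    then have ag1: "agree (insert (VI i) (wr p)) s0 s1" using Suc(6) agree_trans by blast
    have "runP \<Phi> (While (ILess i N) (p ;; Do (ISucc i))) s1 ((?n - Suc k) * (B + 2) + 1) (Inv ?n)"
      using Suc(2) k 1(3) ag1 by (intro Suc(1)) (auto simp: s1_def)
    then obtain t' s'' where 2: "exec (While (ILess i N) (p ;; Do (ISucc i))) s1 t' s''"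
      "t' + \<Phi> s'' \<le> (?n - Suc k) * (B + 2) + 1 + \<Phi> s1" "Inv ?n s''"
      unfolding runP_def by blast
    have "exec (p ;; Do (ISucc i)) s (t + 1) s1"
      using exec.Seq[OF 1(1) exec.Do[of "ISucc i" s']] st by simp
    from exec.WhileTrue[OF h this 2(1)]
    have "exec (While (ILess i N) (p ;; Do (ISucc i))) s (t + 1 + t' + 1) s''" .
    moreover have "t + 1 + t' + 1 + \<Phi> s'' \<le> (?n - k) * (B + 2) + 1 + \<Phi> s"
    proof -
      have "?n - k = Suc (?n - Suc k)" using k by simp
      then have "(?n - k) * (B + 2) = B + 2 + (?n - Suc k) * (B + 2)" by simp
      moreover have "\<Phi> s1 = \<Phi> s'" by (simp add: s1_def pot)
      ultimately show ?thesis using 1(2) 2(2) by linarith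
    qed
    ultimately show ?case using 2(3) unfolding runP_def by blast
  qed
  have "runP \<Phi> (Do (IConst i 0)) s0 1 (\<lambda>s. s = s0\<lparr>ireg := (ireg s0)(i := 0)\<rparr>)"
    unfolding runP_def using exec.Do[of "IConst i 0" s0]
    by (intro exI[of _ 1] exI[of _ "step (IConst i 0) s0"]) (auto simp: pot)
  then have "runP \<Phi> (FOR i N p) s0 (1 + ((?n - 0) * (B + 2) + 1)) (Inv ?n)"
    unfolding FOR_def
  proof (rule runP_Seq)
    fix s' assume "s' = s0\<lparr>ireg := (ireg s0)(i := 0)\<rparr>"
    then show "runP \<Phi> (While (ILess i N) (p ;; Do (ISucc i))) s' ((?n - 0) * (B + 2) + 1) (Inv ?n)"
      using init by (intro loop) (auto simp: agree_def)
  qed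
  then show ?thesis by simp
qed

lemma run_FOR_wp:
  assumes "i \<noteq> N" "VI i \<notin> wr p" "VI N \<notin> wr p" and N: "ireg s0 N = N0" and c: "cost p + 2 \<le> c"
    and "Inv 0 (s0\<lparr>ireg := (ireg s0)(i := 0)\<rparr>)"
    and "\<And>k s. Inv k s \<Longrightarrow> k < N0 \<Longrightarrow> ireg s i = k \<Longrightarrow>
      wp p (\<lambda>s'. Inv (Suc k) (s'\<lparr>ireg := (ireg s')(i := Suc k)\<rparr>)) s"
  shows "run (FOR i N p) s0 (N0 * c + 2) (Inv N0)"
proof -
  have "run (FOR i N p) s0 (ireg s0 N * (cost p + 2) + 2) (Inv (ireg s0 N))"
    using assms by (intro runP_FOR run_wp) auto
  then show ?thesis unfolding N
    by (rule runP_mono) (use mult_le_mono2[OF c, of N0] in auto)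
qed

section \<open>Computing the layout\<close>

text \<open>Array names: \<open>d\<close> degrees; \<open>r1\<close>, \<open>r2\<close> ranks of an edge at its two ends, plus 2; \<open>A\<close>, \<open>B\<close> the last and
  the second to last edge seen at a vertex, plus 1 (0 if there is none); \<open>hx\<close> labels of the deleted vertices
  (0 for the others); \<open>pv\<close>, \<open>pe\<close> positions of vertices and edges on the line. The register \<open>z\<close> is never
  written and holds 0.\<close>

definition degree_half :: "name \<Rightarrow> name \<Rightarrow> prog" where
  "degree_half e r =
     Do (ILoad ''u'' e ''j'') ;; Do (ILoad ''t'' ''d'' ''u'') ;; Do (ISucc ''t'') ;; Do (IStore ''d'' ''u'' ''t'') ;;
     Do (ISucc ''t'') ;; Do (IStore r ''j'' ''t'') ;;
     Do (ILoad ''t'' ''A'' ''u'') ;; Do (IStore ''B'' ''u'' ''t'') ;;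
     Do (IMove ''c'' ''j'') ;; Do (ISucc ''c'') ;; Do (IStore ''A'' ''u'' ''c'')"

definition degree_prog :: prog where
  "degree_prog = FOR ''j'' ''m'' (degree_half ''end1'' ''r1'' ;; degree_half ''end2'' ''r2'')"

definition label_prog :: prog where
  "label_prog = Do (IConst ''c'' 2) ;; FOR ''i'' ''n'' (Do (ILoad ''t'' ''d'' ''i'') ;;
     Cond (ILess ''c'' ''t'') (Do (ISucc ''k'') ;; Do (IStore ''hx'' ''i'' ''k'')) Skip)"

text \<open>\<open>a\<close> is an edge number shifted by one, with 0 for no edge; \<open>u\<close>
  becomes the end of that edge different from \<open>cur\<close>. The register \<open>c\<close>
  counts the free neighbours.\<close>

definition try_prog :: prog where
  "try_prog = Cond (IEq ''a'' ''z'') Skip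
     (Do (IPred ''a'') ;; Do (ILoad ''u'' ''end1'' ''a'') ;;
      Cond (IEq ''u'' ''cur'') (Do (ILoad ''u'' ''end2'' ''a'')) Skip ;;
      Do (ILoad ''t'' ''hx'' ''u'') ;;
      Cond (IEq ''t'' ''z'')
        (Do (ILoad ''t'' ''pv'' ''u'') ;;
         Cond (IEq ''t'' ''z'') (Do (ISucc ''c'') ;; Do (IMove ''nx'' ''u'') ;; Do (IMove ''ne'' ''a'')) Skip)
        Skip)"

text \<open>Two stored edges suffice, because the search is only made at vertices of degree at most
  2. It takes constant time without adjacency lists.\<close>

definition find_prog :: prog where
  "find_prog = Do (IConst ''c'' 0) ;; Do (ILoad ''a'' ''A'' ''cur'') ;; try_prog ;;
     Do (ILoad ''a'' ''B'' ''cur'') ;; try_prog"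

definition start_prog :: prog where
  "start_prog = Do (IStore ''pv'' ''cur'' ''L'') ;; Do (ISucc ''L'')"

definition extend_prog :: prog where
  "extend_prog = Do (IStore ''pe'' ''ne'' ''L'') ;; Do (ISucc ''L'') ;; Do (IMove ''cur'' ''nx'') ;;
     Do (IStore ''pv'' ''cur'' ''L'') ;; Do (ISucc ''L'')"

text \<open>The two final increments of \<open>L\<close> are the empty positions that keep
  consecutive paths from conflicting on the line.\<close>

definition walk_prog :: prog where
  "walk_prog = start_prog ;; find_prog ;; While (ILess ''z'' ''c'') (extend_prog ;; find_prog) ;;
     Do (ISucc ''L'') ;; Do (ISucc ''L'')"

definition scan_prog :: "prog \<Rightarrow> prog" where
  "scan_prog p = FOR ''i'' ''n'' (Do (ILoad ''t'' ''hx'' ''i'') ;; Cond (IEq ''t'' ''z'')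
     (Do (ILoad ''t'' ''pv'' ''i'') ;; Cond (IEq ''t'' ''z'') p Skip) Skip)"

text \<open>A walk is started only at a vertex with at most one free neighbour. One scan is enough:
  a skipped vertex has two undeleted neighbours, and labels do not change during this scan.\<close>

definition paths_prog :: prog where
  "paths_prog = scan_prog (Do (IMove ''cur'' ''i'') ;; find_prog ;; Cond (ILess ''o'' ''c'') Skip walk_prog)"

text \<open>Once a vertex of a cycle is deleted, its neighbour \<open>nx\<close> is the end of a
  path, which the ordinary walk can place.\<close>

definition cycles_prog :: prog where
  "cycles_prog = scan_prog ((Do (ISucc ''k'') ;; Do (IStore ''hx'' ''i'' ''k'') ;; Do (IMove ''cur'' ''i'')) ;;
     find_prog ;; Do (IMove ''cur'' ''nx'') ;; walk_prog)"

lemma wr_find_prog: "wr find_prog = {VI ''c'', VI ''a'', VI ''u'', VI ''t'', VI ''nx'', VI ''ne''}"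
  by (auto simp: find_prog_def try_prog_def)

lemma wr_walk_prog: "wr walk_prog = {VI ''c'', VI ''a'', VI ''u'', VI ''t'', VI ''nx'', VI ''ne'', VI ''cur'', VI ''L'', VA ''pv'', VA ''pe''}"
  unfolding walk_prog_def by (auto simp: wr_find_prog start_prog_def extend_prog_def)

locale total_matching_prog = igraph n m X Y for n m X Y +
  fixes wv we :: "nat \<Rightarrow> real"
begin

section \<open>Degrees, last edges, labels and the search for free neighbours\<close>

definition base :: "store \<Rightarrow> bool" where
  "base s \<longleftrightarrow> ireg s ''n'' = n \<and> ireg s ''m'' = m \<and> iarr s ''end1'' = X \<and> iarr s ''end2'' = Y \<and>
     ireg s ''z'' = 0 \<and> ireg s ''o'' = 1 \<and> rarr s ''wv'' = wv \<and> rarr s ''we'' = we"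

definition ranks_upto :: "nat \<Rightarrow> store \<Rightarrow> bool" where
  "ranks_upto j s \<longleftrightarrow> (\<forall>v. iarr s ''d'' v = rk v j) \<and>
     (\<forall>i<j. iarr s ''r1'' i = rk (X i) i + 2 \<and> iarr s ''r2'' i = rk (Y i) i + 2)"

text \<open>The two slots are exact while at most two edges have been seen at the vertex. Later
  edges overwrite them, but such vertices have degree at least 3 and are deleted.\<close>

definition last_edges :: "nat \<Rightarrow> (nat \<Rightarrow> nat) \<Rightarrow> (nat \<Rightarrow> nat) \<Rightarrow> bool" where
  "last_edges j A B \<longleftrightarrow> (\<forall>v. A v \<le> j \<and> B v \<le> j \<and> (rk v j = 0 \<longrightarrow> A v = 0) \<and> (rk v j \<le> 1 \<longrightarrow> B v = 0) \<and>
     (A v \<noteq> 0 \<longrightarrow> A v \<noteq> B v) \<and>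
     (rk v j \<le> 2 \<longrightarrow> (\<forall>i. A v = Suc i \<or> B v = Suc i \<longleftrightarrow> i < j \<and> inc i v)))"

lemma last_edges_step:
  assumes "last_edges j A B" "j < m"
  shows "last_edges (Suc j) (A(X j := Suc j, Y j := Suc j)) (B(X j := A (X j), Y j := A (Y j)))"
  unfolding last_edges_def
proof (intro allI)
  fix v
  have xy: "X j \<noteq> Y j" using assms X_neq_Y by simp
  have old: "A v \<le> j" "B v \<le> j" "rk v j = 0 \<longrightarrow> A v = 0" "rk v j \<le> 1 \<longrightarrow> B v = 0" "A v \<noteq> 0 \<longrightarrow> A v \<noteq> B v"
    "rk v j \<le> 2 \<longrightarrow> (\<forall>i. A v = Suc i \<or> B v = Suc i \<longleftrightarrow> i < j \<and> inc i v)"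
    using assms(1) by (auto simp: last_edges_def)
  let ?A = "(A(X j := Suc j, Y j := Suc j)) v" and ?B = "(B(X j := A (X j), Y j := A (Y j))) v"
  show "?A \<le> Suc j \<and> ?B \<le> Suc j \<and> (rk v (Suc j) = 0 \<longrightarrow> ?A = 0) \<and> (rk v (Suc j) \<le> 1 \<longrightarrow> ?B = 0) \<and>
    (?A \<noteq> 0 \<longrightarrow> ?A \<noteq> ?B) \<and>
    (rk v (Suc j) \<le> 2 \<longrightarrow> (\<forall>i. ?A = Suc i \<or> ?B = Suc i \<longleftrightarrow> i < Suc j \<and> inc i v))"
  proof (cases "inc j v")
    case True
    then have AB: "?A = Suc j" "?B = A v" using xy by (auto simp: inc_def)
    have "(Suc j = Suc i \<or> A v = Suc i) \<longleftrightarrow> i < Suc j \<and> inc i v" if "rk v j \<le> 1" for i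
      using old(4,6) that True by (auto simp: less_Suc_eq)
    then show ?thesis using old True unfolding AB rk_Suc by auto
  next
    case False
    then have "?A = A v" "?B = B v" by (auto simp: inc_def)
    then show ?thesis using old False unfolding rk_Suc by (auto simp: less_Suc_eq)
  qed
qed

lemma run_degree_prog:
  assumes "base s" "\<forall>v. iarr s ''d'' v = 0" "\<forall>v. iarr s ''A'' v = 0" "\<forall>v. iarr s ''B'' v = 0"
  shows "run degree_prog s (m * 24 + 2) (\<lambda>s'. base s' \<and> ranks_upto m s' \<and> last_edges m (iarr s' ''A'') (iarr s' ''B''))"
proof -
  let ?Inv = "\<lambda>j s. base s \<and> ranks_upto j s \<and> last_edges j (iarr s ''A'') (iarr s ''B'')"
  let ?b = "degree_half ''end1'' ''r1'' ;; degree_half ''end2'' ''r2''"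
  show ?thesis unfolding degree_prog_def
  proof (rule run_FOR_wp[where Inv = ?Inv])
    show "?Inv 0 (s\<lparr>ireg := (ireg s)(''j'' := 0)\<rparr>)"
      using assms by (auto simp: base_def ranks_upto_def last_edges_def)
  next
    fix k s' assume k: "k < m" and I: "?Inv k s'" "ireg s' ''j'' = k"
    note le = last_edges_step[OF conjunct2[OF conjunct2[OF I(1)]] k]
    have ne: "X k \<noteq> Y k" using X_neq_Y[OF k] .
    show "wp ?b (\<lambda>s'. ?Inv (Suc k) (s'\<lparr>ireg := (ireg s')(''j'' := Suc k)\<rparr>)) s'"
      using I le ne ne[symmetric]
      by (auto simp: degree_half_def base_def ranks_upto_def rk_Suc inc_def less_Suc_eq)
  qed (use assms(1) in \<open>auto simp: degree_half_def base_def\<close>)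
qed

text \<open>The labels in use are exactly 1 to \<open>k\<close>. Thus \<open>k\<close> is both the
  number of deleted vertices and the length of the relevant part of an option vector.\<close>

definition labelled :: "(nat \<Rightarrow> nat) \<Rightarrow> nat \<Rightarrow> bool" where
  "labelled hx k \<longleftrightarrow> (\<forall>v. hx v \<noteq> 0 \<longrightarrow> v < n) \<and> inj_on hx {v. hx v \<noteq> 0} \<and>
     (\<forall>v. hx v \<le> k) \<and> card {v. hx v \<noteq> 0} = k"

lemma labelled_new:
  assumes "labelled hx k" "v < n" "hx v = 0"
  shows "labelled (hx(v := Suc k)) (Suc k)"
proof -
  have "finite {v. hx v \<noteq> 0}"
    by (rule finite_subset[of _ "{..<n}"]) (use assms in \<open>auto simp: labelled_def\<close>)
  moreover have "{u. (hx(v := Suc k)) u \<noteq> 0} = insert v {v. hx v \<noteq> 0}" by auto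
  ultimately have "card {u. (hx(v := Suc k)) u \<noteq> 0} = Suc k" using assms by (simp add: labelled_def)
  moreover have "hx u \<noteq> Suc k" for u
    using assms(1) unfolding labelled_def by (metis Suc_n_not_le_n)
  moreover have "hx u \<le> Suc k" for u using assms by (auto simp: labelled_def intro: le_SucI)
  moreover have "inj_on (hx(v := Suc k)) {u. (hx(v := Suc k)) u \<noteq> 0}"
  proof (rule inj_onI)
    fix a b assume ab: "a \<in> {u. (hx(v := Suc k)) u \<noteq> 0}" "b \<in> {u. (hx(v := Suc k)) u \<noteq> 0}"
      "(hx(v := Suc k)) a = (hx(v := Suc k)) b"
    have "inj_on hx {v. hx v \<noteq> 0}" using assms(1) by (simp add: labelled_def)
    from inj_onD[OF this, of a b] ab \<open>\<And>u. hx u \<noteq> Suc k\<close>[of a] \<open>\<And>u. hx u \<noteq> Suc k\<close>[of b]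
    show "a = b" by (cases "a = v"; cases "b = v") simp_all
  qed
  moreover have "\<forall>u. (hx(v := Suc k)) u \<noteq> 0 \<longrightarrow> u < n" using assms by (auto simp: labelled_def)
  ultimately show ?thesis by (simp add: labelled_def)
qed

lemma run_label_prog:
  assumes "base s" "ranks_upto m s" "\<forall>v. iarr s ''hx'' v = 0" "ireg s ''k'' = 0"
  shows "run label_prog s (n * 6 + 3) (\<lambda>s'. base s' \<and> labelled (iarr s' ''hx'') (ireg s' ''k'') \<and>
    (\<forall>v. iarr s' ''hx'' v \<noteq> 0 \<longleftrightarrow> v < n \<and> \<not> low v))"
proof -
  let ?Inv = "\<lambda>i s. base s \<and> ranks_upto m s \<and> labelled (iarr s ''hx'') (ireg s ''k'') \<and> ireg s ''c'' = 2 \<and>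
    (\<forall>v. iarr s ''hx'' v \<noteq> 0 \<longleftrightarrow> v < i \<and> v < n \<and> \<not> low v)"
  let ?b = "Do (ILoad ''t'' ''d'' ''i'') ;;
     Cond (ILess ''c'' ''t'') (Do (ISucc ''k'') ;; Do (IStore ''hx'' ''i'' ''k'')) Skip"
  have *: "run (FOR ''i'' ''n'' ?b) s1 (n * 6 + 2) (?Inv n)"
    if s1: "s1 = s\<lparr>ireg := (ireg s)(''c'' := 2)\<rparr>" for s1
  proof (rule run_FOR_wp[where Inv = ?Inv])
    show "?Inv 0 (s1\<lparr>ireg := (ireg s1)(''i'' := 0)\<rparr>)"
      using assms s1 by (auto simp: base_def ranks_upto_def labelled_def)
  next
    fix k s' assume k: "k < n" and I: "?Inv k s'" "ireg s' ''i'' = k"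
    have h0: "iarr s' ''hx'' k = 0" using I by auto
    have new: "labelled ((iarr s' ''hx'')(k := Suc (ireg s' ''k''))) (Suc (ireg s' ''k''))"
      using I by (intro labelled_new k h0) auto
    have d: "iarr s' ''d'' k = deg k" using I by (auto simp: ranks_upto_def deg_def)
    show "wp ?b (\<lambda>s'. ?Inv (Suc k) (s'\<lparr>ireg := (ireg s')(''i'' := Suc k)\<rparr>)) s'"
      using I new d k h0 by (auto simp: base_def ranks_upto_def less_Suc_eq low_def)
  qed (use assms(1) s1 in \<open>auto simp: base_def\<close>)
  have "run label_prog s (1 + (n * 6 + 2)) (?Inv n)"
    unfolding label_prog_def
  proof (rule runP_Seq)
    show "run (Do (IConst ''c'' 2)) s 1 (\<lambda>s1. s1 = s\<lparr>ireg := (ireg s)(''c'' := 2)\<rparr>)"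
      using run_wp[of "Do (IConst ''c'' 2)" "\<lambda>s1. s1 = s\<lparr>ireg := (ireg s)(''c'' := 2)\<rparr>" s] by simp
  qed (rule *)
  then show ?thesis by (rule runP_mono) auto
qed

definition found :: "store \<Rightarrow> bool" where
  "found s \<longleftrightarrow> (let F = free_nbrs (iarr s ''hx'') (iarr s ''pv'') (ireg s ''cur'') in
     ireg s ''c'' = card F \<and> (ireg s ''c'' \<noteq> 0 \<longrightarrow> ireg s ''nx'' \<in> F \<and> ireg s ''ne'' < m \<and>
       {X (ireg s ''ne''), Y (ireg s ''ne'')} = {ireg s ''cur'', ireg s ''nx''}))"

text \<open>The two slots name different edges at \<open>cur\<close> and hence different neighbours,
  so \<open>c\<close> counts nothing twice. Splitting on which slots are empty leaves four loop-free
  runs to be evaluated.\<close>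

lemma run_find_prog:
  assumes b: "base s" and le: "last_edges m (iarr s ''A'') (iarr s ''B'')" and d: "deg (ireg s ''cur'') \<le> 2"
  shows "run find_prog s (cost find_prog) found"
proof (rule run_wp)
  define cur where "cur = ireg s ''cur''"
  define A where "A = iarr s ''A'' cur"
  define B where "B = iarr s ''B'' cur"
  define other where "other i = (if X i = cur then Y i else X i)" for i
  define ok where "ok i \<longleftrightarrow> iarr s ''hx'' (other i) = 0 \<and> iarr s ''pv'' (other i) = 0" for i
  define F where "F = free_nbrs (iarr s ''hx'') (iarr s ''pv'') cur"
  have AB: "A = Suc i \<or> B = Suc i \<longleftrightarrow> i < m \<and> inc i cur" for i
    using le d by (auto simp: last_edges_def deg_def A_def B_def cur_def)
  have neq: "A \<noteq> 0 \<Longrightarrow> A \<noteq> B" using le by (auto simp: last_edges_def A_def B_def)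
  have ed: "i < m" "inc i cur" "{X i, Y i} = {cur, other i}" "other i \<noteq> cur" if "A = Suc i \<or> B = Suc i" for i
    using AB[of i] that X_neq_Y[of i] by (auto simp: inc_def other_def)
  have F: "F = {other i | i. (A = Suc i \<or> B = Suc i) \<and> ok i}"
  proof (intro Set.set_eqI iffI)
    fix u assume u: "u \<in> F"
    then obtain i where i: "i < m" "{X i, Y i} = {cur, u}" by (auto simp: F_def free_nbrs_def adj_def)
    then have "inc i cur" "u = other i" using X_neq_Y[of i] by (auto simp: inc_def other_def doubleton_eq_iff)
    then show "u \<in> {other i | i. (A = Suc i \<or> B = Suc i) \<and> ok i}"
      using AB[of i] i u by (auto simp: F_def free_nbrs_def ok_def)
  next
    fix u assume "u \<in> {other i | i. (A = Suc i \<or> B = Suc i) \<and> ok i}"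
    then obtain i where "A = Suc i \<or> B = Suc i" "ok i" "u = other i" by auto
    with ed[of i] show "u \<in> F" by (auto simp: F_def free_nbrs_def ok_def adj_def)
  qed
  have inj: "other i \<noteq> other j" if "A = Suc i" "B = Suc j" for i j
  proof
    assume eq: "other i = other j"
    have "{X i, Y i} = {X j, Y j}" using ed(3)[of i] ed(3)[of j] that eq by auto
    then have "i = j" using edge_inj ed(1)[of i] ed(1)[of j] that by auto
    then show False using neq that by auto
  qed
  have base: "ireg s ''z'' = 0" "iarr s ''end1'' = X" "iarr s ''end2'' = Y" "ireg s ''cur'' = cur"
    "iarr s ''A'' cur = A" "iarr s ''B'' cur = B"
    using b by (auto simp: base_def cur_def A_def B_def)
  have post: "found s'" if "iarr s' = iarr s" "ireg s' ''cur'' = cur" "ireg s' ''c'' = card F"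
    "ireg s' ''c'' \<noteq> 0 \<Longrightarrow> ireg s' ''nx'' = other (ireg s' ''ne'') \<and> ok (ireg s' ''ne'') \<and>
      (A = Suc (ireg s' ''ne'') \<or> B = Suc (ireg s' ''ne''))" for s'
    using that ed[of "ireg s' ''ne''"] by (auto simp: found_def Let_def F[unfolded F_def] F_def)
  show "wp find_prog found s"
  proof (cases A)
    case A0: 0
    show ?thesis
    proof (cases B)
      case 0
      then have "F = {}" using F A0 by auto
      then show ?thesis unfolding find_prog_def try_prog_def using base A0 0
        by (simp, intro post) auto
    next
      case (Suc b)
      then have "F = (if ok b then {other b} else {})" using F A0 by auto
      then show ?thesis unfolding find_prog_def try_prog_def using base A0 Suc
        by (simp, intro conjI impI post) (auto simp: ok_def other_def)
    qed
  next
    case As: (Suc a)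
    show ?thesis
    proof (cases B)
      case 0
      then have "F = (if ok a then {other a} else {})" using F As by auto
      then show ?thesis unfolding find_prog_def try_prog_def using base As 0
        by (simp, intro conjI impI post) (auto simp: ok_def other_def)
    next
      case (Suc b)
      then have "F = (if ok a then {other a} else {}) \<union> (if ok b then {other b} else {})" using F As by auto
      then have "card F = (if ok a then 1 else 0) + (if ok b then 1 else 0)"
        using inj[OF As Suc] by auto
      then show ?thesis unfolding find_prog_def try_prog_def using base As Suc
        by (simp, intro conjI impI post) (auto simp: ok_def other_def)
    qed
  qed
qed

end

lemma run_wp_le: "wp c Q s \<Longrightarrow> cost c \<le> B \<Longrightarrow> run c s B Q"
  by (rule runP_mono[OF run_wp])

section \<open>Amortised cost of the walks and of the scans that start them\<close>

context total_matching_prog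
begin

text \<open>Every unplaced vertex holds the price of one round of a walk: 5 steps of
  \<open>extend_prog\<close>, one search and one loop test.\<close>

definition pot :: "store \<Rightarrow> nat" where
  "pot s = (cost find_prog + 6) * card {v. v < n \<and> iarr s ''pv'' v = 0}"

lemma pot_ireg [simp]: "pot (s\<lparr>ireg := f\<rparr>) = pot s" by (simp add: pot_def)

lemma pot_cong: "iarr s' ''pv'' = iarr s ''pv'' \<Longrightarrow> pot s' = pot s" by (simp add: pot_def)

lemma pot_place:
  assumes "iarr s' ''pv'' = (iarr s ''pv'')(u := l)" "u < n" "iarr s ''pv'' u = 0" "l \<noteq> 0"
  shows "pot s' + (cost find_prog + 6) = pot s"
proof -
  have "{v. v < n \<and> iarr s ''pv'' v = 0} = insert u {v. v < n \<and> iarr s' ''pv'' v = 0}"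
    using assms by auto
  moreover have "u \<notin> {v. v < n \<and> iarr s' ''pv'' v = 0}" using assms by simp
  ultimately have "card {v. v < n \<and> iarr s ''pv'' v = 0} = Suc (card {v. v < n \<and> iarr s' ''pv'' v = 0})"
    by simp
  then show ?thesis by (simp add: pot_def)
qed

lemma runP_pot_frame:
  assumes "run c s B Q" "VA ''pv'' \<notin> wr c"
  shows "runP pot c s B Q"
proof -
  have "runP pot c s (B + 0) Q"
  proof (rule runP_potential[OF assms(1)])
    fix s' assume "agree (wr c) s s'"
    then have "pot s' = pot s" using assms(2) by (intro pot_cong agreeD(2))
    then show "pot s' \<le> 0 + pot s" by simp
  qed
  then show ?thesis by simp
qed

lemma runP_pot_wp: "wp c Q s \<Longrightarrow> VA ''pv'' \<notin> wr c \<Longrightarrow> cost c \<le> B \<Longrightarrow> runP pot c s B Q"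
  by (rule runP_mono[OF runP_pot_frame[OF run_wp]])

lemma base_agree:
  assumes "agree W s s'" "base s"
    and "W \<inter> {VI ''n'', VI ''m'', VA ''end1'', VA ''end2'', VI ''z'', VI ''o'', VF ''wv'', VF ''we''} = {}"
  shows "base s'"
proof -
  have "VI ''n'' \<notin> W" "VI ''m'' \<notin> W" "VA ''end1'' \<notin> W" "VA ''end2'' \<notin> W" "VI ''z'' \<notin> W" "VI ''o'' \<notin> W"
    "VF ''wv'' \<notin> W" "VF ''we'' \<notin> W" using assms(3) by blast+
  then show ?thesis using assms(2) agreeD[OF assms(1)] by (simp add: base_def)
qed

definition ready :: "store \<Rightarrow> bool" where
  "ready s \<longleftrightarrow> base s \<and> last_edges m (iarr s ''A'') (iarr s ''B'') \<and> (\<forall>v<n. iarr s ''hx'' v = 0 \<longrightarrow> deg v \<le> 2)"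

lemma ready_agree:
  assumes "agree W s s'" "ready s"
    and "W \<inter> {VI ''n'', VI ''m'', VA ''end1'', VA ''end2'', VI ''z'', VI ''o'', VF ''wv'', VF ''we''} = {}"
    and "W \<inter> {VA ''A'', VA ''B'', VA ''hx''} = {}"
  shows "ready s'"
proof -
  have "VA ''A'' \<notin> W" "VA ''B'' \<notin> W" "VA ''hx'' \<notin> W" using assms(4) by blast+
  then show ?thesis using assms(2) agreeD[OF assms(1)] base_agree[OF assms(1) _ assms(3)]
    by (simp add: ready_def)
qed

abbreviation closed_in :: "store \<Rightarrow> bool" where
  "closed_in s \<equiv> closed_layout (iarr s ''hx'') (iarr s ''pv'') (iarr s ''pe'') (ireg s ''L'')"

definition walk_done :: "store \<Rightarrow> store \<Rightarrow> bool" where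
  "walk_done s s' \<longleftrightarrow> closed_in s' \<and>
    (\<exists>pth t L. walk_layout (iarr s ''hx'') (iarr s' ''pv'') (iarr s' ''pe'') L t \<and>
       free_nbrs (iarr s ''hx'') (iarr s' ''pv'') t = {} \<and>
       path_of (iarr s ''pv'') (iarr s' ''pv'') (ireg s ''cur'') t pth)"

text \<open>The rounds are paid for by the vertices they place. What remains to be charged is 2
  steps for the start, the first search, the final test and 2 steps for the gap.\<close>

lemma run_walk_prog:
  assumes r: "ready s" and cl: "closed_in s"
    and cur: "ireg s ''cur'' < n" "iarr s ''hx'' (ireg s ''cur'') = 0" "iarr s ''pv'' (ireg s ''cur'') = 0"
    and N: "card (free_nbrs (iarr s ''hx'') (iarr s ''pv'') (ireg s ''cur'')) \<le> 1"
  shows "runP pot walk_prog s (cost find_prog + 5) (walk_done s)"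
proof -
  define hx where "hx = iarr s ''hx''"
  define W where "W = wr walk_prog"
  define lay where "lay s' \<longleftrightarrow> agree W s s' \<and>
    walk_layout hx (iarr s' ''pv'') (iarr s' ''pe'') (ireg s' ''L'') (ireg s' ''cur'') \<and>
    (\<exists>pth. path_of (iarr s ''pv'') (iarr s' ''pv'') (ireg s ''cur'') (ireg s' ''cur'') pth)" for s'
  have W: "W = {VI ''c'', VI ''a'', VI ''u'', VI ''t'', VI ''nx'', VI ''ne'', VI ''cur'', VI ''L'', VA ''pv'', VA ''pe''}"
    by (simp add: W_def wr_walk_prog)
  have rd: "ready s'" and hx': "iarr s' ''hx'' = hx" if "lay s'" for s'
    using that ready_agree[of W s s'] r agreeD(2)[of W s s' "''hx''"] by (auto simp: lay_def W hx_def)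
  have find: "run find_prog s1 (cost find_prog) (\<lambda>s2. lay s2 \<and> found s2 \<and> iarr s2 ''pv'' = iarr s1 ''pv'')"
    if l: "lay s1" for s1
  proof -
    have c: "ireg s1 ''cur'' < n" "hx (ireg s1 ''cur'') = 0"
      using l by (auto simp: lay_def walk_layout_def layout_def)
    then have "deg (ireg s1 ''cur'') \<le> 2" using rd[OF l] hx'[OF l] by (auto simp: ready_def)
    then have "run find_prog s1 (cost find_prog) found"
      using rd[OF l] by (intro run_find_prog) (auto simp: ready_def)
    then show ?thesis
    proof (rule runP_mono)
      fix s2 assume a: "agree (wr find_prog) s1 s2" and f: "found s2"
      have "agree W s s2" using l agree_mono[OF a, of W] agree_trans[of W s s1 s2]
        by (auto simp: lay_def W wr_find_prog)
      moreover have eq: "ireg s2 ''cur'' = ireg s1 ''cur''" "ireg s2 ''L'' = ireg s1 ''L''"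
        "iarr s2 ''pv'' = iarr s1 ''pv''" "iarr s2 ''pe'' = iarr s1 ''pe''"
        using agreeD[OF a] by (auto simp: wr_find_prog)
      ultimately show "lay s2 \<and> found s2 \<and> iarr s2 ''pv'' = iarr s1 ''pv''" using l f by (simp add: lay_def)
    qed simp
  qed
  have start: "runP pot start_prog s 2 lay"
  proof -
    define s1 where "s1 = s\<lparr>ireg := (ireg s)(''L'' := Suc (ireg s ''L'')),
      iarr := (iarr s)(''pv'' := (iarr s ''pv'')(ireg s ''cur'' := ireg s ''L''))\<rparr>"
    have L0: "ireg s ''L'' \<noteq> 0" using cl by (auto simp: closed_layout_def)
    have "lay s1" unfolding lay_def s1_def hx_def
      using walk_start[OF cl cur N] path_of_start[of "iarr s ''pv''", OF cur(3) L0]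
      by (auto simp: agree_def W)
    have "run start_prog s 2 (\<lambda>s'. s' = s1)"
      by (rule run_wp_le) (simp_all add: start_prog_def s1_def)
    then have "runP pot start_prog s (2 + 0) (\<lambda>s'. s' = s1)"
    proof (rule runP_potential)
      fix s' assume "s' = s1"
      then show "pot s' \<le> 0 + pot s"
        using pot_place[of s' s "ireg s ''cur''" "ireg s ''L''"] cur L0 by (simp add: s1_def)
    qed
    then show ?thesis by (rule runP_mono) (use \<open>lay s1\<close> in auto)
  qed
  have ext: "\<exists>t s'. exec (extend_prog ;; find_prog) s1 t s' \<and> t + 1 + pot s' \<le> pot s1 \<and> (lay s' \<and> found s')"
    if l: "lay s1 \<and> found s1" and h: "holds (ILess ''z'' ''c'') s1" for s1
  proof -
    define u where "u = ireg s1 ''nx''"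
    define j where "j = ireg s1 ''ne''"
    define L where "L = ireg s1 ''L''"
    define c where "c = ireg s1 ''cur''"
    have "ireg s1 ''c'' \<noteq> 0" using h by auto
    then have u: "u \<in> free_nbrs hx (iarr s1 ''pv'') c" and j: "j < m" "{X j, Y j} = {c, u}"
      using l hx'[of s1] by (auto simp: found_def Let_def u_def j_def c_def)
    have u': "u < n" "iarr s1 ''pv'' u = 0" "adj c u" using u adj_less by (auto simp: free_nbrs_def)
    have "deg u \<le> 2" using rd[of s1] hx'[of s1] l u adj_less by (auto simp: ready_def free_nbrs_def)
    then have wl: "walk_layout hx ((iarr s1 ''pv'')(u := Suc L)) ((iarr s1 ''pe'')(j := L)) (Suc (Suc L)) u"
      using l u j by (intro walk_extend[of hx _ _ L c]) (auto simp: lay_def L_def c_def)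
    obtain pth where pth: "path_of (iarr s ''pv'') (iarr s1 ''pv'') (ireg s ''cur'') c pth"
      using l by (auto simp: lay_def c_def)
    define s2 where "s2 = s1\<lparr>ireg := (ireg s1)(''L'' := Suc (Suc L), ''cur'' := u),
      iarr := (iarr s1)(''pe'' := (iarr s1 ''pe'')(j := L), ''pv'' := (iarr s1 ''pv'')(u := Suc L))\<rparr>"
    have r2: "run extend_prog s1 5 (\<lambda>s'. s' = s2)"
      by (rule run_wp_le) (simp_all add: extend_prog_def s2_def u_def j_def L_def fun_upd_twist)
    have l2: "lay s2"
      using wl l path_of_extend[OF pth u'(3,2), of "Suc L"] unfolding lay_def s2_def
      by (auto simp: agree_def W)
    have "run (extend_prog ;; find_prog) s1 (5 + cost find_prog)
        (\<lambda>s3. lay s3 \<and> found s3 \<and> iarr s3 ''pv'' = iarr s2 ''pv'')"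
      by (rule runP_Seq[OF r2]) (use find[OF l2] in simp)
    then obtain t s3 where t: "exec (extend_prog ;; find_prog) s1 t s3" "t \<le> 5 + cost find_prog"
      "lay s3" "found s3" "iarr s3 ''pv'' = iarr s2 ''pv''" unfolding runP_def by auto
    have "pot s3 + (cost find_prog + 6) = pot s1"
      using t(5) u' by (intro pot_place[of _ _ u "Suc L"]) (auto simp: s2_def)
    then show ?thesis using t by (intro exI[of _ t] exI[of _ s3]) auto
  qed
  have fin: "runP pot (Do (ISucc ''L'') ;; Do (ISucc ''L'')) s1 2 (walk_done s)"
    if l: "(lay s1 \<and> found s1) \<and> \<not> holds (ILess ''z'' ''c'') s1" for s1
  proof -
    have "ireg s1 ''z'' = 0" using rd l by (auto simp: ready_def base_def)
    then have "card (free_nbrs hx (iarr s1 ''pv'') (ireg s1 ''cur'')) = 0"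
      using l hx'[of s1] by (auto simp: found_def Let_def)
    then have e: "free_nbrs hx (iarr s1 ''pv'') (ireg s1 ''cur'') = {}" by simp
    have w: "walk_layout hx (iarr s1 ''pv'') (iarr s1 ''pe'') (ireg s1 ''L'') (ireg s1 ''cur'')"
      using l by (simp add: lay_def)
    obtain pth where pth: "path_of (iarr s ''pv'') (iarr s1 ''pv'') (ireg s ''cur'') (ireg s1 ''cur'') pth"
      using l by (auto simp: lay_def)
    define s2 where "s2 = s1\<lparr>ireg := (ireg s1)(''L'' := Suc (Suc (ireg s1 ''L'')))\<rparr>"
    have "run (Do (ISucc ''L'') ;; Do (ISucc ''L'')) s1 2 (\<lambda>s'. s' = s2)"
      by (rule run_wp_le) (simp_all add: s2_def)
    then have "runP pot (Do (ISucc ''L'') ;; Do (ISucc ''L'')) s1 2 (\<lambda>s'. s' = s2)"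
      by (rule runP_pot_frame) simp
    moreover have "closed_in s2" using walk_close[OF w e] hx'[of s1] l by (simp add: s2_def)
    moreover have "walk_layout (iarr s ''hx'') (iarr s2 ''pv'') (iarr s2 ''pe'') (ireg s1 ''L'') (ireg s1 ''cur'')"
      "free_nbrs (iarr s ''hx'') (iarr s2 ''pv'') (ireg s1 ''cur'') = {}"
      "path_of (iarr s ''pv'') (iarr s2 ''pv'') (ireg s ''cur'') (ireg s1 ''cur'') pth"
      using w e pth by (simp_all add: s2_def hx_def)
    ultimately show ?thesis unfolding walk_done_def by (elim runP_mono) blast+
  qed
  have "runP pot walk_prog s (2 + (cost find_prog + (1 + 2))) (walk_done s)"
    unfolding walk_prog_def
  proof (rule runP_Seq[OF start], rule runP_Seq)
    fix s1 assume "lay s1"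
    from find[OF this] show "runP pot find_prog s1 (cost find_prog) (\<lambda>s2. lay s2 \<and> found s2 \<and> iarr s2 ''pv'' = iarr s1 ''pv'')"
      by (rule runP_pot_frame) (simp add: wr_find_prog)
  next
    fix s1 s2 assume "lay s2 \<and> found s2 \<and> iarr s2 ''pv'' = iarr s1 ''pv''"
    then have "lay s2 \<and> found s2" by simp
    then have "runP pot (While (ILess ''z'' ''c'') (extend_prog ;; find_prog)) s2 1
      (\<lambda>s. (lay s \<and> found s) \<and> \<not> holds (ILess ''z'' ''c'') s)"
      using ext by (rule runP_While)
    then show "runP pot (While (ILess ''z'' ''c'') (extend_prog ;; find_prog) ;; Do (ISucc ''L'') ;; Do (ISucc ''L'')) s2 (1 + 2)
     (walk_done s)"
      by (rule runP_Seq) (rule fin)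
  qed
  then show ?thesis by (rule runP_mono) auto
qed

text \<open>The scan itself writes \<open>t\<close> and \<open>i\<close>; \<open>ins\<close> makes
  \<open>J\<close> insensitive to them, and \<open>skip\<close> lets \<open>J\<close> advance over
  vertices that are already deleted or placed.\<close>

lemma runP_scan_prog:
  assumes i: "VI ''i'' \<notin> wr p" "VI ''n'' \<notin> wr p"
    and b: "\<And>k s. J k s \<Longrightarrow> base s"
    and ins: "\<And>k s c. J k (s\<lparr>ireg := (ireg s)(''t'' := c)\<rparr>) \<longleftrightarrow> J k s"
      "\<And>k s c. J k (s\<lparr>ireg := (ireg s)(''i'' := c)\<rparr>) \<longleftrightarrow> J k s"
    and init: "J 0 s0"
    and skip: "\<And>k s. J k s \<Longrightarrow> k < n \<Longrightarrow> iarr s ''hx'' k \<noteq> 0 \<or> iarr s ''pv'' k \<noteq> 0 \<Longrightarrow> J (Suc k) s"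
    and body: "\<And>k s. J k s \<Longrightarrow> k < n \<Longrightarrow> ireg s ''i'' = k \<Longrightarrow> iarr s ''hx'' k = 0 \<Longrightarrow> iarr s ''pv'' k = 0 \<Longrightarrow>
      runP pot p s B (J (Suc k))"
    and B: "1 \<le> B"
  shows "runP pot (scan_prog p) s0 (n * (B + 6) + 2) (J n)"
proof -
  let ?b2 = "Do (ILoad ''t'' ''pv'' ''i'') ;; Cond (IEq ''t'' ''z'') p Skip"
  let ?b = "Do (ILoad ''t'' ''hx'' ''i'') ;; Cond (IEq ''t'' ''z'') ?b2 Skip"
  have "runP pot (FOR ''i'' ''n'' ?b) s0 (ireg s0 ''n'' * ((B + 4) + 2) + 2) (J (ireg s0 ''n''))"
  proof (rule runP_FOR[where Inv = J])
    fix k s assume J: "J k s" and "k < ireg s0 ''n''" and ik: "ireg s ''i'' = k"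
    then have k: "k < n" using b[OF init] by (simp add: base_def)
    have z: "ireg s ''z'' = 0" using b[OF J] by (simp add: base_def)
    define s1 where "s1 = s\<lparr>ireg := (ireg s)(''t'' := iarr s ''hx'' k)\<rparr>"
    define s2 where "s2 = s1\<lparr>ireg := (ireg s1)(''t'' := iarr s1 ''pv'' k)\<rparr>"
    have J1: "J k s1" "J k s2" using J by (auto simp: s1_def s2_def ins)
    have "runP pot ?b s (1 + ((1 + (B + 1)) + 1)) (J (Suc k))"
    proof (rule runP_Seq)
      show "runP pot (Do (ILoad ''t'' ''hx'' ''i'')) s 1 (\<lambda>s'. s' = s1)"
        by (rule runP_pot_wp) (auto simp: s1_def ik)
    next
      fix s' assume s': "s' = s1"
      show "runP pot (Cond (IEq ''t'' ''z'') ?b2 Skip) s' ((1 + (B + 1)) + 1) (J (Suc k))"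
        unfolding s'
      proof (rule runP_Cond)
        assume h: "holds (IEq ''t'' ''z'') s1"
        then have hx: "iarr s ''hx'' k = 0" by (simp add: s1_def z)
        show "runP pot ?b2 s1 (1 + (B + 1)) (J (Suc k))"
        proof (rule runP_Seq)
          show "runP pot (Do (ILoad ''t'' ''pv'' ''i'')) s1 1 (\<lambda>s'. s' = s2)"
            by (rule runP_pot_wp) (auto simp: s1_def s2_def ik)
        next
          fix s' assume s': "s' = s2"
          show "runP pot (Cond (IEq ''t'' ''z'') p Skip) s' (B + 1) (J (Suc k))"
            unfolding s'
          proof (rule runP_Cond)
            assume h: "holds (IEq ''t'' ''z'') s2"
            then show "runP pot p s2 B (J (Suc k))"
              using J1 hx k by (intro body) (auto simp: s1_def s2_def z ik)
          next
            assume h: "\<not> holds (IEq ''t'' ''z'') s2"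
            then have "J (Suc k) s2" using J1 k by (intro skip) (auto simp: s1_def s2_def z)
            then show "runP pot Skip s2 B (J (Suc k))" using B by (intro runP_pot_wp) auto
          qed
        qed
      next
        assume h: "\<not> holds (IEq ''t'' ''z'') s1"
        then have "J (Suc k) s1" using J1 k by (intro skip) (auto simp: s1_def z)
        then show "runP pot Skip s1 (1 + (B + 1)) (J (Suc k))" by (intro runP_pot_wp) auto
      qed
    qed
    then show "runP pot ?b s (B + 4) (\<lambda>s'. J (Suc k) (s'\<lparr>ireg := (ireg s')(''i'' := Suc k)\<rparr>))"
      by (rule runP_mono) (auto simp: ins)
  qed (use i init in \<open>auto simp: ins\<close>)
  moreover have "ireg s0 ''n'' = n" using b[OF init] by (simp add: base_def)
  ultimately show ?thesis unfolding scan_prog_def by (simp add: add.commute)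
qed

lemma ready_reg: "x \<notin> {''n'', ''m'', ''z'', ''o''} \<Longrightarrow> ready (s\<lparr>ireg := (ireg s)(x := c)\<rparr>) \<longleftrightarrow> ready s"
  by (auto simp: ready_def base_def)

section \<open>The scan for paths and the scan for cycles\<close>

definition paths_step :: "store \<Rightarrow> store \<Rightarrow> bool" where
  "paths_step s s' \<longleftrightarrow> ready s' \<and> closed_in s' \<and> iarr s' ''hx'' = iarr s ''hx'' \<and>
      (\<forall>v. iarr s ''pv'' v \<noteq> 0 \<longrightarrow> iarr s' ''pv'' v \<noteq> 0) \<and>
      (iarr s' ''pv'' (ireg s ''i'') \<noteq> 0 \<or> 2 \<le> card (free_nbrs (iarr s ''hx'') (iarr s ''pv'') (ireg s ''i'')))"

lemma run_paths_inner:
  assumes r: "ready s" and cl: "closed_in s" and i: "ireg s ''i'' < n"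
    and h0: "iarr s ''hx'' (ireg s ''i'') = 0" and p0: "iarr s ''pv'' (ireg s ''i'') = 0"
  shows "runP pot (Do (IMove ''cur'' ''i'') ;; find_prog ;; Cond (ILess ''o'' ''c'') Skip walk_prog) s
    (2 * cost find_prog + 7) (\<lambda>s'. paths_step s s')"
    (is "runP pot _ _ _ (paths_step s)")
proof -
  define s1 where "s1 = s\<lparr>ireg := (ireg s)(''cur'' := ireg s ''i'')\<rparr>"
  have r1: "ready s1" using r by (simp add: s1_def ready_reg)
  have "runP pot (Do (IMove ''cur'' ''i'') ;; find_prog ;; Cond (ILess ''o'' ''c'') Skip walk_prog) s
    (1 + (cost find_prog + ((cost find_prog + 5) + 1))) (paths_step s)"
  proof (rule runP_Seq)
    show "runP pot (Do (IMove ''cur'' ''i'')) s 1 (\<lambda>s'. s' = s1)"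
      by (rule runP_pot_wp) (auto simp: s1_def)
  next
    fix s' assume s': "s' = s1"
    show "runP pot (find_prog ;; Cond (ILess ''o'' ''c'') Skip walk_prog) s' (cost find_prog + ((cost find_prog + 5) + 1)) (paths_step s)"
      unfolding s'
    proof (rule runP_Seq)
      have "run find_prog s1 (cost find_prog) found"
        using r1 i h0 by (intro run_find_prog) (auto simp: ready_def s1_def)
      then show "runP pot find_prog s1 (cost find_prog) found"
        by (rule runP_pot_frame) (simp add: wr_find_prog)
    next
      fix s2 assume a: "agree (wr find_prog) s1 s2" and f: "found s2"
      have r2: "ready s2" by (rule ready_agree[OF a r1]) (auto simp: wr_find_prog)
      have eq: "ireg s2 ''cur'' = ireg s ''i''" "ireg s2 ''L'' = ireg s ''L''"
        "iarr s2 ''pv'' = iarr s ''pv''" "iarr s2 ''pe'' = iarr s ''pe''" "iarr s2 ''hx'' = iarr s ''hx''"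
        using agreeD[OF a] by (auto simp: wr_find_prog s1_def)
      have o: "ireg s2 ''o'' = 1" using r2 by (auto simp: ready_def base_def)
      have c: "ireg s2 ''c'' = card (free_nbrs (iarr s ''hx'') (iarr s ''pv'') (ireg s ''i''))"
        using f eq by (auto simp: found_def Let_def)
      show "runP pot (Cond (ILess ''o'' ''c'') Skip walk_prog) s2 ((cost find_prog + 5) + 1) (paths_step s)"
      proof (rule runP_Cond)
        assume "holds (ILess ''o'' ''c'') s2"
        then show "runP pot Skip s2 (cost find_prog + 5) (paths_step s)"
          using r2 cl eq o c by (intro runP_pot_wp) (auto simp: paths_step_def)
      next
        assume "\<not> holds (ILess ''o'' ''c'') s2"
        then have "runP pot walk_prog s2 (cost find_prog + 5) (walk_done s2)"
          using r2 cl eq o c i h0 p0 by (intro run_walk_prog) auto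
        then show "runP pot walk_prog s2 (cost find_prog + 5) (paths_step s)"
        proof (rule runP_mono)
          fix s3 assume a3: "agree (wr walk_prog) s2 s3" and "walk_done s2 s3"
          then obtain pth t where cl3: "closed_in s3" and
            p: "path_of (iarr s ''pv'') (iarr s3 ''pv'') (ireg s ''i'') t pth" using eq by (auto simp: walk_done_def)
          have "ready s3" by (rule ready_agree[OF a3 r2]) (auto simp: wr_walk_prog)
          moreover have "iarr s3 ''hx'' = iarr s ''hx''" using agreeD(2)[OF a3] eq by (simp add: wr_walk_prog)
          moreover have "\<forall>v. iarr s ''pv'' v \<noteq> 0 \<longrightarrow> iarr s3 ''pv'' v \<noteq> 0"
            using p unfolding path_of_def by blast
          moreover have "iarr s3 ''pv'' (ireg s ''i'') \<noteq> 0"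
            using p unfolding path_of_def by (metis list.set_sel(1))
          ultimately show "paths_step s s3" using cl3 by (simp add: paths_step_def)
        qed simp
      qed
    qed
  qed
  then show ?thesis by (rule runP_mono) auto
qed

text \<open>The last clause counts undeleted rather than free neighbours. This number does not
  change during the scan, so the clause stays true for vertices passed earlier.\<close>

lemma run_paths_prog:
  assumes r: "ready s" and cl: "closed_in s"
  shows "runP pot paths_prog s (n * (2 * cost find_prog + 13) + 2) (\<lambda>s'. ready s' \<and> closed_in s' \<and>
    iarr s' ''hx'' = iarr s ''hx'' \<and> (\<forall>v<n. iarr s ''hx'' v = 0 \<longrightarrow> iarr s' ''pv'' v = 0 \<longrightarrow>
      2 \<le> card {u. adj v u \<and> iarr s ''hx'' u = 0}))"
proof -
  define hx where "hx = iarr s ''hx''"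
  let ?J = "\<lambda>k s'. ready s' \<and> closed_in s' \<and> iarr s' ''hx'' = hx \<and> (\<forall>v<k. hx v = 0 \<longrightarrow> iarr s' ''pv'' v = 0 \<longrightarrow>
      2 \<le> card {u. adj v u \<and> hx u = 0})"
  let ?p = "Do (IMove ''cur'' ''i'') ;; find_prog ;; Cond (ILess ''o'' ''c'') Skip walk_prog"
  have "runP pot (scan_prog ?p) s (n * ((2 * cost find_prog + 7) + 6) + 2) (?J n)"
  proof (rule runP_scan_prog[where J = ?J])
    fix k s1 assume J: "?J k s1" and k: "k < n" "ireg s1 ''i'' = k" "iarr s1 ''hx'' k = 0" "iarr s1 ''pv'' k = 0"
    have "runP pot ?p s1 (2 * cost find_prog + 7) (paths_step s1)"
      using J k by (intro run_paths_inner) auto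
    then show "runP pot ?p s1 (2 * cost find_prog + 7) (?J (Suc k))"
    proof (rule runP_mono)
      fix s2 assume "paths_step s1 s2"
      note * = this[unfolded paths_step_def]
      have "card (free_nbrs hx (iarr s1 ''pv'') k) \<le> card {u. adj k u \<and> hx u = 0}"
        by (rule card_mono, rule finite_subset[OF _ finite_nbrs[of k]]) (auto simp: free_nbrs_def nbrs_def)
      then have new: "iarr s2 ''pv'' k = 0 \<Longrightarrow> 2 \<le> card {u. adj k u \<and> hx u = 0}" using * J k by auto
      have "2 \<le> card {u. adj v u \<and> hx u = 0}" if v: "v < Suc k" "hx v = 0" "iarr s2 ''pv'' v = 0" for v
      proof (cases "v = k")
        case True
        then show ?thesis using new v by simp
      next
        case False
        then have "iarr s1 ''pv'' v = 0" using * v by blast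
        then show ?thesis using J v False by (auto simp: less_Suc_eq)
      qed
      then show "?J (Suc k) s2" using * J by auto
    qed simp
  qed (use r cl in \<open>auto simp: wr_find_prog wr_walk_prog ready_reg hx_def less_Suc_eq\<close>, auto simp: ready_def)
  then show ?thesis unfolding paths_prog_def by (rule runP_mono) (auto simp: hx_def)
qed

text \<open>A new label can only shrink the sets of free neighbours, and an unplaced vertex is not
  constrained by the layout.\<close>

lemma closed_layout_new_label:
  assumes "closed_layout hx pv pe L" "pv v = 0" "k \<noteq> 0"
  shows "closed_layout (hx(v := k)) pv pe L"
proof -
  have "free_nbrs (hx(v := k)) pv u \<subseteq> free_nbrs hx pv u" for u using assms(3) by (auto simp: free_nbrs_def)
  moreover have "layout (hx(v := k)) pv pe" using assms unfolding closed_layout_def layout_def by simp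
  ultimately show ?thesis using assms(1) unfolding closed_layout_def by blast
qed

definition cycles_step :: "nat \<Rightarrow> store \<Rightarrow> store \<Rightarrow> bool" where
  "cycles_step i s s' \<longleftrightarrow> ready s' \<and> closed_in s' \<and> iarr s' ''hx'' = (iarr s ''hx'')(i := Suc (ireg s ''k'')) \<and>
      ireg s' ''k'' = Suc (ireg s ''k'') \<and> labelled (iarr s' ''hx'') (ireg s' ''k'') \<and>
      cycles_left (iarr s' ''hx'') (iarr s' ''pv'') \<and>
      (\<forall>v. iarr s ''pv'' v \<noteq> 0 \<longrightarrow> iarr s' ''pv'' v \<noteq> 0) \<and>
      (\<exists>c. is_cycle edge_sets c \<and> set c \<inter> processed (iarr s ''hx'') (iarr s ''pv'') = {} \<and>
         processed (iarr s' ''hx'') (iarr s' ''pv'') = processed (iarr s ''hx'') (iarr s ''pv'') \<union> set c)"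

lemma run_cycles_inner:
  assumes r: "ready s" and cl: "closed_in s" and i: "ireg s ''i'' = i" "i < n"
    and h0: "iarr s ''hx'' i = 0" and p0: "iarr s ''pv'' i = 0"
    and lab: "labelled (iarr s ''hx'') (ireg s ''k'')" and S: "cycles_left (iarr s ''hx'') (iarr s ''pv'')"
  shows "runP pot ((Do (ISucc ''k'') ;; Do (IStore ''hx'' ''i'' ''k'') ;; Do (IMove ''cur'' ''i'')) ;;
     find_prog ;; Do (IMove ''cur'' ''nx'') ;; walk_prog) s
    (2 * cost find_prog + 9) (\<lambda>s'. cycles_step i s s')"
    (is "runP pot _ _ _ (cycles_step i s)")
proof -
  define hx where "hx = iarr s ''hx''"
  define pv where "pv = iarr s ''pv''"
  define k where "k = Suc (ireg s ''k'')"
  define hx' where "hx' = hx(i := k)"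
  define s1 where "s1 = s\<lparr>ireg := (ireg s)(''k'' := k, ''cur'' := i), iarr := (iarr s)(''hx'' := hx')\<rparr>"
  have low_i: "low i" "i \<notin> processed hx pv" using S i h0 p0 by (auto simp: cycles_left_def processed_def hx_def pv_def)
  have nb: "u \<in> free_nbrs hx' pv i \<and> low u" if "adj i u" for u
  proof -
    have "low u" using S low_i that by (auto simp: cycles_left_def nbrs_def hx_def pv_def)
    moreover have "u \<notin> processed hx pv" using S low_i that adj_sym
      by (auto simp: cycles_left_def hx_def[symmetric] pv_def[symmetric])
    moreover have "u \<noteq> i" using that by auto
    ultimately show ?thesis using that by (auto simp: free_nbrs_def processed_def hx'_def)
  qed
  have "card (nbrs i) = 2" using S low_i by (auto simp: cycles_left_def card_nbrs hx_def pv_def)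
  then have "nbrs i \<noteq> {}" by auto
  then have ne: "free_nbrs hx' pv i \<noteq> {}" using nb by (auto simp: nbrs_def)
  have r1: "ready s1" using r by (auto simp: s1_def ready_def base_def hx'_def hx_def k_def)
  have cl1: "closed_layout hx' pv (iarr s ''pe'') (ireg s ''L'')"
    using closed_layout_new_label[OF cl, of i k] p0 by (simp add: hx'_def hx_def pv_def k_def)
  have "runP pot ((Do (ISucc ''k'') ;; Do (IStore ''hx'' ''i'' ''k'') ;; Do (IMove ''cur'' ''i'')) ;;
     find_prog ;; Do (IMove ''cur'' ''nx'') ;; walk_prog) s
    (3 + (cost find_prog + (1 + (cost find_prog + 5)))) (cycles_step i s)"
  proof (rule runP_Seq)
    show "runP pot (Do (ISucc ''k'') ;; Do (IStore ''hx'' ''i'' ''k'') ;; Do (IMove ''cur'' ''i'')) s 3 (\<lambda>s'. s' = s1)"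
      by (rule runP_pot_wp) (auto simp: s1_def k_def hx'_def hx_def i)
  next
    fix s' assume s': "s' = s1"
    show "runP pot (find_prog ;; Do (IMove ''cur'' ''nx'') ;; walk_prog) s'
       (cost find_prog + (1 + (cost find_prog + 5))) (cycles_step i s)"
      unfolding s'
    proof (rule runP_Seq)
      have "run find_prog s1 (cost find_prog) found"
        using r1 low_i by (intro run_find_prog) (auto simp: ready_def s1_def low_def)
      then show "runP pot find_prog s1 (cost find_prog) found"
        by (rule runP_pot_frame) (simp add: wr_find_prog)
    next
      fix s2 assume a: "agree (wr find_prog) s1 s2" and f: "found s2"
      have r2: "ready s2" by (rule ready_agree[OF a r1]) (auto simp: wr_find_prog)
      have eq: "ireg s2 ''cur'' = i" "ireg s2 ''L'' = ireg s ''L''" "ireg s2 ''k'' = k"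
        "iarr s2 ''pv'' = pv" "iarr s2 ''pe'' = iarr s ''pe''" "iarr s2 ''hx'' = hx'"
        using agreeD[OF a] by (auto simp: wr_find_prog s1_def pv_def)
      define u where "u = ireg s2 ''nx''"
      have "card (free_nbrs hx' pv i) \<noteq> 0" using ne by simp
      then have u: "u \<in> free_nbrs hx' pv i" using f eq by (auto simp: found_def Let_def u_def)
      then have u': "u < n" "hx' u = 0" "pv u = 0" "adj i u" using adj_less by (auto simp: free_nbrs_def)
      have "free_nbrs hx' pv u \<subseteq> nbrs u - {i}" by (auto simp: free_nbrs_def nbrs_def hx'_def k_def)
      then have "card (free_nbrs hx' pv u) \<le> card (nbrs u - {i})" by (intro card_mono) auto
      also have "\<dots> = deg u - 1"
        using u'(4) adj_sym[of i u] by (subst card_Diff_singleton) (auto simp: nbrs_def card_nbrs[unfolded nbrs_def])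
      finally have cu: "card (free_nbrs hx' pv u) \<le> 1" using nb[OF u'(4)] unfolding low_def by linarith
      define s3 where "s3 = s2\<lparr>ireg := (ireg s2)(''cur'' := u)\<rparr>"
      have r3: "ready s3" using r2 by (simp add: s3_def ready_reg)
      have eq3: "ireg s3 ''cur'' = u" "ireg s3 ''L'' = ireg s ''L''" "ireg s3 ''k'' = k"
        "iarr s3 ''pv'' = pv" "iarr s3 ''pe'' = iarr s ''pe''" "iarr s3 ''hx'' = hx'"
        using eq by (auto simp: s3_def)
      show "runP pot (Do (IMove ''cur'' ''nx'') ;; walk_prog) s2 (1 + (cost find_prog + 5)) (cycles_step i s)"
      proof (rule runP_Seq)
        show "runP pot (Do (IMove ''cur'' ''nx'')) s2 1 (\<lambda>s'. s' = s3)"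
          by (rule runP_pot_wp) (auto simp: s3_def u_def)
      next
        fix s' assume s': "s' = s3"
        have "runP pot walk_prog s3 (cost find_prog + 5) (walk_done s3)"
          by (rule run_walk_prog[OF r3]) (use cl1 u' cu in \<open>simp_all add: eq3\<close>)
        then show "runP pot walk_prog s' (cost find_prog + 5) (cycles_step i s)"
          unfolding s'
        proof (rule runP_mono)
          fix s4 assume a4: "agree (wr walk_prog) s3 s4" and "walk_done s3 s4"
          then obtain pth t L where cl4: "closed_in s4"
            and w: "walk_layout (hx(i := k)) (iarr s4 ''pv'') (iarr s4 ''pe'') L t"
            and fn: "free_nbrs (hx(i := k)) (iarr s4 ''pv'') t = {}"
            and p: "path_of pv (iarr s4 ''pv'') u t pth" using eq3 by (auto simp: walk_done_def hx'_def)
          have r4: "ready s4" by (rule ready_agree[OF a4 r3]) (auto simp: wr_walk_prog)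
          have e4: "iarr s4 ''hx'' = hx'" "ireg s4 ''k'' = k"
            using agreeD[OF a4] eq3 by (auto simp: wr_walk_prog)
          have k0: "k \<noteq> 0" by (simp add: k_def)
          note cyc = walk_around_cycle[OF S[folded hx_def pv_def] i(2) h0[folded hx_def] p0[folded pv_def] k0 w fn p u'(4)]
          have "labelled hx' k" using labelled_new[OF lab i(2) h0] by (simp add: hx'_def hx_def k_def)
          moreover have "\<forall>v. pv v \<noteq> 0 \<longrightarrow> iarr s4 ''pv'' v \<noteq> 0" using p unfolding path_of_def by blast
          moreover have "\<exists>c. is_cycle edge_sets c \<and> set c \<inter> processed hx pv = {} \<and>
            processed hx' (iarr s4 ''pv'') = processed hx pv \<union> set c"
            using cyc unfolding hx'_def by blast
          ultimately show "cycles_step i s s4"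
            using cl4 r4 e4 cyc(2) by (simp add: cycles_step_def hx'_def hx_def pv_def k_def)
        qed simp
      qed
    qed
  qed
  then show ?thesis by (rule runP_mono) auto
qed

text \<open>\<open>P\<close> collects the processed vertices. A newly found cycle avoids
  \<open>P\<close>, hence all earlier cycles, without any comparison with them.\<close>

definition disjoint_cycles :: "nat list list \<Rightarrow> nat set \<Rightarrow> bool" where
  "disjoint_cycles cs P \<longleftrightarrow> (\<forall>c\<in>set cs. is_cycle edge_sets c \<and> set c \<subseteq> P) \<and>
     sorted_wrt (\<lambda>c c'. set c \<inter> set c' = {}) cs"

text \<open>Every deletion made here yields a further cycle disjoint from the earlier ones, so that
  the increase of \<open>k\<close> falls under the bound on disjoint cycles.\<close>

lemma run_cycles_prog:
  assumes r: "ready s" and cl: "closed_in s"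
    and lab: "labelled (iarr s ''hx'') (ireg s ''k'')" and S: "cycles_left (iarr s ''hx'') (iarr s ''pv'')"
  shows "runP pot cycles_prog s (n * (2 * cost find_prog + 15) + 2) (\<lambda>s'. ready s' \<and> closed_in s' \<and>
      labelled (iarr s' ''hx'') (ireg s' ''k'') \<and> (\<forall>v<n. iarr s' ''hx'' v = 0 \<longrightarrow> iarr s' ''pv'' v \<noteq> 0) \<and>
      (\<exists>cs P. disjoint_cycles cs P \<and> ireg s' ''k'' = ireg s ''k'' + length cs))"
proof -
  let ?J = "\<lambda>i s'. ready s' \<and> closed_in s' \<and>
      labelled (iarr s' ''hx'') (ireg s' ''k'') \<and> cycles_left (iarr s' ''hx'') (iarr s' ''pv'') \<and>
      (\<forall>v<i. iarr s' ''hx'' v = 0 \<longrightarrow> iarr s' ''pv'' v \<noteq> 0) \<and>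
      (\<exists>cs. disjoint_cycles cs (processed (iarr s' ''hx'') (iarr s' ''pv'')) \<and> ireg s' ''k'' = ireg s ''k'' + length cs)"
  let ?p = "(Do (ISucc ''k'') ;; Do (IStore ''hx'' ''i'' ''k'') ;; Do (IMove ''cur'' ''i'')) ;;
     find_prog ;; Do (IMove ''cur'' ''nx'') ;; walk_prog"
  have "runP pot (scan_prog ?p) s (n * ((2 * cost find_prog + 9) + 6) + 2) (?J n)"
  proof (rule runP_scan_prog[where J = ?J])
    fix k s1 assume J: "?J k s1" and k: "k < n" "ireg s1 ''i'' = k" "iarr s1 ''hx'' k = 0" "iarr s1 ''pv'' k = 0"
    obtain cs where cs: "disjoint_cycles cs (processed (iarr s1 ''hx'') (iarr s1 ''pv''))"
      "ireg s1 ''k'' = ireg s ''k'' + length cs" using J by blast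
    have "ready s1" "closed_in s1" "labelled (iarr s1 ''hx'') (ireg s1 ''k'')"
      "cycles_left (iarr s1 ''hx'') (iarr s1 ''pv'')" using J by auto
    note inner = run_cycles_inner[OF this(1,2) k(2,1,3,4) this(3,4)]
    show "runP pot ?p s1 (2 * cost find_prog + 9) (?J (Suc k))"
    proof (rule runP_mono[OF inner])
      fix s2 assume "cycles_step k s1 s2"
      note * = this[unfolded cycles_step_def]
      then obtain c where c: "is_cycle edge_sets c" "set c \<inter> processed (iarr s1 ''hx'') (iarr s1 ''pv'') = {}"
         "processed (iarr s2 ''hx'') (iarr s2 ''pv'') = processed (iarr s1 ''hx'') (iarr s1 ''pv'') \<union> set c" by blast
      have "disjoint_cycles (c # cs) (processed (iarr s2 ''hx'') (iarr s2 ''pv''))"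
        unfolding disjoint_cycles_def
      proof (intro conjI ballI)
        have sub: "set c' \<subseteq> processed (iarr s1 ''hx'') (iarr s1 ''pv'')" "is_cycle edge_sets c'" if "c' \<in> set cs" for c'
          using cs(1) that by (auto simp: disjoint_cycles_def)
        show "sorted_wrt (\<lambda>c c'. set c \<inter> set c' = {}) (c # cs)"
          using cs(1) c(2) sub(1) unfolding disjoint_cycles_def sorted_wrt.simps by blast
        fix c' assume "c' \<in> set (c # cs)"
        then show "is_cycle edge_sets c'" "set c' \<subseteq> processed (iarr s2 ''hx'') (iarr s2 ''pv'')"
          using c(1) sub unfolding c(3) by auto
      qed
      then have ex: "\<exists>cs. disjoint_cycles cs (processed (iarr s2 ''hx'') (iarr s2 ''pv'')) \<and>
        ireg s2 ''k'' = ireg s ''k'' + length cs"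
        using * cs(2) by (intro exI[of _ "c # cs"]) simp
      have h2: "iarr s2 ''hx'' = (iarr s1 ''hx'')(k := Suc (ireg s1 ''k''))" using * by blast
      have "iarr s2 ''pv'' v \<noteq> 0" if v: "v < Suc k" "iarr s2 ''hx'' v = 0" for v
      proof -
        have "v \<noteq> k" "iarr s1 ''hx'' v = 0" using v(2) h2 by (auto split: if_splits)
        then have "iarr s1 ''pv'' v \<noteq> 0" using J v by (auto simp: less_Suc_eq)
        then show ?thesis using * by blast
      qed
      then show "?J (Suc k) s2" using * ex by blast
    qed simp
  next
    show "?J 0 s" using assms by (auto simp: disjoint_cycles_def)
  next
    fix k s assume "?J k s"
    then show "base s" by (simp add: ready_def)
  next
    fix k s1 assume "?J k s1" "k < n" "iarr s1 ''hx'' k \<noteq> 0 \<or> iarr s1 ''pv'' k \<noteq> 0"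
    then show "?J (Suc k) s1" by (auto simp: less_Suc_eq)
  qed (simp_all add: wr_find_prog wr_walk_prog ready_reg)
  then show ?thesis unfolding cycles_prog_def by (rule runP_mono) auto
qed

text \<open>A leftover vertex has two undeleted neighbours and degree at most 2, so these are all
  its neighbours. Placed vertices have no free neighbours, which separates the leftover part from
  them.\<close>

lemma cycles_left_after_paths:
  assumes hx: "\<forall>v. hx v \<noteq> 0 \<longleftrightarrow> v < n \<and> \<not> low v" and cl: "closed_layout hx pv pe L"
    and two: "\<forall>v<n. hx v = 0 \<longrightarrow> pv v = 0 \<longrightarrow> 2 \<le> card {u. adj v u \<and> hx u = 0}"
  shows "cycles_left hx pv"
proof -
  have lown: "low v \<Longrightarrow> v < n" for v by (simp add: low_def)
  have low0: "low v \<longleftrightarrow> v < n \<and> hx v = 0" for v using spec[OF hx, of v] lown[of v] by metis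
  have proc: "processed hx pv = {v. pv v \<noteq> 0}" unfolding processed_def low0 by blast
  show ?thesis unfolding cycles_left_def proc
  proof (intro conjI allI impI ballI)
    fix u v assume "adj u v" "u \<in> {v. pv v \<noteq> 0}" "low v"
    then have "free_nbrs hx pv u = {}" using cl by (auto simp: closed_layout_def)
    then show "v \<in> {v. pv v \<noteq> 0}" using \<open>adj u v\<close> \<open>low v\<close> low0 by (auto simp: free_nbrs_def)
  next
    fix v assume v: "low v" "v \<notin> {v. pv v \<noteq> 0}"
    then have "2 \<le> card {u. adj v u \<and> hx u = 0}" using two low0 by auto
    moreover have sub: "{u. adj v u \<and> hx u = 0} \<subseteq> nbrs v" by (auto simp: nbrs_def)
    moreover have c: "card (nbrs v) \<le> 2" using v by (simp add: card_nbrs low_def)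
    moreover have "card {u. adj v u \<and> hx u = 0} \<le> card (nbrs v)" using sub by (intro card_mono) auto
    ultimately have "card (nbrs v) = 2" "card {u. adj v u \<and> hx u = 0} = card (nbrs v)" by linarith+
    then show "deg v = 2" by (simp add: card_nbrs)
    fix u assume "u \<in> nbrs v"
    moreover have "{u. adj v u \<and> hx u = 0} = nbrs v"
      using \<open>card {u. adj v u \<and> hx u = 0} = card (nbrs v)\<close> sub by (intro card_subset_eq) auto
    ultimately show "low u" using low0 adj_less[of v u] by (auto simp: nbrs_def)
  next
    fix v assume "v < n" "\<not> low v"
    then show "hx v \<noteq> 0" using low0[of v] by simp
  qed
qed

end

section \<open>Solving for a fixed option vector\<close>

lemma wp_mono: "wp c Q s \<Longrightarrow> (\<And>t. Q t \<Longrightarrow> Q' t) \<Longrightarrow> wp c Q' s"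
proof (induction c arbitrary: Q Q' s)
  case (Seq p q)
  then show ?case unfolding wp.simps by metis
qed auto

section \<open>The phases of the solver for one option vector\<close>

definition select_prog :: prog where
  "select_prog = FOR ''i'' ''n''
     (Do (ILoad ''t'' ''hx'' ''i'') ;; Do (ILoad ''t'' ''opt'' ''t'') ;;
      Cond (IEq ''t'' ''o'') (Do (IStore ''sel'' ''i'' ''o'')) (Do (IStore ''sel'' ''i'' ''z'')) ;;
      Do (IStore ''cov'' ''i'' ''z'') ;; Do (IStore ''nb'' ''i'' ''z''))"

text \<open>\<open>r1\<close> and \<open>r2\<close> hold ranks plus 2 and can be compared with
  options directly.\<close>

definition choose_prog :: prog where
  "choose_prog = FOR ''j'' ''m''
     (Do (ILoad ''u'' ''end1'' ''j'') ;; Do (ILoad ''hu'' ''hx'' ''u'') ;; Do (ILoad ''ou'' ''opt'' ''hu'') ;;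
      Do (ILoad ''v'' ''end2'' ''j'') ;; Do (ILoad ''hv'' ''hx'' ''v'') ;; Do (ILoad ''ov'' ''opt'' ''hv'') ;;
      Do (ILoad ''ru'' ''r1'' ''j'') ;; Do (ILoad ''rv'' ''r2'' ''j'') ;; Do (IConst ''c'' 0) ;;
      Cond (IEq ''hu'' ''z'')
        (Cond (IEq ''hv'' ''z'') Skip (Cond (IEq ''ov'' ''rv'') (Do (IConst ''c'' 1)) Skip))
        (Cond (IEq ''ou'' ''ru'')
          (Cond (IEq ''hv'' ''z'') (Do (IConst ''c'' 1)) (Cond (IEq ''ov'' ''rv'') (Do (IConst ''c'' 1)) Skip)) Skip) ;;
      Do (IStore ''che'' ''j'' ''c''))"

text \<open>Both ends are tested before either is marked, so an edge never clashes with
  itself.\<close>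

definition cover_prog :: prog where
  "cover_prog = Do (IConst ''bd'' 0) ;; FOR ''j'' ''m''
     (Do (ILoad ''c'' ''che'' ''j'') ;;
      Cond (IEq ''c'' ''z'') Skip
        (Do (ILoad ''u'' ''end1'' ''j'') ;; Do (ILoad ''v'' ''end2'' ''j'') ;;
         Do (ILoad ''t'' ''cov'' ''u'') ;; Cond (IEq ''t'' ''z'') Skip (Do (IConst ''bd'' 1)) ;;
         Do (ILoad ''t'' ''cov'' ''v'') ;; Cond (IEq ''t'' ''z'') Skip (Do (IConst ''bd'' 1)) ;;
         Do (IStore ''cov'' ''u'' ''o'') ;; Do (IStore ''cov'' ''v'' ''o'')))"

definition block_prog :: prog where
  "block_prog = Do (IConst ''be'' 0) ;; FOR ''j'' ''m''
     (Do (ILoad ''u'' ''end1'' ''j'') ;; Do (ILoad ''v'' ''end2'' ''j'') ;;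
      Do (ILoad ''su'' ''sel'' ''u'') ;; Do (ILoad ''sv'' ''sel'' ''v'') ;;
      Cond (IEq ''su'' ''z'') Skip
        (Do (IStore ''nb'' ''v'' ''o'') ;; Cond (IEq ''sv'' ''z'') Skip (Do (IConst ''be'' 1))) ;;
      Cond (IEq ''sv'' ''z'') Skip (Do (IStore ''nb'' ''u'' ''o'')))"

definition clear_prog :: prog where
  "clear_prog = Do (RZero ''y'') ;; FOR ''p'' ''L'' (Do (RStore ''w'' ''p'' ''y''))"

definition vweight_prog :: prog where
  "vweight_prog = FOR ''i'' ''n''
     (Do (ILoad ''q'' ''pv'' ''i'') ;; Cond (IEq ''q'' ''z'') Skip
       (Do (ILoad ''t'' ''cov'' ''i'') ;; Cond (IEq ''t'' ''z'')
         (Do (ILoad ''t'' ''nb'' ''i'') ;; Cond (IEq ''t'' ''z'')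
            (Do (RLoad ''y'' ''wv'' ''i'') ;; Do (RStore ''w'' ''q'' ''y'')) Skip) Skip))"

definition eweight_prog :: prog where
  "eweight_prog = FOR ''j'' ''m''
     (Do (ILoad ''q'' ''pe'' ''j'') ;; Cond (IEq ''q'' ''z'') Skip
       (Do (ILoad ''u'' ''end1'' ''j'') ;; Do (ILoad ''t'' ''cov'' ''u'') ;; Cond (IEq ''t'' ''z'')
         (Do (ILoad ''v'' ''end2'' ''j'') ;; Do (ILoad ''t'' ''cov'' ''v'') ;; Cond (IEq ''t'' ''z'')
            (Do (RLoad ''y'' ''we'' ''j'') ;; Do (RStore ''w'' ''q'' ''y'')) Skip) Skip))"

text \<open>Three values are live: \<open>x1\<close>, \<open>x2\<close>, \<open>x3\<close> hold
  \<open>dp_val\<close> at \<open>p\<close>, \<open>p - 1\<close> and \<open>p - 2\<close>. The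
  decisions are kept in \<open>tk\<close> for the trace.\<close>

definition dp_prog :: prog where
  "dp_prog = (Do (RZero ''x1'') ;; Do (RZero ''x2'') ;; Do (RZero ''x3'')) ;; FOR ''p'' ''L''
     (Do (RLoad ''y'' ''w'' ''p'') ;; Do (RAdd ''y'' ''y'' ''x3'') ;; Do (RMove ''x3'' ''x2'') ;; Do (RMove ''x2'' ''x1'') ;;
      Cond (RLess ''x1'' ''y'') (Do (RMove ''x1'' ''y'') ;; Do (IStore ''tk'' ''p'' ''o'')) (Do (IStore ''tk'' ''p'' ''z'')))"

text \<open>\<open>sk\<close> is the number of positions still to be passed over: after position
  \<open>p\<close> is taken, the recursion continues with \<open>dp_set a (p - 2)\<close>.\<close>

definition trace_prog :: prog where
  "trace_prog = (Do (IMove ''p'' ''L'') ;; Do (IConst ''sk'' 0)) ;; FOR ''i'' ''L''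
     (Do (IPred ''p'') ;; Cond (IEq ''sk'' ''z'')
        (Do (ILoad ''t'' ''tk'' ''p'') ;; Cond (IEq ''t'' ''z'') (Do (IStore ''ch'' ''p'' ''z''))
           (Do (IStore ''ch'' ''p'' ''o'') ;; Do (IConst ''sk'' 2)))
        (Do (IPred ''sk'') ;; Do (IStore ''ch'' ''p'' ''z'')))"

definition cand_body :: "name \<Rightarrow> name \<Rightarrow> name \<Rightarrow> name \<Rightarrow> name \<Rightarrow> prog" where
  "cand_body i sel pv cv w =
     Do (ILoad ''t'' sel i) ;; Do (ILoad ''q'' pv i) ;; Cond (IEq ''q'' ''z'') Skip
       (Do (ILoad ''c'' ''ch'' ''q'') ;; Cond (IEq ''c'' ''z'') Skip (Do (IMove ''t'' ''o''))) ;;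
     Do (IStore cv i ''t'') ;; Cond (IEq ''t'' ''z'') Skip
       (Do (RLoad ''y'' w i) ;; Do (RAdd ''val'' ''val'' ''y''))"

definition cand_prog :: prog where
  "cand_prog = Do (RZero ''val'') ;; FOR ''i'' ''n'' (cand_body ''i'' ''sel'' ''pv'' ''cv'' ''wv'') ;;
     FOR ''j'' ''m'' (cand_body ''j'' ''che'' ''pe'' ''ce'' ''we'')"

definition update_prog :: prog where
  "update_prog = Cond (IEq ''bd'' ''z'') (Cond (IEq ''be'' ''z'') (Cond (RLess ''best'' ''val'')
     (Do (RMove ''best'' ''val'') ;;
      FOR ''i'' ''n'' (Do (ILoad ''t'' ''cv'' ''i'') ;; Do (IStore ''outv'' ''i'' ''t'')) ;;
      FOR ''j'' ''m'' (Do (ILoad ''t'' ''ce'' ''j'') ;; Do (IStore ''oute'' ''j'' ''t'')))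
     Skip) Skip) Skip"

definition solve_prog :: prog where
  "solve_prog = select_prog ;; choose_prog ;; cover_prog ;; block_prog ;; clear_prog ;; vweight_prog ;;
     eweight_prog ;; dp_prog ;; trace_prog ;; cand_prog ;; update_prog"

context total_matching_prog
begin

section \<open>Correctness and cost of the phases\<close>

definition env :: "(nat \<Rightarrow> nat) \<Rightarrow> (nat \<Rightarrow> nat) \<Rightarrow> (nat \<Rightarrow> nat) \<Rightarrow> nat \<Rightarrow> (nat \<Rightarrow> nat) \<Rightarrow> store \<Rightarrow> bool" where
  "env hx pv pe L opt s \<longleftrightarrow> base s \<and> iarr s ''hx'' = hx \<and> iarr s ''pv'' = pv \<and> iarr s ''pe'' = pe \<and>
     ireg s ''L'' = L \<and> iarr s ''opt'' = opt \<and>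
     (\<forall>i<m. iarr s ''r1'' i = rk (X i) i + 2 \<and> iarr s ''r2'' i = rk (Y i) i + 2)"

lemma env_reg: "x \<notin> {''n'', ''m'', ''z'', ''o'', ''L''} \<Longrightarrow>
    env hx pv pe L opt (s\<lparr>ireg := (ireg s)(x := c)\<rparr>) \<longleftrightarrow> env hx pv pe L opt s"
  by (auto simp: env_def base_def)

lemma run_select_prog:
  assumes "env hx pv pe L opt s"
  shows "run select_prog s (n * 8 + 2) (\<lambda>s'. env hx pv pe L opt s' \<and> (\<forall>v<n. (iarr s' ''sel'' v \<noteq> 0 \<longleftrightarrow> sel hx opt v) \<and>
    iarr s' ''cov'' v = 0 \<and> iarr s' ''nb'' v = 0))"
  unfolding select_prog_def
  by (rule run_FOR_wp[where Inv = "\<lambda>k s'. env hx pv pe L opt s' \<and> (\<forall>v<k. (iarr s' ''sel'' v \<noteq> 0 \<longleftrightarrow> sel hx opt v) \<and>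
    iarr s' ''cov'' v = 0 \<and> iarr s' ''nb'' v = 0)"])
    (use assms in \<open>auto simp: env_def base_def less_Suc_eq sel_def\<close>)

lemma run_choose_prog:
  assumes "env hx pv pe L opt s"
  shows "run choose_prog s (m * 17 + 2) (\<lambda>s'. env hx pv pe L opt s' \<and> (\<forall>j<m. iarr s' ''che'' j \<noteq> 0 \<longleftrightarrow> chosen hx opt j))"
  unfolding choose_prog_def
proof (rule run_FOR_wp[where Inv = "\<lambda>k s'. env hx pv pe L opt s' \<and> (\<forall>j<k. iarr s' ''che'' j \<noteq> 0 \<longleftrightarrow> chosen hx opt j)"], goal_cases)
  case (7 k s')
  have ch: "chosen hx opt k \<longleftrightarrow> (if hx (X k) = 0 then hx (Y k) \<noteq> 0 \<and> opt (hx (Y k)) = rk (Y k) k + 2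
    else opt (hx (X k)) = rk (X k) k + 2 \<and> (hx (Y k) = 0 \<or> opt (hx (Y k)) = rk (Y k) k + 2))"
    using 7(2) by (auto simp: chosen_def)
  have e: "env hx pv pe L opt s'" using 7(1) by blast
  show ?case
  proof (rule wp_mono[where Q = "\<lambda>t. iarr t ''che'' = (iarr s' ''che'')(k := if chosen hx opt k then 1 else 0) \<and>
      env hx pv pe L opt t"], goal_cases)
    case 1
    show ?case using 7(2,3) e by (simp add: ch env_def base_def)
  next
    case (2 t)
    then show ?case using 7(1) by (simp add: less_Suc_eq env_reg)
  qed
qed (use assms in \<open>auto simp: env_def base_def\<close>)

lemma run_cover_prog:
  assumes e: "env hx pv pe L opt s" and cov0: "\<forall>v<n. iarr s ''cov'' v = 0"
    and che: "\<forall>j<m. iarr s ''che'' j \<noteq> 0 \<longleftrightarrow> chosen hx opt j"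
  shows "run cover_prog s (m * 14 + 3) (\<lambda>s'. env hx pv pe L opt s' \<and> (\<forall>v<n. iarr s' ''cov'' v \<noteq> 0 \<longleftrightarrow> cov hx opt v) \<and>
    (ireg s' ''bd'' \<noteq> 0 \<longleftrightarrow> (\<exists>i j v. i \<noteq> j \<and> chosen hx opt i \<and> chosen hx opt j \<and> inc i v \<and> inc j v)))"
proof -
  define covU where "covU k v \<longleftrightarrow> (\<exists>i<k. chosen hx opt i \<and> inc i v)" for k v
  \<comment> \<open>Of two chosen edges with a common end, the later one detects the clash, as it
    finds this end already covered.\<close>
  define badU where "badU k \<longleftrightarrow> (\<exists>i<k. chosen hx opt i \<and> (covU i (X i) \<or> covU i (Y i)))" for k
  have cs: "covU (Suc k) v \<longleftrightarrow> covU k v \<or> chosen hx opt k \<and> inc k v" for k v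
    by (auto simp: covU_def less_Suc_eq)
  have bs: "badU (Suc k) \<longleftrightarrow> badU k \<or> chosen hx opt k \<and> (covU k (X k) \<or> covU k (Y k))" for k
    by (auto simp: badU_def less_Suc_eq)
  have chm: "chosen hx opt j \<Longrightarrow> j < m" for j by (simp add: chosen_def)
  have covm: "covU m v \<longleftrightarrow> cov hx opt v" for v using chm by (auto simp: covU_def cov_def)
  have badm: "badU m \<longleftrightarrow> (\<exists>i j v. i \<noteq> j \<and> chosen hx opt i \<and> chosen hx opt j \<and> inc i v \<and> inc j v)"
  proof
    assume "badU m"
    then obtain i where i: "chosen hx opt i" "covU i (X i) \<or> covU i (Y i)" by (auto simp: badU_def)
    then obtain j v where "j < i" "chosen hx opt j" "inc j v" "inc i v" by (auto simp: covU_def inc_def)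
    then show "\<exists>i j v. i \<noteq> j \<and> chosen hx opt i \<and> chosen hx opt j \<and> inc i v \<and> inc j v"
      using i by (intro exI[of _ i] exI[of _ j] exI[of _ v]) auto
  next
    assume "\<exists>i j v. i \<noteq> j \<and> chosen hx opt i \<and> chosen hx opt j \<and> inc i v \<and> inc j v"
    then obtain i j v where ij: "i < j" "chosen hx opt i" "chosen hx opt j" "inc i v" "inc j v"
      by (metis linorder_neqE_nat)
    then have "covU j v" by (auto simp: covU_def)
    then have "covU j (X j) \<or> covU j (Y j)" using ij(5) by (auto simp: inc_def)
    then show "badU m" using ij chm by (auto simp: badU_def)
  qed
  let ?Inv = "\<lambda>k s'. env hx pv pe L opt s' \<and> (\<forall>j<m. iarr s' ''che'' j \<noteq> 0 \<longleftrightarrow> chosen hx opt j) \<and>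
    (\<forall>v<n. iarr s' ''cov'' v \<noteq> 0 \<longleftrightarrow> covU k v) \<and> (ireg s' ''bd'' \<noteq> 0 \<longleftrightarrow> badU k)"
  have "run cover_prog s (1 + (m * 14 + 2)) (?Inv m)" unfolding cover_prog_def
  proof (rule runP_Seq[where ?Q1.0 = "?Inv 0"], goal_cases)
    case 1
    show ?case
      by (rule run_wp_le) (use assms in \<open>auto simp: env_def base_def covU_def badU_def\<close>)
  next
    case (2 s1)
    note I = 2(2)
    show ?case
    proof (rule run_FOR_wp[where Inv = ?Inv], goal_cases)
      case (7 k s')
      have "X k < n" "Y k < n" using 7 X_less Y_less by auto
      then show ?case using 7 by (auto simp: env_def base_def cs bs inc_def)
    qed (use I in \<open>auto simp: env_def base_def\<close>)
  qed
  then show ?thesis by (rule runP_mono) (auto simp: covm badm)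
qed

lemma run_block_prog:
  assumes e: "env hx pv pe L opt s" and nb0: "\<forall>v<n. iarr s ''nb'' v = 0"
    and sel: "\<forall>v<n. iarr s ''sel'' v \<noteq> 0 \<longleftrightarrow> sel hx opt v"
  shows "run block_prog s (m * 12 + 3) (\<lambda>s'. env hx pv pe L opt s' \<and>
    (\<forall>v<n. iarr s' ''nb'' v \<noteq> 0 \<longleftrightarrow> (\<exists>u. adj u v \<and> sel hx opt u)) \<and>
    (ireg s' ''be'' \<noteq> 0 \<longleftrightarrow> (\<exists>j<m. sel hx opt (X j) \<and> sel hx opt (Y j))))"
proof -
  define nbU where "nbU k v \<longleftrightarrow> (\<exists>i<k. (sel hx opt (X i) \<and> Y i = v) \<or> (sel hx opt (Y i) \<and> X i = v))" for k v
  define badU where "badU k \<longleftrightarrow> (\<exists>i<k. sel hx opt (X i) \<and> sel hx opt (Y i))" for k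
  have ns: "nbU (Suc k) v \<longleftrightarrow> nbU k v \<or> (sel hx opt (X k) \<and> Y k = v) \<or> (sel hx opt (Y k) \<and> X k = v)" for k v
    by (auto simp: nbU_def less_Suc_eq)
  have bs: "badU (Suc k) \<longleftrightarrow> badU k \<or> sel hx opt (X k) \<and> sel hx opt (Y k)" for k
    by (auto simp: badU_def less_Suc_eq)
  have nbm: "nbU m v \<longleftrightarrow> (\<exists>u. adj u v \<and> sel hx opt u)" for v
    by (auto simp: nbU_def adj_def doubleton_eq_iff)
  let ?Inv = "\<lambda>k s'. env hx pv pe L opt s' \<and> (\<forall>v<n. iarr s' ''sel'' v \<noteq> 0 \<longleftrightarrow> sel hx opt v) \<and>
    (\<forall>v<n. iarr s' ''nb'' v \<noteq> 0 \<longleftrightarrow> nbU k v) \<and> (ireg s' ''be'' \<noteq> 0 \<longleftrightarrow> badU k)"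
  have "run block_prog s (1 + (m * 12 + 2)) (?Inv m)" unfolding block_prog_def
  proof (rule runP_Seq[where ?Q1.0 = "?Inv 0"], goal_cases)
    case 1
    show ?case
      by (rule run_wp_le) (use assms in \<open>auto simp: env_def base_def nbU_def badU_def\<close>)
  next
    case (2 s1)
    note I = 2(2)
    show ?case
    proof (rule run_FOR_wp[where Inv = ?Inv], goal_cases)
      case (7 k s')
      have "X k < n" "Y k < n" using 7 X_less Y_less by auto
      then show ?case using 7 by (auto simp: env_def base_def ns bs)
    qed (use I in \<open>auto simp: env_def base_def\<close>)
  qed
  then show ?thesis by (rule runP_mono) (auto simp: nbm badU_def)
qed


lemma run_clear_prog:
  assumes "env hx pv pe L opt s"
  shows "run clear_prog s (L * 3 + 3) (\<lambda>s'. env hx pv pe L opt s' \<and> (\<forall>p<L. rarr s' ''w'' p = 0))"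
proof -
  let ?Inv = "\<lambda>k s'. env hx pv pe L opt s' \<and> rreg s' ''y'' = 0 \<and> (\<forall>p<k. rarr s' ''w'' p = 0)"
  have "run clear_prog s (1 + (L * 3 + 2)) (?Inv L)" unfolding clear_prog_def
  proof (rule runP_Seq[where ?Q1.0 = "?Inv 0"], goal_cases)
    case 1
    show ?case
      by (rule run_wp_le) (use assms in \<open>auto simp: env_def base_def\<close>)
  next
    case (2 s1)
    note I = 2(2)
    show ?case
      by (rule run_FOR_wp[where Inv = ?Inv])
        (use I in \<open>auto simp: env_def base_def less_Suc_eq\<close>)
  qed
  then show ?thesis by (rule runP_mono) auto
qed

lemma layout_pos_inj:
  assumes "layout hx pv pe"
  shows "pv u \<noteq> 0 \<Longrightarrow> pv u = pv v \<longleftrightarrow> u = v" "pe i \<noteq> 0 \<Longrightarrow> pe i = pe j \<longleftrightarrow> i = j" "pe i \<noteq> 0 \<Longrightarrow> pe i \<noteq> pv v"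
proof -
  have inj: "\<And>x y. pos pv pe x \<noteq> 0 \<Longrightarrow> pos pv pe x = pos pv pe y \<Longrightarrow> x = y"
    using assms unfolding layout_def by blast
  show "pv u \<noteq> 0 \<Longrightarrow> pv u = pv v \<longleftrightarrow> u = v" using inj[of "Inl u" "Inl v"] by auto
  show "pe i \<noteq> 0 \<Longrightarrow> pe i = pe j \<longleftrightarrow> i = j" using inj[of "Inr i" "Inr j"] by auto
  show "pe i \<noteq> 0 \<Longrightarrow> pe i \<noteq> pv v" using inj[of "Inr i" "Inl v"] by auto
qed

definition weights_upto where
  "weights_upto hx opt pv pe L iv ie a \<longleftrightarrow>
     (\<forall>v<iv. pv v \<noteq> 0 \<longrightarrow> a (pv v) = (if avail hx opt (Inl v) then wv v else 0)) \<and>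
     (\<forall>j<ie. pe j \<noteq> 0 \<longrightarrow> a (pe j) = (if avail hx opt (Inr j) then we j else 0)) \<and>
     (\<forall>p<L. (\<forall>v<iv. pv v \<noteq> 0 \<longrightarrow> pv v \<noteq> p) \<and> (\<forall>j<ie. pe j \<noteq> 0 \<longrightarrow> pe j \<noteq> p) \<longrightarrow> a p = (0::real))"

lemma weights_upto_vertex:
  assumes lay: "complete_layout hx pv pe L" and w: "weights_upto hx opt pv pe L i 0 a"
  shows "pv i = 0 \<Longrightarrow> weights_upto hx opt pv pe L (Suc i) 0 a"
    "pv i \<noteq> 0 \<Longrightarrow> \<not> avail hx opt (Inl i) \<Longrightarrow> weights_upto hx opt pv pe L (Suc i) 0 a"
    "pv i \<noteq> 0 \<Longrightarrow> avail hx opt (Inl i) \<Longrightarrow> weights_upto hx opt pv pe L (Suc i) 0 (a(pv i := wv i))"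
proof -
  have L: "layout hx pv pe" and Lb: "\<And>x. pos pv pe x < L" using lay by (auto simp: complete_layout_def)
  note inj = layout_pos_inj(1)[OF L]
  show "pv i = 0 \<Longrightarrow> weights_upto hx opt pv pe L (Suc i) 0 a"
    using w by (auto simp: weights_upto_def less_Suc_eq)
  have z: "a (pv i) = 0" if i: "pv i \<noteq> 0"
  proof -
    have "pv v \<noteq> pv i" if "v < i" for v using inj[OF i, of v] that by auto
    then show ?thesis using w Lb[of "Inl i"] unfolding weights_upto_def by auto
  qed
  show "pv i \<noteq> 0 \<Longrightarrow> \<not> avail hx opt (Inl i) \<Longrightarrow> weights_upto hx opt pv pe L (Suc i) 0 a"
    using w z by (auto simp: weights_upto_def less_Suc_eq)
  show "weights_upto hx opt pv pe L (Suc i) 0 (a(pv i := wv i))" if i: "pv i \<noteq> 0" "avail hx opt (Inl i)"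
    unfolding weights_upto_def
  proof (intro conjI allI impI)
    fix v assume "v < Suc i" "pv v \<noteq> 0"
    then show "(a(pv i := wv i)) (pv v) = (if avail hx opt (Inl v) then wv v else 0)"
      using w i inj[of i v] unfolding weights_upto_def by (cases "v = i") auto
  next
    fix p assume p: "p < L" "(\<forall>v<Suc i. pv v \<noteq> 0 \<longrightarrow> pv v \<noteq> p) \<and> (\<forall>j<0. pe j \<noteq> 0 \<longrightarrow> pe j \<noteq> p)"
    then have "p \<noteq> pv i" using i by auto
    then show "(a(pv i := wv i)) p = 0" using p w unfolding weights_upto_def by auto
  qed auto
qed

lemma weights_upto_edge:
  assumes lay: "complete_layout hx pv pe L" and w: "weights_upto hx opt pv pe L n i a"
  shows "pe i = 0 \<Longrightarrow> weights_upto hx opt pv pe L n (Suc i) a"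
    "pe i \<noteq> 0 \<Longrightarrow> \<not> avail hx opt (Inr i) \<Longrightarrow> weights_upto hx opt pv pe L n (Suc i) a"
    "pe i \<noteq> 0 \<Longrightarrow> avail hx opt (Inr i) \<Longrightarrow> weights_upto hx opt pv pe L n (Suc i) (a(pe i := we i))"
proof -
  have L: "layout hx pv pe" and Lb: "\<And>x. pos pv pe x < L" using lay by (auto simp: complete_layout_def)
  note inj = layout_pos_inj(2,3)[OF L]
  show "pe i = 0 \<Longrightarrow> weights_upto hx opt pv pe L n (Suc i) a"
    using w by (auto simp: weights_upto_def less_Suc_eq)
  have z: "a (pe i) = 0" if i: "pe i \<noteq> 0"
  proof -
    have "\<forall>v<n. pv v \<noteq> 0 \<longrightarrow> pv v \<noteq> pe i" using inj(2)[OF i] by metis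
    moreover have "pe j \<noteq> pe i" if "j < i" for j using inj(1)[OF i, of j] that by auto
    ultimately show ?thesis using w Lb[of "Inr i"] unfolding weights_upto_def by auto
  qed
  show "pe i \<noteq> 0 \<Longrightarrow> \<not> avail hx opt (Inr i) \<Longrightarrow> weights_upto hx opt pv pe L n (Suc i) a"
    using w z by (auto simp: weights_upto_def less_Suc_eq)
  show "weights_upto hx opt pv pe L n (Suc i) (a(pe i := we i))" if i: "pe i \<noteq> 0" "avail hx opt (Inr i)"
    unfolding weights_upto_def
  proof (intro conjI allI impI)
    fix v assume "v < n" "pv v \<noteq> 0"
    then show "(a(pe i := we i)) (pv v) = (if avail hx opt (Inl v) then wv v else 0)"
      using w i inj(2)[of i v] unfolding weights_upto_def by auto
  next
    fix j assume "j < Suc i" "pe j \<noteq> 0"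
    then show "(a(pe i := we i)) (pe j) = (if avail hx opt (Inr j) then we j else 0)"
      using w i inj(1)[of i j] unfolding weights_upto_def by (cases "j = i") auto
  next
    fix p assume p: "p < L" "(\<forall>v<n. pv v \<noteq> 0 \<longrightarrow> pv v \<noteq> p) \<and> (\<forall>j<Suc i. pe j \<noteq> 0 \<longrightarrow> pe j \<noteq> p)"
    then have "p \<noteq> pe i" using i by auto
    then show "(a(pe i := we i)) p = 0" using p w unfolding weights_upto_def by auto
  qed
qed

lemma weights_upto_line_weights:
  assumes lay: "complete_layout hx pv pe L" and w: "weights_upto hx opt pv pe L n m a"
  shows "line_weights hx opt pv pe L (case_sum wv we) a"
  unfolding line_weights_def
proof (intro conjI allI impI)
  have L: "layout hx pv pe" using lay by (auto simp: complete_layout_def)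
  fix x assume x: "pos pv pe x \<noteq> 0"
  show "a (pos pv pe x) = (if avail hx opt x then case_sum wv we x else 0)"
    using placed_elems[OF L x] x w by (cases x) (auto simp: weights_upto_def)
next
  fix p assume p: "p < L" "a p \<noteq> 0"
  then have "\<not> ((\<forall>v<n. pv v \<noteq> 0 \<longrightarrow> pv v \<noteq> p) \<and> (\<forall>j<m. pe j \<noteq> 0 \<longrightarrow> pe j \<noteq> p))"
    using w unfolding weights_upto_def by blast
  then consider v where "pv v \<noteq> 0" "pv v = p" | j where "pe j \<noteq> 0" "pe j = p" by blast
  then have "\<exists>x. pos pv pe x = p \<and> p \<noteq> 0"
  proof cases
    case 1
    then show ?thesis by (intro exI[of _ "Inl v"]) simp
  next
    case 2
    then show ?thesis by (intro exI[of _ "Inr j"]) simp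
  qed
  then show "p \<noteq> 0" "\<exists>x. pos pv pe x = p" by auto
qed

lemma run_vweight_prog:
  assumes e: "env hx pv pe L opt s" and lay: "complete_layout hx pv pe L" and w0: "\<forall>p<L. rarr s ''w'' p = 0"
    and cov: "\<forall>v<n. iarr s ''cov'' v \<noteq> 0 \<longleftrightarrow> cov hx opt v"
    and nb: "\<forall>v<n. iarr s ''nb'' v \<noteq> 0 \<longleftrightarrow> (\<exists>u. adj u v \<and> sel hx opt u)"
  shows "run vweight_prog s (n * 10 + 2) (\<lambda>s'. env hx pv pe L opt s' \<and> weights_upto hx opt pv pe L n 0 (rarr s' ''w''))"
proof -
  let ?Inv = "\<lambda>k s'. env hx pv pe L opt s' \<and> (\<forall>v<n. iarr s' ''cov'' v \<noteq> 0 \<longleftrightarrow> cov hx opt v) \<and>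
    (\<forall>v<n. iarr s' ''nb'' v \<noteq> 0 \<longleftrightarrow> (\<exists>u. adj u v \<and> sel hx opt u)) \<and> weights_upto hx opt pv pe L k 0 (rarr s' ''w'')"
  have "run vweight_prog s (n * 10 + 2) (?Inv n)"
    unfolding vweight_prog_def
  proof (rule run_FOR_wp[where Inv = ?Inv], goal_cases)
    case (7 k s')
    have w: "weights_upto hx opt pv pe L k 0 (rarr s' ''w'')" and e: "env hx pv pe L opt s'" using 7(1) by blast+
    have av: "avail hx opt (Inl k) \<longleftrightarrow> iarr s' ''cov'' k = 0 \<and> iarr s' ''nb'' k = 0"
      using 7(1,2) by (auto simp: avail_def)
    note step = weights_upto_vertex[OF lay w]
    show ?case using 7(1,3) e step av by (simp add: env_def base_def)
  qed (use e cov nb w0 in \<open>auto simp: env_def base_def weights_upto_def\<close>)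
  then show ?thesis by (rule runP_mono) auto
qed

lemma run_eweight_prog:
  assumes e: "env hx pv pe L opt s" and lay: "complete_layout hx pv pe L"
    and w0: "weights_upto hx opt pv pe L n 0 (rarr s ''w'')"
    and cov: "\<forall>v<n. iarr s ''cov'' v \<noteq> 0 \<longleftrightarrow> cov hx opt v"
  shows "run eweight_prog s (m * 12 + 2) (\<lambda>s'. env hx pv pe L opt s' \<and>
    line_weights hx opt pv pe L (case_sum wv we) (rarr s' ''w''))"
proof -
  let ?Inv = "\<lambda>k s'. env hx pv pe L opt s' \<and> (\<forall>v<n. iarr s' ''cov'' v \<noteq> 0 \<longleftrightarrow> cov hx opt v) \<and>
    weights_upto hx opt pv pe L n k (rarr s' ''w'')"
  have "run eweight_prog s (m * 12 + 2) (?Inv m)"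
    unfolding eweight_prog_def
  proof (rule run_FOR_wp[where Inv = ?Inv], goal_cases)
    case (7 k s')
    have w: "weights_upto hx opt pv pe L n k (rarr s' ''w'')" and e: "env hx pv pe L opt s'" using 7(1) by blast+
    have "X k < n" "Y k < n" using 7 X_less Y_less by auto
    then have av: "avail hx opt (Inr k) \<longleftrightarrow> iarr s' ''cov'' (X k) = 0 \<and> iarr s' ''cov'' (Y k) = 0"
      using 7(1,2) by (auto simp: avail_def)
    note step = weights_upto_edge[OF lay w]
    show ?case using 7(1,3) e step av by (simp add: env_def base_def)
  qed (use e cov w0 in \<open>auto simp: env_def base_def\<close>)
  then show ?thesis by (rule runP_mono) (auto intro: weights_upto_line_weights lay)
qed

lemma run_dp_prog:
  assumes e: "env hx pv pe L opt s" and a: "rarr s ''w'' = a"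
  shows "run dp_prog s (L * 9 + 5) (\<lambda>s'. env hx pv pe L opt s' \<and>
    (\<forall>p<L. iarr s' ''tk'' p \<noteq> 0 \<longleftrightarrow> dp_val a p < a p + dp_val a (p - 2)))"
proof -
  let ?Inv = "\<lambda>k s'. env hx pv pe L opt s' \<and> rarr s' ''w'' = a \<and> rreg s' ''x1'' = dp_val a k \<and>
    rreg s' ''x2'' = dp_val a (k - 1) \<and> rreg s' ''x3'' = dp_val a (k - 2) \<and>
    (\<forall>p<k. iarr s' ''tk'' p \<noteq> 0 \<longleftrightarrow> dp_val a p < a p + dp_val a (p - 2))"
  have "run dp_prog s (3 + (L * 9 + 2)) (?Inv L)" unfolding dp_prog_def
  proof (rule runP_Seq[where ?Q1.0 = "?Inv 0"], goal_cases)
    case 1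
    show ?case
      by (rule run_wp_le) (use assms in \<open>auto simp: env_def base_def\<close>)
  next
    case (2 s1)
    note I = 2(2)
    show ?case
    proof (rule run_FOR_wp[where Inv = ?Inv], goal_cases)
      case (7 k s')
      have "Suc k - 2 = k - 1" by simp
      then show ?case using 7 by (auto simp: env_def base_def less_Suc_eq max_def)
    qed (use I in \<open>auto simp: env_def base_def\<close>)
  qed
  then show ?thesis by (rule runP_mono) auto
qed

lemma run_trace_prog:
  assumes e: "env hx pv pe L opt s"
    and tk: "\<forall>p<L. iarr s ''tk'' p \<noteq> 0 \<longleftrightarrow> dp_val a p < a p + dp_val a (p - 2)"
  shows "run trace_prog s (L * 8 + 4) (\<lambda>s'. env hx pv pe L opt s' \<and> (\<forall>q<L. iarr s' ''ch'' q \<noteq> 0 \<longleftrightarrow> q \<in> dp_set a L))"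
proof -
  \<comment> \<open>From \<open>L - k\<close> on, the decisions are stored in \<open>ch\<close>;
    below, the choice still to be made is \<open>dp_set a (L - k - sk)\<close>. The counter
    \<open>sk\<close> is thus a subtraction carried out one position at a time.\<close>
  let ?Inv = "\<lambda>k s'. env hx pv pe L opt s' \<and> (\<forall>p<L. iarr s' ''tk'' p \<noteq> 0 \<longleftrightarrow> dp_val a p < a p + dp_val a (p - 2)) \<and>
    ireg s' ''p'' = L - k \<and>
    (\<forall>q<L. (if q < L - k then q \<in> dp_set a (L - k - ireg s' ''sk'') else iarr s' ''ch'' q \<noteq> 0) \<longleftrightarrow> q \<in> dp_set a L)"
  have "run trace_prog s (2 + (L * 8 + 2)) (?Inv L)" unfolding trace_prog_def
  proof (rule runP_Seq[where ?Q1.0 = "?Inv 0"], goal_cases)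
    case 1
    show ?case
      by (rule run_wp_le) (use assms in \<open>auto simp: env_def base_def\<close>)
  next
    case (2 s1)
    note I = 2(2)
    show ?case
    proof (rule run_FOR_wp[where Inv = ?Inv], goal_cases)
      case (7 k s')
      define r where "r = L - Suc k"
      define sk where "sk = ireg s' ''sk''"
      have r: "L - k = Suc r" "r < L" using 7(2) by (auto simp: r_def)
      have e: "env hx pv pe L opt s'" "ireg s' ''p'' = Suc r" and tkr: "iarr s' ''tk'' r \<noteq> 0 \<longleftrightarrow> dp_val a r < a r + dp_val a (r - 2)"
        and old: "\<And>q. q < L \<Longrightarrow> (if q < Suc r then q \<in> dp_set a (Suc r - sk) else iarr s' ''ch'' q \<noteq> 0) \<longleftrightarrow> q \<in> dp_set a L"
        using 7(1) r unfolding sk_def by auto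
      have nr: "r \<notin> dp_set a (r - l)" for l using dp_set_bound[of r a "r - l"] by auto
      have bnd: "q < r" if "q \<in> dp_set a (r - l)" for q l using dp_set_bound[OF that] by linarith
      define new where "new ch' sk' \<longleftrightarrow> (\<forall>q<L. (if q < r then q \<in> dp_set a (r - sk') else ch' q \<noteq> 0) \<longleftrightarrow> q \<in> dp_set a L)"
        for ch' :: "nat \<Rightarrow> nat" and sk' :: nat
      have n1: "new ((iarr s' ''ch'')(r := 0)) 0" if "sk = 0" "iarr s' ''tk'' r = 0"
        unfolding new_def
      proof (intro allI impI)
        fix q assume "q < L"
        then show "(if q < r then q \<in> dp_set a (r - 0) else ((iarr s' ''ch'')(r := 0)) q \<noteq> 0) \<longleftrightarrow> q \<in> dp_set a L"
          using old[of q] that tkr nr[of 0] by (cases "q = r") auto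
      qed
      have n2: "new ((iarr s' ''ch'')(r := 1)) 2" if "sk = 0" "iarr s' ''tk'' r \<noteq> 0"
        unfolding new_def
      proof (intro allI impI)
        fix q assume "q < L"
        then show "(if q < r then q \<in> dp_set a (r - 2) else ((iarr s' ''ch'')(r := 1)) q \<noteq> 0) \<longleftrightarrow> q \<in> dp_set a L"
          using old[of q] that tkr nr[of 2] by (cases "q = r") auto
      qed
      have n3: "new ((iarr s' ''ch'')(r := 0)) (sk - 1)" if "sk \<noteq> 0"
        unfolding new_def
      proof (intro allI impI)
        fix q assume "q < L"
        \<comment> \<open>Passing over one position and decreasing \<open>sk\<close> cancel out, so
          the remaining set is the same.\<close>
        have "Suc r - sk = r - (sk - 1)" using that by simp
        note o = old[OF \<open>q < L\<close>, unfolded this]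
        show "(if q < r then q \<in> dp_set a (r - (sk - 1)) else ((iarr s' ''ch'')(r := 0)) q \<noteq> 0) \<longleftrightarrow> q \<in> dp_set a L"
          using o nr[of "sk - 1"] by (cases "q = r"; cases "q < r") simp_all
      qed
      have goal: "?Inv (Suc k) t = (env hx pv pe L opt t \<and> (\<forall>p<L. iarr t ''tk'' p \<noteq> 0 \<longleftrightarrow> dp_val a p < a p + dp_val a (p - 2)) \<and>
        ireg t ''p'' = r \<and> new (iarr t ''ch'') (ireg t ''sk''))" for t
        by (simp add: r_def new_def)
      have tk': "\<forall>p<L. iarr s' ''tk'' p \<noteq> 0 \<longleftrightarrow> dp_val a p < a p + dp_val a (p - 2)" using 7(1) by blast
      show ?case unfolding goal
      proof (rule wp_mono[where Q = "\<lambda>t. env hx pv pe L opt t \<and> iarr t ''tk'' = iarr s' ''tk'' \<and>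
        ireg t ''p'' = r \<and> new (iarr t ''ch'') (ireg t ''sk'')"], goal_cases)
        case 1
        show ?case using e n1 n2 n3 unfolding sk_def by (simp add: env_def base_def)
      next
        case (2 t)
        then show ?case using tk' by (simp add: env_reg)
      qed
    qed (use I in \<open>auto simp: env_def base_def\<close>)
  qed
  then show ?thesis by (rule runP_mono) auto
qed


lemma sum_Collect_less_Suc:
  fixes f :: "nat \<Rightarrow> real"
  shows "sum f {v. v < Suc k \<and> P v} = sum f {v. v < k \<and> P v} + (if P k then f k else 0)"
proof -
  have "{v. v < Suc k \<and> P v} = {v. v < k \<and> P v} \<union> (if P k then {k} else {})" by (auto simp: less_Suc_eq)
  then show ?thesis by (auto simp: add.commute)
qed

lemma run_cand_prog:
  assumes e: "env hx pv pe L opt s" and lay: "complete_layout hx pv pe L"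
    and sel: "\<forall>v<n. iarr s ''sel'' v \<noteq> 0 \<longleftrightarrow> sel hx opt v"
    and che: "\<forall>j<m. iarr s ''che'' j \<noteq> 0 \<longleftrightarrow> chosen hx opt j"
    and ch: "\<forall>q<L. iarr s ''ch'' q \<noteq> 0 \<longleftrightarrow> q \<in> Q"
    and T: "T = candidate hx opt pv pe Q"
  shows "run cand_prog s (n * 12 + m * 12 + 5) (\<lambda>s'. env hx pv pe L opt s' \<and>
    (\<forall>v<n. iarr s' ''cv'' v \<noteq> 0 \<longleftrightarrow> Inl v \<in> T) \<and> (\<forall>j<m. iarr s' ''ce'' j \<noteq> 0 \<longleftrightarrow> Inr j \<in> T) \<and>
    rreg s' ''val'' = sum (case_sum wv we) T)"
proof -
  have Lb: "pv v < L" "pe j < L" for v j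
    using lay unfolding complete_layout_def by (auto dest: spec[of _ "Inl v"] spec[of _ "Inr j"])
  have Tv: "Inl v \<in> T \<longleftrightarrow> sel hx opt v \<or> (pv v \<noteq> 0 \<and> pv v \<in> Q)" for v
    by (auto simp: T candidate_def decode_def)
  have Te: "Inr j \<in> T \<longleftrightarrow> chosen hx opt j \<or> (pe j \<noteq> 0 \<and> pe j \<in> Q)" for j
    by (auto simp: T candidate_def decode_def)
  have Tsub: "T \<subseteq> {..<n} <+> {..<m}"
    unfolding T candidate_def using decode_elems placed_elems[of hx pv pe] lay
    by (auto simp: complete_layout_def)
  define S1 where "S1 k = sum wv {v. v < k \<and> Inl v \<in> T}" for k
  define S2 where "S2 k = sum we {j. j < k \<and> Inr j \<in> T}" for k
  have S1: "S1 (Suc k) = S1 k + (if Inl k \<in> T then wv k else 0)" for k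
    unfolding S1_def by (rule sum_Collect_less_Suc)
  have S2: "S2 (Suc k) = S2 k + (if Inr k \<in> T then we k else 0)" for k
    unfolding S2_def by (rule sum_Collect_less_Suc)
  have tot: "S1 n + S2 m = sum (case_sum wv we) T"
  proof -
    have "T = {v. v < n \<and> Inl v \<in> T} <+> {j. j < m \<and> Inr j \<in> T}" (is "_ = ?A <+> ?B")
      using Tsub by (auto simp: Plus_def)
    then have "sum (case_sum wv we) T = sum (case_sum wv we) (?A <+> ?B)" by simp
    also have "\<dots> = S1 n + S2 m" by (subst sum.Plus) (auto simp: S1_def S2_def)
    finally show ?thesis by simp
  qed
  let ?Inv1 = "\<lambda>k s'. env hx pv pe L opt s' \<and> (\<forall>v<n. iarr s' ''sel'' v \<noteq> 0 \<longleftrightarrow> sel hx opt v) \<and>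
    (\<forall>j<m. iarr s' ''che'' j \<noteq> 0 \<longleftrightarrow> chosen hx opt j) \<and> (\<forall>q<L. iarr s' ''ch'' q \<noteq> 0 \<longleftrightarrow> q \<in> Q) \<and>
    (\<forall>v<k. iarr s' ''cv'' v \<noteq> 0 \<longleftrightarrow> Inl v \<in> T) \<and> rreg s' ''val'' = S1 k"
  let ?Inv2 = "\<lambda>k s'. env hx pv pe L opt s' \<and>
    (\<forall>j<m. iarr s' ''che'' j \<noteq> 0 \<longleftrightarrow> chosen hx opt j) \<and> (\<forall>q<L. iarr s' ''ch'' q \<noteq> 0 \<longleftrightarrow> q \<in> Q) \<and>
    (\<forall>v<n. iarr s' ''cv'' v \<noteq> 0 \<longleftrightarrow> Inl v \<in> T) \<and> (\<forall>j<k. iarr s' ''ce'' j \<noteq> 0 \<longleftrightarrow> Inr j \<in> T) \<and>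
    rreg s' ''val'' = S1 n + S2 k"
  have "run cand_prog s (1 + ((n * 12 + 2) + (m * 12 + 2))) (?Inv2 m)" unfolding cand_prog_def
  proof (rule runP_Seq[where ?Q1.0 = "?Inv1 0"], goal_cases)
    case 1
    show "run (Do (RZero ''val'')) s 1 (?Inv1 0)"
      by (rule run_wp_le) (use e sel che ch in \<open>auto simp: env_def base_def S1_def\<close>)
  next
    case (2 s1)
    show ?case
    proof (rule runP_Seq[where ?Q1.0 = "?Inv1 n"], goal_cases)
      case 1
      show "run (FOR ''i'' ''n'' (cand_body ''i'' ''sel'' ''pv'' ''cv'' ''wv'')) s1 (n * 12 + 2) (?Inv1 n)"
      proof (rule run_FOR_wp[where Inv = ?Inv1], goal_cases)
        case (7 k s')
        have e': "env hx pv pe L opt s'" using 7(1) by blast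
        have in_T: "Inl k \<in> T \<longleftrightarrow> iarr s' ''sel'' k \<noteq> 0 \<or> (pv k \<noteq> 0 \<and> iarr s' ''ch'' (pv k) \<noteq> 0)"
          using 7(1,2) Tv[of k] Lb(1)[of k] by auto
        show ?case
        proof (rule wp_mono[where Q = "\<lambda>t. env hx pv pe L opt t \<and> iarr t ''sel'' = iarr s' ''sel'' \<and>
           iarr t ''che'' = iarr s' ''che'' \<and> iarr t ''ch'' = iarr s' ''ch'' \<and>
           (\<exists>c. iarr t ''cv'' = (iarr s' ''cv'')(k := c) \<and> (c \<noteq> 0 \<longleftrightarrow> Inl k \<in> T)) \<and>
           rreg t ''val'' = rreg s' ''val'' + (if Inl k \<in> T then wv k else 0)"], goal_cases)
          case 1
          show ?case using e' 7(3) in_T by (auto simp: cand_body_def env_def base_def)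
        next
          case (2 t)
          then show ?case using 7(1) by (auto simp: env_reg S1 less_Suc_eq)
        qed
      qed (use 2 in \<open>auto simp: env_def base_def cand_body_def\<close>)
    next
      case (2 s2)
      show "run (FOR ''j'' ''m'' (cand_body ''j'' ''che'' ''pe'' ''ce'' ''we'')) s2 (m * 12 + 2) (?Inv2 m)"
      proof (rule run_FOR_wp[where Inv = ?Inv2], goal_cases)
        case (7 k s')
        have e': "env hx pv pe L opt s'" using 7(1) by blast
        have in_T: "Inr k \<in> T \<longleftrightarrow> iarr s' ''che'' k \<noteq> 0 \<or> (pe k \<noteq> 0 \<and> iarr s' ''ch'' (pe k) \<noteq> 0)"
          using 7(1,2) Te[of k] Lb(2)[of k] by auto
        show ?case
        proof (rule wp_mono[where Q = "\<lambda>t. env hx pv pe L opt t \<and> iarr t ''cv'' = iarr s' ''cv'' \<and>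
           iarr t ''che'' = iarr s' ''che'' \<and> iarr t ''ch'' = iarr s' ''ch'' \<and>
           (\<exists>c. iarr t ''ce'' = (iarr s' ''ce'')(k := c) \<and> (c \<noteq> 0 \<longleftrightarrow> Inr k \<in> T)) \<and>
           rreg t ''val'' = rreg s' ''val'' + (if Inr k \<in> T then we k else 0)"], goal_cases)
          case 1
          show ?case using e' 7(3) in_T by (auto simp: cand_body_def env_def base_def)
        next
          case (2 t)
          then show ?case using 7(1) by (auto simp: env_reg S2 less_Suc_eq)
        qed
      qed (use 2 in \<open>auto simp: env_def base_def cand_body_def S2_def\<close>)
    qed
  qed
  then show ?thesis by (rule runP_mono) (auto simp: tot)
qed

section \<open>Keeping the best candidate and assembling the phases\<close>

abbreviation W :: "elem \<Rightarrow> real" where "W \<equiv> case_sum wv we"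

definition out :: "store \<Rightarrow> elem set" where
  "out s = {v. v < n \<and> iarr s ''outv'' v \<noteq> 0} <+> {j. j < m \<and> iarr s ''oute'' j \<noteq> 0}"

text \<open>Initially true for the empty output of value 0, so the stored output is a total matching
  at every moment, even if no candidate improves on it.\<close>

definition best_ok :: "store \<Rightarrow> bool" where
  "best_ok s \<longleftrightarrow> tmatch (out s) \<and> rreg s ''best'' = sum W (out s)"

lemma run_update_prog:
  assumes e: "env hx pv pe L opt s" and T: "T \<subseteq> {..<n} <+> {..<m}"
    and cv: "\<forall>v<n. iarr s ''cv'' v \<noteq> 0 \<longleftrightarrow> Inl v \<in> T" and ce: "\<forall>j<m. iarr s ''ce'' j \<noteq> 0 \<longleftrightarrow> Inr j \<in> T"
    and val: "rreg s ''val'' = sum W T"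
    and bd: "ireg s ''bd'' = 0 \<Longrightarrow> ireg s ''be'' = 0 \<Longrightarrow> tmatch T" and ok: "best_ok s"
  shows "run update_prog s (n * 4 + m * 4 + 8) (\<lambda>s'. env hx pv pe L opt s' \<and> best_ok s' \<and>
    rreg s ''best'' \<le> rreg s' ''best'' \<and> (ireg s ''bd'' = 0 \<and> ireg s ''be'' = 0 \<longrightarrow> sum W T \<le> rreg s' ''best''))"
    (is "run _ _ _ ?Q")
proof -
  have z: "ireg s ''z'' = 0" using e by (simp add: env_def base_def)
  let ?c1 = "FOR ''i'' ''n'' (Do (ILoad ''t'' ''cv'' ''i'') ;; Do (IStore ''outv'' ''i'' ''t''))"
  let ?c2 = "FOR ''j'' ''m'' (Do (ILoad ''t'' ''ce'' ''j'') ;; Do (IStore ''oute'' ''j'' ''t''))"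
  let ?I1 = "\<lambda>k s'. env hx pv pe L opt s' \<and> rreg s' ''best'' = rreg s ''val'' \<and> iarr s' ''cv'' = iarr s ''cv'' \<and>
    iarr s' ''ce'' = iarr s ''ce'' \<and> (\<forall>v<k. iarr s' ''outv'' v = iarr s ''cv'' v)"
  let ?I2 = "\<lambda>k s'. env hx pv pe L opt s' \<and> rreg s' ''best'' = rreg s ''val'' \<and> iarr s' ''cv'' = iarr s ''cv'' \<and>
    iarr s' ''ce'' = iarr s ''ce'' \<and> (\<forall>v<n. iarr s' ''outv'' v = iarr s ''cv'' v) \<and> (\<forall>j<k. iarr s' ''oute'' j = iarr s ''ce'' j)"
  have copy: "run (Do (RMove ''best'' ''val'') ;; ?c1 ;; ?c2) s (1 + ((n * 4 + 2) + (m * 4 + 2))) (?I2 m)"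
  proof (rule runP_Seq[where ?Q1.0 = "?I1 0"], goal_cases)
    case 1
    show "run (Do (RMove ''best'' ''val'')) s 1 (?I1 0)"
      by (rule run_wp_le) (use e in \<open>auto simp: env_def base_def\<close>)
  next
    case (2 s1)
    show ?case
    proof (rule runP_Seq[where ?Q1.0 = "?I1 n"], goal_cases)
      case 1
      show "run ?c1 s1 (n * 4 + 2) (?I1 n)"
        by (rule run_FOR_wp[where Inv = ?I1]) (use 2 in \<open>auto simp: env_def base_def less_Suc_eq\<close>)
    next
      case (2 s2)
      show "run ?c2 s2 (m * 4 + 2) (?I2 m)"
        by (rule run_FOR_wp[where Inv = ?I2]) (use 2 in \<open>auto simp: env_def base_def less_Suc_eq\<close>)
    qed
  qed
  have skip: "run Skip s B ?Q" if "\<not> (ireg s ''bd'' = 0 \<and> ireg s ''be'' = 0) \<or> \<not> rreg s ''best'' < rreg s ''val''" "1 \<le> B" for B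
    using that e ok val by (intro run_wp_le) auto
  have "run update_prog s (1 + ((n * 4 + 2) + (m * 4 + 2)) + 1 + 1 + 1) ?Q"
    unfolding update_prog_def
  proof (intro runP_Cond)
    assume h: "holds (IEq ''bd'' ''z'') s" "holds (IEq ''be'' ''z'') s" "holds (RLess ''best'' ''val'') s"
    then have b: "ireg s ''bd'' = 0" "ireg s ''be'' = 0" "rreg s ''best'' < rreg s ''val''" using z by auto
    show "run (Do (RMove ''best'' ''val'') ;; ?c1 ;; ?c2) s (1 + ((n * 4 + 2) + (m * 4 + 2))) ?Q"
    proof (rule runP_mono[OF copy])
      fix s' assume I: "?I2 m s'"
      have "T = {v. v < n \<and> Inl v \<in> T} <+> {j. j < m \<and> Inr j \<in> T}" using T by (auto simp: Plus_def)
      moreover have "{v. v < n \<and> iarr s' ''outv'' v \<noteq> 0} = {v. v < n \<and> Inl v \<in> T}" using I cv by auto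
      moreover have "{j. j < m \<and> iarr s' ''oute'' j \<noteq> 0} = {j. j < m \<and> Inr j \<in> T}" using I ce by auto
      ultimately have "out s' = T" unfolding out_def by simp
      then show "?Q s'" using I b bd val by (auto simp: best_ok_def)
    qed simp
  qed ((rule skip, use z in simp, simp)+)
  then show ?thesis by (rule runP_mono) auto
qed

end

lemma wr_solve_parts:
  "wr select_prog = {VI ''i'', VI ''t'', VA ''sel'', VA ''cov'', VA ''nb''}"
  "wr choose_prog = {VI ''j'', VI ''u'', VI ''hu'', VI ''ou'', VI ''v'', VI ''hv'', VI ''ov'', VI ''ru'', VI ''rv'', VI ''c'', VA ''che''}"
  "wr cover_prog = {VI ''bd'', VI ''j'', VI ''c'', VI ''u'', VI ''v'', VI ''t'', VA ''cov''}"
  "wr block_prog = {VI ''be'', VI ''j'', VI ''u'', VI ''v'', VI ''su'', VI ''sv'', VA ''nb''}"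
  "wr clear_prog = {VR ''y'', VI ''p'', VF ''w''}"
  "wr vweight_prog = {VI ''i'', VI ''q'', VI ''t'', VR ''y'', VF ''w''}"
  "wr eweight_prog = {VI ''j'', VI ''q'', VI ''u'', VI ''t'', VI ''v'', VR ''y'', VF ''w''}"
  "wr dp_prog = {VR ''x1'', VR ''x2'', VR ''x3'', VI ''p'', VR ''y'', VA ''tk''}"
  "wr trace_prog = {VI ''p'', VI ''sk'', VI ''i'', VI ''t'', VA ''ch''}"
  "wr cand_prog = {VR ''val'', VI ''i'', VI ''j'', VI ''t'', VI ''q'', VI ''c'', VA ''cv'', VA ''ce'', VR ''y''}"
  "wr update_prog = {VR ''best'', VI ''i'', VI ''j'', VI ''t'', VA ''outv'', VA ''oute''}"
  by (auto simp: select_prog_def choose_prog_def cover_prog_def block_prog_def clear_prog_def vweight_prog_def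
      eweight_prog_def dp_prog_def trace_prog_def cand_prog_def cand_body_def update_prog_def)

context total_matching_prog
begin

text \<open>Total matchings are grouped by their part outside the line; a single option vector
  settles a whole group.\<close>

definition solved :: "(nat \<Rightarrow> nat) \<Rightarrow> (nat \<Rightarrow> nat) \<Rightarrow> (nat \<Rightarrow> nat) \<Rightarrow> (nat \<Rightarrow> nat) \<Rightarrow> real \<Rightarrow> bool" where
  "solved hx pv pe opt b \<longleftrightarrow> (\<forall>T. tmatch T \<longrightarrow> {x \<in> T. pos pv pe x = 0} = decode hx opt \<longrightarrow> sum W T \<le> b)"

text \<open>If some total matching decodes to the vector, both flags are 0 and the candidate
  dominates it. If there is none, \<open>solved\<close> holds vacuously, and the flags prevent an
  invalid candidate from being stored.\<close>

lemma run_solve_prog: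
  assumes e: "env hx pv pe L opt s" and lay: "complete_layout hx pv pe L" and o: "opt 0 = 0" and ok: "best_ok s"
  shows "run solve_prog s (n * 34 + m * 71 + L * 20 + 39) (\<lambda>s'. env hx pv pe L opt s' \<and> best_ok s' \<and>
    rreg s ''best'' \<le> rreg s' ''best'' \<and> solved hx pv pe opt (rreg s' ''best''))"
proof -
  define P0 where "P0 t \<longleftrightarrow> env hx pv pe L opt t \<and> iarr t ''outv'' = iarr s ''outv'' \<and> iarr t ''oute'' = iarr s ''oute'' \<and>
    rreg t ''best'' = rreg s ''best''" for t :: store
  define Ps where "Ps t \<longleftrightarrow> (\<forall>v<n. iarr t ''sel'' v \<noteq> 0 \<longleftrightarrow> sel hx opt v)" for t :: store
  define Pc where "Pc t \<longleftrightarrow> (\<forall>j<m. iarr t ''che'' j \<noteq> 0 \<longleftrightarrow> chosen hx opt j)" for t :: store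
  define Pcov where "Pcov t \<longleftrightarrow> (\<forall>v<n. iarr t ''cov'' v \<noteq> 0 \<longleftrightarrow> cov hx opt v)" for t :: store
  define Pbd where "Pbd t \<longleftrightarrow> (ireg t ''bd'' \<noteq> 0 \<longleftrightarrow> (\<exists>i j v. i \<noteq> j \<and> chosen hx opt i \<and> chosen hx opt j \<and> inc i v \<and> inc j v))" for t :: store
  define Pbe where "Pbe t \<longleftrightarrow> (ireg t ''be'' \<noteq> 0 \<longleftrightarrow> (\<exists>j<m. sel hx opt (X j) \<and> sel hx opt (Y j)))" for t :: store
  define Pnb where "Pnb t \<longleftrightarrow> (\<forall>v<n. iarr t ''nb'' v \<noteq> 0 \<longleftrightarrow> (\<exists>u. adj u v \<and> sel hx opt u))" for t :: store
  define Plw where "Plw a \<longleftrightarrow> line_weights hx opt pv pe L W a" for a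
  define Ptk where "Ptk a t \<longleftrightarrow> (\<forall>p<L. iarr t ''tk'' p \<noteq> 0 \<longleftrightarrow> dp_val a p < a p + dp_val a (p - 2))" for a and t :: store
  define Pch where "Pch a t \<longleftrightarrow> (\<forall>q<L. iarr t ''ch'' q \<noteq> 0 \<longleftrightarrow> q \<in> dp_set a L)" for a and t :: store
  define Pcand where "Pcand T t \<longleftrightarrow> (\<forall>v<n. iarr t ''cv'' v \<noteq> 0 \<longleftrightarrow> Inl v \<in> T) \<and>
    (\<forall>j<m. iarr t ''ce'' j \<noteq> 0 \<longleftrightarrow> Inr j \<in> T) \<and> rreg t ''val'' = sum W T" for T and t :: store
  define Pr where "Pr t \<longleftrightarrow> env hx pv pe L opt t \<and> best_ok t \<and> rreg s ''best'' \<le> rreg t ''best'' \<and>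
    solved hx pv pe opt (rreg t ''best'')" for t
  define Pk where "Pk t \<longleftrightarrow> P0 t \<and> Ps t \<and> Pc t \<and> Pcov t \<and> Pbd t \<and> Pnb t \<and> Pbe t" for t
  note defs = Pk_def P0_def Ps_def Pc_def Pcov_def Pbd_def Pbe_def Pnb_def Ptk_def Pch_def
  have s1: "run select_prog t (n * 8 + 2) (\<lambda>t. P0 t \<and> Ps t \<and> (\<forall>v<n. iarr t ''cov'' v = 0) \<and> (\<forall>v<n. iarr t ''nb'' v = 0))" if t: "P0 t" for t
  proof (rule runP_mono[OF run_select_prog[of hx pv pe L opt]], goal_cases)
    case (3 t')
    note E = agreeD[OF 3(1), unfolded wr_solve_parts]
    show ?case using t 3(2) by (simp add: defs E)
  qed (use t in \<open>simp_all add: defs\<close>)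
  have s2: "run choose_prog t (m * 17 + 2) (\<lambda>t. P0 t \<and> Ps t \<and> (\<forall>v<n. iarr t ''cov'' v = 0) \<and> (\<forall>v<n. iarr t ''nb'' v = 0) \<and> Pc t)" if t: "P0 t \<and> Ps t \<and> (\<forall>v<n. iarr t ''cov'' v = 0) \<and> (\<forall>v<n. iarr t ''nb'' v = 0)" for t
  proof (rule runP_mono[OF run_choose_prog[of hx pv pe L opt]], goal_cases)
    case (3 t')
    note E = agreeD[OF 3(1), unfolded wr_solve_parts]
    show ?case using t 3(2) by (simp add: defs E)
  qed (use t in \<open>simp_all add: defs\<close>)
  have s3: "run cover_prog t (m * 14 + 3) (\<lambda>t. P0 t \<and> Ps t \<and> Pc t \<and> (\<forall>v<n. iarr t ''nb'' v = 0) \<and> Pcov t \<and> Pbd t)" if t: "P0 t \<and> Ps t \<and> (\<forall>v<n. iarr t ''cov'' v = 0) \<and> (\<forall>v<n. iarr t ''nb'' v = 0) \<and> Pc t" for t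
  proof (rule runP_mono[OF run_cover_prog[of hx pv pe L opt]], goal_cases)
    case (5 t')
    note E = agreeD[OF 5(1), unfolded wr_solve_parts]
    show ?case using t 5(2) by (simp add: defs E)
  qed (use t in \<open>simp_all add: defs\<close>)
  have s4: "run block_prog t (m * 12 + 3) (\<lambda>t. Pk t)" if t: "P0 t \<and> Ps t \<and> Pc t \<and> (\<forall>v<n. iarr t ''nb'' v = 0) \<and> Pcov t \<and> Pbd t" for t
  proof (rule runP_mono[OF run_block_prog[of hx pv pe L opt]], goal_cases)
    case (5 t')
    note E = agreeD[OF 5(1), unfolded wr_solve_parts]
    show ?case using t 5(2) by (simp add: defs E)
  qed (use t in \<open>simp_all add: defs\<close>)
  have s5: "run clear_prog t (L * 3 + 3) (\<lambda>t. Pk t \<and> (\<forall>p<L. rarr t ''w'' p = 0))" if t: "Pk t" for t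
  proof (rule runP_mono[OF run_clear_prog[of hx pv pe L opt]], goal_cases)
    case (3 t')
    note E = agreeD[OF 3(1), unfolded wr_solve_parts]
    show ?case using t 3(2) by (simp add: defs E)
  qed (use t in \<open>simp_all add: defs\<close>)
  have s6: "run vweight_prog t (n * 10 + 2) (\<lambda>t. Pk t \<and> weights_upto hx opt pv pe L n 0 (rarr t ''w''))" if t: "Pk t \<and> (\<forall>p<L. rarr t ''w'' p = 0)" for t
  proof (rule runP_mono[OF run_vweight_prog[of hx pv pe L opt, OF _ lay]], goal_cases)
    case (6 t')
    note E = agreeD[OF 6(1), unfolded wr_solve_parts]
    show ?case using t 6(2) by (simp add: defs E)
  qed (use t in \<open>simp_all add: defs\<close>)
  have s7: "run eweight_prog t (m * 12 + 2) (\<lambda>t. Pk t \<and> Plw (rarr t ''w''))" if t: "Pk t \<and> weights_upto hx opt pv pe L n 0 (rarr t ''w'')" for t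
  proof (rule runP_mono[OF run_eweight_prog[of hx pv pe L opt, OF _ lay]], goal_cases)
    case (5 t')
    note E = agreeD[OF 5(1), unfolded wr_solve_parts]
    show ?case using t 5(2) by (simp add: defs E Plw_def)
  qed (use t in \<open>simp_all add: defs\<close>)
  have s8: "run dp_prog t (L * 9 + 5) (\<lambda>t. Pk t \<and> Plw (rarr t ''w'') \<and> Ptk (rarr t ''w'') t)" if t: "Pk t \<and> Plw (rarr t ''w'')" for t
  proof (rule runP_mono[OF run_dp_prog[of hx pv pe L opt, OF _ refl]], goal_cases)
    case (3 t')
    note E = agreeD[OF 3(1), unfolded wr_solve_parts]
    show ?case using t 3(2) by (simp add: defs E)
  qed (use t in \<open>simp_all add: defs\<close>)
  have s9: "run trace_prog t (L * 8 + 4) (\<lambda>t. Pk t \<and> Plw (rarr t ''w'') \<and> Pch (rarr t ''w'') t)" if t: "Pk t \<and> Plw (rarr t ''w'') \<and> Ptk (rarr t ''w'') t" for t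
  proof (rule runP_mono[OF run_trace_prog[of hx pv pe L opt, where a = "rarr t ''w''"]], goal_cases)
    case (4 t')
    note E = agreeD[OF 4(1), unfolded wr_solve_parts]
    show ?case using t 4(2) by (simp add: defs E)
  qed (use t in \<open>simp_all add: defs\<close>)
  have s10: "run cand_prog t (n * 12 + m * 12 + 5) (\<lambda>t. P0 t \<and> Pbd t \<and> Pbe t \<and> (\<exists>a. Plw a \<and> Pcand (candidate hx opt pv pe (dp_set a L)) t))" if t: "Pk t \<and> Plw (rarr t ''w'') \<and> Pch (rarr t ''w'') t" for t
  proof (rule runP_mono[OF run_cand_prog[of hx pv pe L opt _ "dp_set (rarr t ''w'') L", OF _ lay _ _ _ refl]], goal_cases)
    case (6 t')
    note E = agreeD[OF 6(1), unfolded wr_solve_parts]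
    have "Plw (rarr t ''w'') \<and> Pcand (candidate hx opt pv pe (dp_set (rarr t ''w'') L)) t'"
      using t 6(2) by (simp add: Pcand_def)
    moreover have "P0 t' \<and> Pbd t' \<and> Pbe t'" using t 6(2) by (simp add: defs E)
    ultimately show ?case by blast
  qed (use t in \<open>simp_all add: defs\<close>)
  have s11: "run update_prog t (n * 4 + m * 4 + 8) Pr" if t: "P0 t \<and> Pbd t \<and> Pbe t \<and> (\<exists>a. Plw a \<and> Pcand (candidate hx opt pv pe (dp_set a L)) t)" for t
  proof -
    obtain a where a: "line_weights hx opt pv pe L W a" "Pcand (candidate hx opt pv pe (dp_set a L)) t"
      using t by (auto simp: Plw_def)
    define T where "T = candidate hx opt pv pe (dp_set a L)"
    have Tsub: "T \<subseteq> {..<n} <+> {..<m}"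
      unfolding T_def candidate_def using decode_elems placed_elems[of hx pv pe] lay
      by (auto simp: complete_layout_def)
    have bad: "bad hx opt \<longleftrightarrow> \<not> (ireg t ''bd'' = 0 \<and> ireg t ''be'' = 0)"
      using t by (auto simp: Pbd_def Pbe_def bad_def)
    have ok': "best_ok t" "rreg t ''best'' = rreg s ''best''" "env hx pv pe L opt t"
      using t ok by (auto simp: P0_def best_ok_def out_def)
    show ?thesis
    proof (rule runP_mono[OF run_update_prog[OF ok'(3) Tsub]], goal_cases)
      case (7 t')
      have "solved hx pv pe opt (rreg t' ''best'')" unfolding solved_def
      proof (intro allI impI)
        fix U assume U: "tmatch U" "{x \<in> U. pos pv pe x = 0} = decode hx opt"
        note opt = candidate_optimal[where opt = opt, OF lay o a(1) U]
        then have "ireg t ''bd'' = 0 \<and> ireg t ''be'' = 0" using bad by blast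
        then show "sum W U \<le> rreg t' ''best''" using 7(2) opt(2) unfolding T_def by linarith
      qed
      then show ?case using 7(2) ok' by (simp add: Pr_def)
    next
      case 4
      then show ?case using candidate_tmatch[where opt = opt, OF lay o _ a(1)] bad unfolding T_def by blast
    qed (use a(2) ok' in \<open>auto simp: Pcand_def T_def\<close>)
  qed
  have "P0 s" using e by (simp add: P0_def)
  then have "run solve_prog s ((n * 8 + 2) + ((m * 17 + 2) + ((m * 14 + 3) + ((m * 12 + 3) + ((L * 3 + 3) + ((n * 10 + 2) +
    ((m * 12 + 2) + ((L * 9 + 5) + ((L * 8 + 4) + ((n * 12 + m * 12 + 5) + (n * 4 + m * 4 + 8)))))))))))
    Pr"
    unfolding solve_prog_def
    apply -
    apply (rule runP_Seq[OF s1], assumption)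
    apply (rule runP_Seq[OF s2], assumption)
    apply (rule runP_Seq[OF s3], assumption)
    apply (rule runP_Seq[OF s4], assumption)
    apply (rule runP_Seq[OF s5], assumption)
    apply (rule runP_Seq[OF s6], assumption)
    apply (rule runP_Seq[OF s7], assumption)
    apply (rule runP_Seq[OF s8], assumption)
    apply (rule runP_Seq[OF s9], assumption)
    apply (rule runP_Seq[OF s10], assumption)
    apply (rule s11, assumption)
    done
  then show ?thesis by (rule runP_mono) (auto simp: Pr_def)
qed

end

section \<open>Enumerating the option vectors\<close>

lemma run_While_False: "\<not> holds b s \<Longrightarrow> Q s \<Longrightarrow> run (While b p) s 1 Q"
  unfolding runP_def by (intro exI[of _ 1] exI[of _ s]) (auto intro: exec.WhileFalse[simplified])

lemma run_While_True:
  assumes "holds b s" "run p s B1 Q1" "\<And>s'. agree (wr p) s s' \<Longrightarrow> Q1 s' \<Longrightarrow> run (While b p) s' B2 Q"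
  shows "run (While b p) s (B1 + B2 + 1) Q"
proof -
  obtain t s' where 1: "exec p s t s'" "t \<le> B1" "Q1 s'" using assms(2) unfolding runP_def by auto
  then obtain t' s'' where 2: "exec (While b p) s' t' s''" "t' \<le> B2" "Q s''"
    using assms(3)[OF exec_agree[OF 1(1)] 1(3)] unfolding runP_def by auto
  show ?thesis unfolding runP_def
    by (intro exI[of _ "t + t' + 1"] exI[of _ s''] conjI exec.WhileTrue[OF assms(1) 1(1) 2(1)]) (use 1 2 in auto)
qed

text \<open>All levels share the register \<open>e\<close>; it is reloaded from \<open>opt\<close> after the inner levels have overwritten it.\<close>

fun enum_prog :: "nat \<Rightarrow> prog" where
  "enum_prog 0 = solve_prog"
| "enum_prog (Suc r) =
     (Do (IConst ''ix'' (Suc r)) ;; Do (IConst ''e'' 0) ;; Do (IStore ''opt'' ''ix'' ''e'')) ;;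
     While (ILess ''e'' ''D'')
       (enum_prog r ;; Do (IConst ''ix'' (Suc r)) ;; Do (ILoad ''e'' ''opt'' ''ix'') ;; Do (ISucc ''e'') ;;
        Do (IStore ''opt'' ''ix'' ''e''))"

fun enum_cost :: "nat \<Rightarrow> nat \<Rightarrow> nat \<Rightarrow> nat" where
  "enum_cost D B 0 = B"
| "enum_cost D B (Suc r) = 3 + (D * (enum_cost D B r + 5) + 1)"

text \<open>For inner cost \<open>c \<ge> 1\<close>, the overhead \<open>4 + 5 * D\<close> of a loop
  level is at most \<open>(4 + 5 * D) * c\<close>; added to \<open>D * c\<close> it produces the
  base \<open>6 * D + 4\<close>.\<close>

lemma enum_cost_le:
  assumes "1 \<le> B"
  shows "1 \<le> enum_cost D B r \<and> enum_cost D B r \<le> (6 * D + 4) ^ r * B"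
proof (induction r)
  case (Suc r)
  let ?c = "enum_cost D B r"
  have c: "1 \<le> ?c" using Suc by simp
  have "3 + (D * (?c + 5) + 1) = 4 * 1 + D * ?c + D * 5" by (simp add: algebra_simps)
  also have "\<dots> \<le> 4 * ?c + D * ?c + D * (5 * ?c)" using c by (intro add_mono mult_le_mono2) auto
  also have "\<dots> = (6 * D + 4) * ?c" by (simp add: algebra_simps)
  also have "\<dots> \<le> (6 * D + 4) * ((6 * D + 4) ^ r * B)" using Suc by (intro mult_le_mono2) auto
  finally show ?case by (simp add: mult.assoc)
qed (use assms in auto)

lemma wr_solve_prog: "VI ''D'' \<notin> wr solve_prog"
  by (simp add: solve_prog_def wr_solve_parts)

text \<open>Ranks are below the degree, hence at most \<open>d\<close>, so every option is at most
  \<open>d + 2\<close> and \<open>D = d + 3\<close> values suffice. The nest has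
  \<open>3 * d\<close> loops whatever the number of deleted vertices; surplus labels belong to no
  vertex.\<close>

definition main_prog :: "nat \<Rightarrow> prog" where
  "main_prog d = (Do (IConst ''o'' 1) ;; Do (IConst ''L'' 3) ;; Do (IConst ''D'' (d + 3))) ;;
     degree_prog ;; label_prog ;; paths_prog ;; cycles_prog ;; enum_prog (3 * d)"

lemma wr_setup_parts:
  "wr degree_prog = {VI ''j'', VI ''u'', VI ''t'', VI ''c'', VA ''d'', VA ''r1'', VA ''r2'', VA ''A'', VA ''B''}"
  "wr label_prog = {VI ''c'', VI ''i'', VI ''t'', VI ''k'', VA ''hx''}"
  "wr paths_prog = {VI ''i'', VI ''c'', VI ''a'', VI ''u'', VI ''t'', VI ''nx'', VI ''ne'', VI ''cur'', VI ''L'', VA ''pv'', VA ''pe''}"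
  "wr cycles_prog = {VI ''i'', VI ''k'', VA ''hx'', VI ''c'', VI ''a'', VI ''u'', VI ''t'', VI ''nx'', VI ''ne'', VI ''cur'', VI ''L'', VA ''pv'', VA ''pe''}"
  by (auto simp: degree_prog_def degree_half_def label_prog_def paths_prog_def cycles_prog_def scan_prog_def
      wr_find_prog wr_walk_prog)

lemma cost_find_prog: "cost find_prog \<le> 30"
  by (simp add: find_prog_def try_prog_def)

context total_matching_prog
begin

lemma solved_mono: "solved hx pv pe opt b \<Longrightarrow> b \<le> b' \<Longrightarrow> solved hx pv pe opt b'"
  unfolding solved_def by (meson order_trans)

definition enum_ok :: "(nat \<Rightarrow> nat) \<Rightarrow> (nat \<Rightarrow> nat) \<Rightarrow> (nat \<Rightarrow> nat) \<Rightarrow> nat \<Rightarrow> nat \<Rightarrow> store \<Rightarrow> bool" where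
  "enum_ok hx pv pe L D s \<longleftrightarrow> env hx pv pe L (iarr s ''opt'') s \<and> iarr s ''opt'' 0 = 0 \<and> best_ok s \<and> ireg s ''D'' = D"

text \<open>Relative to the entries outside 1 to \<open>r\<close>, which are restored, all vectors
  are settled. Stating it this way makes the levels compose.\<close>

definition enum_post :: "(nat \<Rightarrow> nat) \<Rightarrow> (nat \<Rightarrow> nat) \<Rightarrow> (nat \<Rightarrow> nat) \<Rightarrow> nat \<Rightarrow> nat \<Rightarrow> nat \<Rightarrow> store \<Rightarrow> store \<Rightarrow> bool" where
  "enum_post hx pv pe L D r s s' \<longleftrightarrow> enum_ok hx pv pe L D s' \<and> rreg s ''best'' \<le> rreg s' ''best'' \<and>
    (\<forall>i. i = 0 \<or> r < i \<longrightarrow> iarr s' ''opt'' i = iarr s ''opt'' i) \<and>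
    (\<forall>opt. (\<forall>i. 1 \<le> i \<and> i \<le> r \<longrightarrow> opt i < D) \<and> (\<forall>i. i = 0 \<or> r < i \<longrightarrow> opt i = iarr s ''opt'' i) \<longrightarrow>
      solved hx pv pe opt (rreg s' ''best''))"

lemma run_enum_prog:
  assumes lay: "complete_layout hx pv pe L" and B: "B = n * 34 + m * 71 + L * 20 + 39"
    and ok: "enum_ok hx pv pe L D s"
  shows "run (enum_prog r) s (enum_cost D B r) (enum_post hx pv pe L D r s)"
  using ok
proof (induction r arbitrary: s)
  case 0
  have e: "env hx pv pe L (iarr s ''opt'') s" "iarr s ''opt'' 0 = 0" "best_ok s" "ireg s ''D'' = D"
    using 0 by (auto simp: enum_ok_def)
  show ?case unfolding enum_prog.simps enum_cost.simps B
  proof (rule runP_mono[OF run_solve_prog[where opt = "iarr s ''opt''", OF e(1) lay e(2,3)]], goal_cases)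
    case (2 s')
    have o: "iarr s' ''opt'' = iarr s ''opt''" using 2(2) by (simp add: env_def)
    have D: "ireg s' ''D'' = D" using agreeD(1)[OF 2(1) wr_solve_prog] e by simp
    have "opt = iarr s ''opt''" if "\<forall>i. i = 0 \<or> 0 < i \<longrightarrow> opt i = iarr s ''opt'' i" for opt
      using that by (auto simp: fun_eq_iff)
    then show ?case using 2(2) o D e by (auto simp: enum_post_def enum_ok_def)
  qed simp
next
  case (Suc r)
  let ?c = "enum_cost D B r"
  let ?inc = "Do (IConst ''ix'' (Suc r)) ;; Do (ILoad ''e'' ''opt'' ''ix'') ;; Do (ISucc ''e'') ;; Do (IStore ''opt'' ''ix'' ''e'')"
  \<comment> \<open>What the loop at level \<open>Suc r\<close> achieves from the moment its counter
    is \<open>e\<close>: the vectors whose entry there is at least \<open>e\<close> are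
    settled.\<close>
  define Lp where "Lp e s1 s' \<longleftrightarrow> enum_ok hx pv pe L D s' \<and> rreg s1 ''best'' \<le> rreg s' ''best'' \<and>
      (\<forall>i. i = 0 \<or> Suc r < i \<longrightarrow> iarr s' ''opt'' i = iarr s1 ''opt'' i) \<and>
      (\<forall>opt. (\<forall>i. 1 \<le> i \<and> i \<le> r \<longrightarrow> opt i < D) \<and> e \<le> opt (Suc r) \<and> opt (Suc r) < D \<and>
        (\<forall>i. i = 0 \<or> Suc r < i \<longrightarrow> opt i = iarr s1 ''opt'' i) \<longrightarrow> solved hx pv pe opt (rreg s' ''best''))"
    for e and s1 s' :: store
  have loop: "run (While (ILess ''e'' ''D'') (enum_prog r ;; ?inc)) s1 ((D - e) * (?c + 5) + 1) (Lp e s1)"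
    if "enum_ok hx pv pe L D s1" "ireg s1 ''e'' = e" "iarr s1 ''opt'' (Suc r) = e" "e \<le> D" for e s1
    using that
  proof (induction "D - e" arbitrary: e s1)
    case 0
    then have "e = D" by simp
    have "ireg s1 ''D'' = D" using 0 by (simp add: enum_ok_def)
    then have "run (While (ILess ''e'' ''D'') (enum_prog r ;; ?inc)) s1 1 (\<lambda>s'. s' = s1)"
      by (intro run_While_False) (use 0 \<open>e = D\<close> in simp_all)
    then show ?case by (rule runP_mono) (use 0 \<open>e = D\<close> in \<open>auto simp: Lp_def\<close>)
  next
    case (Suc d)
    have eD: "e < D" using Suc(2) by simp
    have "ireg s1 ''D'' = D" using Suc.prems by (simp add: enum_ok_def)
    then have h: "holds (ILess ''e'' ''D'') s1" using eD Suc.prems by simp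
    define R' where "R' s3 \<longleftrightarrow> enum_ok hx pv pe L D s3 \<and> rreg s1 ''best'' \<le> rreg s3 ''best'' \<and>
      (\<forall>i. i = 0 \<or> Suc r < i \<longrightarrow> iarr s3 ''opt'' i = iarr s1 ''opt'' i) \<and> iarr s3 ''opt'' (Suc r) = Suc e \<and> ireg s3 ''e'' = Suc e \<and>
      (\<forall>opt. (\<forall>i. 1 \<le> i \<and> i \<le> r \<longrightarrow> opt i < D) \<and> (\<forall>i. i = 0 \<or> r < i \<longrightarrow> opt i = iarr s1 ''opt'' i) \<longrightarrow>
        solved hx pv pe opt (rreg s3 ''best''))" for s3
    have body: "run (enum_prog r ;; ?inc) s1 (?c + 4) R'"
    proof (rule runP_Seq)
      show "run (enum_prog r) s1 ?c (enum_post hx pv pe L D r s1)" by (rule Suc.IH[OF Suc.prems(1)])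
    next
      fix s2 assume R: "enum_post hx pv pe L D r s1 s2"
      have e2: "iarr s2 ''opt'' (Suc r) = e" using R Suc.prems by (simp add: enum_post_def)
      show "run ?inc s2 4 R'"
        by (rule run_wp_le) (use R e2 in \<open>auto simp: enum_post_def R'_def enum_ok_def env_def base_def best_ok_def out_def\<close>)
    qed
    have eq: "(?c + 4) + ((D - Suc e) * (?c + 5) + 1) + 1 = (D - e) * (?c + 5) + 1"
    proof -
      have "D - e = Suc (D - Suc e)" using eD by simp
      then show ?thesis by simp
    qed
    have "run (While (ILess ''e'' ''D'') (enum_prog r ;; ?inc)) s1 ((?c + 4) + ((D - Suc e) * (?c + 5) + 1) + 1) (Lp e s1)"
    proof (rule run_While_True[OF h body])
      fix s3 assume R3: "R' s3"
      have "run (While (ILess ''e'' ''D'') (enum_prog r ;; ?inc)) s3 ((D - Suc e) * (?c + 5) + 1) (Lp (Suc e) s3)"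
        using R3 Suc(2) eD by (intro Suc(1)) (auto simp: R'_def)
      then show "run (While (ILess ''e'' ''D'') (enum_prog r ;; ?inc)) s3 ((D - Suc e) * (?c + 5) + 1) (Lp e s1)"
      proof (rule runP_mono, goal_cases)
        case (2 s')
        note lp = 2(2)[unfolded Lp_def]
        have "solved hx pv pe opt (rreg s' ''best'')"
          if o: "\<forall>i. 1 \<le> i \<and> i \<le> r \<longrightarrow> opt i < D" "e \<le> opt (Suc r)" "opt (Suc r) < D"
            "\<forall>i. i = 0 \<or> Suc r < i \<longrightarrow> opt i = iarr s1 ''opt'' i" for opt
        \<comment> \<open>The value \<open>e\<close> was handled by the inner levels just executed,
          the larger ones by the remaining rounds. Settled vectors stay settled because
          \<open>best\<close> never decreases.\<close>
        proof (cases "opt (Suc r) = e")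
          case True
          have "opt i = iarr s1 ''opt'' i" if "i = 0 \<or> r < i" for i
            using that o(4) True Suc.prems(3) by (cases "i = Suc r") auto
          then have "solved hx pv pe opt (rreg s3 ''best'')" using R3 o(1) unfolding R'_def by blast
          then show ?thesis using lp solved_mono by blast
        next
          case False
          have "\<forall>i. i = 0 \<or> Suc r < i \<longrightarrow> opt i = iarr s3 ''opt'' i" using o(4) R3 by (simp add: R'_def)
          moreover have "Suc e \<le> opt (Suc r)" using o(2) False by simp
          ultimately show ?thesis using lp o(1,3) by blast
        qed
        moreover have "rreg s1 ''best'' \<le> rreg s' ''best''"
        proof (rule order_trans)
          show "rreg s1 ''best'' \<le> rreg s3 ''best''" using R3 by (simp add: R'_def)
          show "rreg s3 ''best'' \<le> rreg s' ''best''" using lp by blast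
        qed
        moreover have "\<forall>i. i = 0 \<or> Suc r < i \<longrightarrow> iarr s' ''opt'' i = iarr s1 ''opt'' i"
          using lp R3 by (simp add: R'_def)
        ultimately show ?case using lp unfolding Lp_def by blast
      qed simp
    qed
    then show ?case unfolding eq .
  qed
  have "run (enum_prog (Suc r)) s (3 + ((D - 0) * (?c + 5) + 1)) (enum_post hx pv pe L D (Suc r) s)"
    unfolding enum_prog.simps
  proof (rule runP_Seq)
    define I where "I s1 \<longleftrightarrow> enum_ok hx pv pe L D s1 \<and> ireg s1 ''e'' = 0 \<and> rreg s1 ''best'' = rreg s ''best'' \<and>
      iarr s1 ''opt'' = (iarr s ''opt'')(Suc r := 0)" for s1
    show "run (Do (IConst ''ix'' (Suc r)) ;; Do (IConst ''e'' 0) ;; Do (IStore ''opt'' ''ix'' ''e'')) s 3 I"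
      by (rule run_wp_le) (use Suc.prems in \<open>auto simp: I_def enum_ok_def env_def base_def best_ok_def out_def\<close>)
    fix s1 assume I: "I s1"
    have l: "enum_ok hx pv pe L D s1" "ireg s1 ''e'' = 0" "iarr s1 ''opt'' (Suc r) = 0" using I by (auto simp: I_def)
    show "run (While (ILess ''e'' ''D'') (enum_prog r ;; ?inc)) s1 ((D - 0) * (?c + 5) + 1)
      (enum_post hx pv pe L D (Suc r) s)"
      by (rule runP_mono[OF loop[OF l]]) (use I in \<open>auto simp: I_def Lp_def enum_post_def\<close>)
  qed
  then show ?case by simp
qed

lemma closed_layout_empty:
  assumes "\<forall>v. pv v = 0" "\<forall>j. pe j = 0"
  shows "closed_layout hx pv pe 3"
proof -
  have "pos pv pe x = 0" for x using assms by (cases x) auto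
  then show ?thesis using assms by (simp add: closed_layout_def layout_def)
qed

lemma run_main_prog:
  assumes s: "ireg s = (\<lambda>_. 0)(''n'' := n, ''m'' := m)" "iarr s = (\<lambda>_ _. 0)(''end1'' := X, ''end2'' := Y)"
      "rreg s = (\<lambda>_. 0)" "rarr s = (\<lambda>_ _. 0)(''wv'' := wv, ''we'' := we)"
    and deg: "\<And>v. v < n \<Longrightarrow> deg v \<le> d + 1" and high: "card {v. v < n \<and> \<not> low v} \<le> 2 * d"
    and cyc: "\<And>cs P. disjoint_cycles cs P \<Longrightarrow> length cs \<le> d"
  shows "run (main_prog d) s (600 * (n + m + 1) * (6 * d + 22) ^ (3 * d)) (\<lambda>s'. tmatch (out s') \<and>
    (\<forall>T. tmatch T \<longrightarrow> sum W T \<le> sum W (out s')))"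
proof -
  define keep where "keep t \<longleftrightarrow> iarr t ''opt'' = (\<lambda>_. 0) \<and> iarr t ''outv'' = (\<lambda>_. 0) \<and> iarr t ''oute'' = (\<lambda>_. 0) \<and>
    rreg t ''best'' = 0 \<and> ireg t ''D'' = d + 3" for t :: store
  define fresh where "fresh t \<longleftrightarrow> keep t \<and> iarr t ''pv'' = (\<lambda>_. 0) \<and> iarr t ''pe'' = (\<lambda>_. 0) \<and> ireg t ''L'' = 3" for t :: store
  define ranks where "ranks t \<longleftrightarrow> (\<forall>i<m. iarr t ''r1'' i = rk (X i) i + 2 \<and> iarr t ''r2'' i = rk (Y i) i + 2)" for t :: store
  define S1 where "S1 t \<longleftrightarrow> base t \<and> fresh t \<and> ireg t ''k'' = 0 \<and> iarr t ''hx'' = (\<lambda>_. 0) \<and>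
    iarr t ''d'' = (\<lambda>_. 0) \<and> iarr t ''A'' = (\<lambda>_. 0) \<and> iarr t ''B'' = (\<lambda>_. 0)" for t :: store
  define S2 where "S2 t \<longleftrightarrow> base t \<and> fresh t \<and> ireg t ''k'' = 0 \<and> iarr t ''hx'' = (\<lambda>_. 0) \<and>
    ranks_upto m t \<and> ranks t \<and> last_edges m (iarr t ''A'') (iarr t ''B'')" for t :: store
  define S3 where "S3 t \<longleftrightarrow> ready t \<and> fresh t \<and> ranks t \<and> labelled (iarr t ''hx'') (ireg t ''k'') \<and>
    (\<forall>v. iarr t ''hx'' v \<noteq> 0 \<longleftrightarrow> v < n \<and> \<not> low v)" for t :: store
  define S4 where "S4 t \<longleftrightarrow> ready t \<and> keep t \<and> ranks t \<and> labelled (iarr t ''hx'') (ireg t ''k'') \<and> ireg t ''k'' \<le> 2 * d \<and>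
    closed_in t \<and> cycles_left (iarr t ''hx'') (iarr t ''pv'')" for t :: store
  define S5 where "S5 t \<longleftrightarrow> ready t \<and> keep t \<and> ranks t \<and> labelled (iarr t ''hx'') (ireg t ''k'') \<and> ireg t ''k'' \<le> 3 * d \<and>
    closed_in t \<and> (\<forall>v<n. iarr t ''hx'' v = 0 \<longrightarrow> iarr t ''pv'' v \<noteq> 0)" for t :: store
  note defs = keep_def fresh_def ranks_def
  \<comment> \<open>36 is the bound 30 on the cost of a search plus the 6 other steps of a
    round.\<close>
  have pot_le: "pot t \<le> 36 * n" for t
  proof -
    have "card {v. v < n \<and> iarr t ''pv'' v = 0} \<le> card {..<n}" by (intro card_mono) auto
    then have "pot t \<le> 36 * card {..<n}" unfolding pot_def using cost_find_prog by (intro mult_le_mono) auto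
    then show ?thesis by simp
  qed
  have s1: "run (Do (IConst ''o'' 1) ;; Do (IConst ''L'' 3) ;; Do (IConst ''D'' (d + 3))) s 3 S1"
    by (rule run_wp_le) (auto simp: s S1_def base_def defs)
  have s2: "run degree_prog t (m * 24 + 2) S2" if t: "S1 t" for t
  proof (rule runP_mono[OF run_degree_prog], goal_cases)
    case (6 t')
    note E = agreeD[OF 6(1), unfolded wr_setup_parts]
    have "ranks t'" using 6(2) by (simp add: ranks_upto_def ranks_def)
    then show ?case using t 6(2) by (simp add: S1_def S2_def fresh_def keep_def E)
  qed (use t in \<open>simp_all add: S1_def\<close>)
  have s3: "run label_prog t (n * 6 + 3) S3" if t: "S2 t" for t
  proof (rule runP_mono[OF run_label_prog], goal_cases)
    case (6 t')
    note E = agreeD[OF 6(1), unfolded wr_setup_parts]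
    have hx: "\<forall>v. iarr t' ''hx'' v \<noteq> 0 \<longleftrightarrow> v < n \<and> \<not> low v" using 6(2) by blast
    have "deg v \<le> 2" if "v < n" "iarr t' ''hx'' v = 0" for v
      using spec[OF hx, of v] that by (auto simp: low_def)
    then have "ready t'" using t 6(2) by (simp add: ready_def S2_def E)
    then show ?case using t 6(2) by (simp add: S2_def S3_def defs E)
  qed (use t in \<open>simp_all add: S2_def\<close>)
  have s4: "run paths_prog t (n * 110 + 2) S4" if t: "S3 t" for t
  proof -
    have cl: "closed_in t" using t closed_layout_empty[of "iarr t ''pv''" "iarr t ''pe''"] by (simp add: S3_def fresh_def)
    have r: "ready t" using t by (simp add: S3_def)
    show ?thesis
    proof (rule runP_mono[OF run_of_runP[OF run_paths_prog[OF r cl]]], goal_cases)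
      case 1
      have "n * (2 * cost find_prog + 13) \<le> n * 73" using cost_find_prog by (intro mult_le_mono2) auto
      then show ?case using pot_le[of t] by linarith
    next
      case (2 t')
      note E = agreeD[OF 2(1), unfolded wr_setup_parts]
      have hxt: "\<forall>v. iarr t ''hx'' v \<noteq> 0 \<longleftrightarrow> v < n \<and> \<not> low v" using t by (simp add: S3_def)
      have hx': "iarr t' ''hx'' = iarr t ''hx''" and k': "ireg t' ''k'' = ireg t ''k''" using 2(2) by (simp_all add: E)
      have "{v. iarr t ''hx'' v \<noteq> 0} = {v. v < n \<and> \<not> low v}" using hxt by (intro Collect_cong) simp
      then have "ireg t ''k'' \<le> 2 * d" using t high by (simp add: S3_def labelled_def)
      moreover have "cycles_left (iarr t ''hx'') (iarr t' ''pv'')"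
        by (rule cycles_left_after_paths[OF hxt, of _ "iarr t' ''pe''" "ireg t' ''L''"]) (use 2(2) hx' in auto)
      ultimately show ?case using t 2(2) hx' k' by (simp add: S3_def S4_def defs E)
    qed
  qed
  have s5: "run cycles_prog t (n * 115 + 2) S5" if t: "S4 t" for t
  proof -
    have *: "ready t" "closed_in t" "labelled (iarr t ''hx'') (ireg t ''k'')" "cycles_left (iarr t ''hx'') (iarr t ''pv'')"
      using t by (simp_all add: S4_def)
    show ?thesis
    proof (rule runP_mono[OF run_of_runP[OF run_cycles_prog[OF *]]], goal_cases)
      case 1
      have "n * (2 * cost find_prog + 15) \<le> n * 75" using cost_find_prog by (intro mult_le_mono2) auto
      then show ?case using pot_le[of t] by linarith
    next
      case (2 t')
      note E = agreeD[OF 2(1), unfolded wr_setup_parts]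
      obtain cs P where "disjoint_cycles cs P" "ireg t' ''k'' = ireg t ''k'' + length cs" using 2(2) by blast
      then have "ireg t' ''k'' \<le> 3 * d" using cyc[of cs P] t by (simp add: S4_def)
      then show ?case using t 2(2) by (simp add: S4_def S5_def defs E)
    qed
  qed
  have s6: "run (enum_prog (3 * d)) t ((6 * d + 22) ^ (3 * d) * (n * 94 + m * 71 + 99)) (\<lambda>s'. tmatch (out s') \<and>
    (\<forall>T. tmatch T \<longrightarrow> sum W T \<le> sum W (out s')))" if t: "S5 t" for t
  proof -
    define hx where "hx = iarr t ''hx''"
    define pv where "pv = iarr t ''pv''"
    define pe where "pe = iarr t ''pe''"
    define L where "L = ireg t ''L''"
    have cl: "closed_layout hx pv pe L" using t by (simp add: S5_def hx_def pv_def pe_def L_def)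
    have "card {v. pv v \<noteq> 0} \<le> card {..<n}"
      using cl by (intro card_mono) (auto simp: closed_layout_def layout_def)
    \<comment> \<open>The line is linear in \<open>n\<close>. This turns \<open>20 * L\<close> into
      at most \<open>60 * n + 60\<close> and yields the coefficients 94 and 99.\<close>
    then have L: "L \<le> 3 + 3 * n" using cl by (simp add: closed_layout_def)
    have lay: "complete_layout hx pv pe L"
      unfolding complete_layout_def
    proof (intro conjI allI impI)
      show "layout hx pv pe" using cl by (simp add: closed_layout_def)
      have L0: "0 < L" using cl by (simp add: closed_layout_def)
      show "pos pv pe x < L" for x
        using cl L0 by (cases "pos pv pe x = 0") (auto simp: closed_layout_def dest: spec[of _ x])
      show "pv v \<noteq> 0" if "v < n" "hx v = 0" for v using t that by (simp add: S5_def hx_def pv_def)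
    qed
    have lab: "labelled hx (ireg t ''k'')" "ireg t ''k'' \<le> 3 * d" using t by (simp_all add: S5_def hx_def)
    have out0: "out t = {}" using t by (simp add: S5_def keep_def out_def)
    have ok: "enum_ok hx pv pe L (d + 3) t"
      using t out0 unfolding enum_ok_def env_def best_ok_def
      by (simp add: S5_def keep_def ranks_def ready_def hx_def pv_def pe_def L_def tmatch_def)
    define B where "B = n * 34 + m * 71 + L * 20 + 39"
    show ?thesis
    proof (rule runP_mono[OF run_enum_prog[OF lay B_def ok]], goal_cases)
      case 1
      have "enum_cost (d + 3) B (3 * d) \<le> (6 * (d + 3) + 4) ^ (3 * d) * B"
        using enum_cost_le[of B "d + 3" "3 * d"] by (simp add: B_def)
      also have "6 * (d + 3) + 4 = 6 * d + 22" by simp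
      also have "(6 * d + 22) ^ (3 * d) * B \<le> (6 * d + 22) ^ (3 * d) * (n * 94 + m * 71 + 99)"
        using L by (intro mult_le_mono2) (simp add: B_def)
      finally show ?case .
    next
      case (2 s')
      note post = 2(2)[unfolded enum_post_def]
      have bo: "tmatch (out s')" "rreg s' ''best'' = sum W (out s')"
        using post by (simp_all add: enum_ok_def best_ok_def)
      have "sum W T \<le> rreg s' ''best''" if T: "tmatch T" for T
      proof -
        obtain opt where opt: "opt 0 = 0" "\<And>i. opt i < d + 3" "\<And>i. ireg t ''k'' < i \<Longrightarrow> opt i = 0"
          "{x \<in> T. pos pv pe x = 0} = decode hx opt"
        proof (rule decode_surj[OF lay T, of "ireg t ''k''" "d + 3"])
          show "hx v \<noteq> 0 \<Longrightarrow> v < n" for v using lab(1) by (simp add: labelled_def)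
          show "u = v" if "hx u \<noteq> 0" "hx u = hx v" for u v
          proof -
            have "inj_on hx {v. hx v \<noteq> 0}" using lab(1) by (simp add: labelled_def)
            then show ?thesis by (rule inj_onD[of hx _ u v]) (use that in simp_all)
          qed
          show "hx v \<le> ireg t ''k''" for v using lab(1) by (simp add: labelled_def)
          show "v < n \<Longrightarrow> deg v + 2 \<le> d + 3" for v using deg[of v] by simp
        qed auto
        \<comment> \<open>Options of labels above the counter are 0, like the initial array, so the
          vector lies in the enumerated range.\<close>
        have "opt i = iarr t ''opt'' i" if "i = 0 \<or> 3 * d < i" for i
          using that opt(1) opt(3)[of i] lab(2) t by (auto simp: S5_def keep_def)
        then have "solved hx pv pe opt (rreg s' ''best'')" using post opt(2) by blast
        then show ?thesis using T opt(4) by (simp add: solved_def)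
      qed
      then show ?case using bo by simp
    qed
  qed
  let ?R = "\<lambda>s'. tmatch (out s') \<and> (\<forall>T. tmatch T \<longrightarrow> sum W T \<le> sum W (out s'))"
  let ?P = "(6 * d + 22) ^ (3 * d)"
  have "run (main_prog d) s (3 + ((m * 24 + 2) + ((n * 6 + 3) + ((n * 110 + 2) + ((n * 115 + 2) +
    (?P * (n * 94 + m * 71 + 99))))))) ?R"
    unfolding main_prog_def
    apply (rule runP_Seq[OF s1])
    apply (rule runP_Seq[OF s2], assumption)
    apply (rule runP_Seq[OF s3], assumption)
    apply (rule runP_Seq[OF s4], assumption)
    apply (rule runP_Seq[OF s5], assumption)
    apply (rule s6, assumption)
    done
  then show ?thesis
  proof (rule runP_mono, goal_cases)
    case 1
    \<comment> \<open>The linear preprocessing is absorbed by multiplying it with the number of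
      cases.\<close>
    have "1 \<le> ?P" by simp
    then have a: "1 * (231 * n + 24 * m + 12) \<le> ?P * (231 * n + 24 * m + 12)" by (rule mult_le_mono1)
    define Z where "Z = ?P * (n * 94 + m * 71 + 99)"
    have "3 + ((m * 24 + 2) + ((n * 6 + 3) + ((n * 110 + 2) + ((n * 115 + 2) + Z)))) = 1 * (231 * n + 24 * m + 12) + Z"
      by simp
    also have "\<dots> \<le> ?P * (231 * n + 24 * m + 12) + Z" by (rule add_right_mono[OF a])
    also have "\<dots> = ?P * (231 * n + 24 * m + 12) + ?P * (n * 94 + m * 71 + 99)" by (simp only: Z_def)
    also have "\<dots> = ?P * (325 * n + 95 * m + 111)" by (simp add: algebra_simps)
    also have "\<dots> \<le> ?P * (600 * (n + m + 1))" by (intro mult_le_mono2) simp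
    finally show ?case unfolding Z_def by (simp only: mult.commute)
  qed
qed

end

section \<open>Transfer to abstract graphs\<close>

fun element_conf :: "'a set set \<Rightarrow> 'a element \<Rightarrow> 'a element \<Rightarrow> bool" where
  "element_conf E (Inl u) (Inl v) \<longleftrightarrow> {u, v} \<in> E"
| "element_conf E (Inl v) (Inr e) \<longleftrightarrow> v \<in> e"
| "element_conf E (Inr e) (Inl v) \<longleftrightarrow> v \<in> e"
| "element_conf E (Inr e) (Inr e') \<longleftrightarrow> e \<noteq> e' \<and> e \<inter> e' \<noteq> {}"

text \<open>Replaces the pair of a stable set and a matching by a pairwise condition on elements,
  the form in which \<open>tmatch\<close> is stated.\<close>

lemma total_matching_iff:
  "total_matching V E T \<longleftrightarrow> T \<subseteq> V <+> E \<and> (\<forall>x\<in>T. \<forall>y\<in>T. \<not> element_conf E x y)"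
proof
  assume "total_matching V E T"
  then obtain S F where T: "T = S <+> F" "stable_set V E S" "matching E F" "\<forall>v\<in>S. \<forall>e\<in>F. v \<notin> e"
    by (auto simp: total_matching_def)
  then have "T \<subseteq> V <+> E" by (auto simp: stable_set_def matching_def)
  moreover have "\<not> element_conf E x y" if "x \<in> T" "y \<in> T" for x y
    using that T by (cases x; cases y) (simp_all add: stable_set_def matching_def InlI InrI Plus_def image_iff, metis)
  ultimately show "T \<subseteq> V <+> E \<and> (\<forall>x\<in>T. \<forall>y\<in>T. \<not> element_conf E x y)" by blast
next
  assume T: "T \<subseteq> V <+> E \<and> (\<forall>x\<in>T. \<forall>y\<in>T. \<not> element_conf E x y)"
  then have sub: "T \<subseteq> V <+> E" and nc: "\<And>x y. x \<in> T \<Longrightarrow> y \<in> T \<Longrightarrow> \<not> element_conf E x y" by auto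
  define S where "S = {v. Inl v \<in> T}"
  define F where "F = {e. Inr e \<in> T}"
  have "T = S <+> F" using sub by (auto simp: S_def F_def Plus_def)
  moreover have "stable_set V E S"
    using sub nc[of "Inl _" "Inl _"] by (auto simp: stable_set_def S_def)
  moreover have "matching E F" unfolding matching_def
  proof (intro conjI ballI impI)
    show "F \<subseteq> E" using sub by (auto simp: F_def)
    fix e e' assume "e \<in> F" "e' \<in> F" "e \<noteq> e'"
    then show "e \<inter> e' = {}" using nc[of "Inr e" "Inr e'"] by (auto simp: F_def)
  qed
  moreover have "\<forall>v\<in>S. \<forall>e\<in>F. v \<notin> e"
  proof (intro ballI)
    fix v e assume "v \<in> S" "e \<in> F"
    then show "v \<notin> e" using nc[of "Inl v" "Inr e"] by (simp add: S_def F_def)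
  qed
  ultimately show "total_matching V E T" unfolding total_matching_def by blast
qed

text \<open>\<open>\<phi>\<close> is a bijection from index elements to elements that preserves
  conflicts and weights, so total matchings and their optimality transfer both ways. Degrees and
  cycles transfer through \<open>vs\<close>, which brings the determinant bounds to the index
  graph.\<close>

lemma main_prog_correct:
  fixes V :: "'a set"
  assumes G: "simple_graph V E" and d: "max_subdet V E \<le> int d" and P: "presents vs ps V E"
  shows "\<exists>t s. exec (main_prog d) (input_store vs ps w) t s \<and>
    max_weight_total_matching V E w (output_set vs ps s) \<and>
    t \<le> 600 * (card V + card E + 1) * (6 * d + 22) ^ (3 * d)"
proof -
  define n where "n = length vs"
  define m where "m = length ps"
  define X where "X = padded (map fst ps)"
  define Y where "Y = padded (map snd ps)"
  define wv where "wv = padded (map (\<lambda>v. w (Inl v)) vs)"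
  define we where "we = padded (map (\<lambda>e. w (Inr e)) (edge_list vs ps))"
  define el where "el j = edge_list vs ps ! j" for j
  have dvs: "distinct vs" "set vs = V" and del: "distinct (edge_list vs ps)" "set (edge_list vs ps) = E"
    and idx: "\<And>i j. (i, j) \<in> set ps \<Longrightarrow> i < n \<and> j < n"
    using P by (auto simp: presents_def n_def)
  have lel: "length (edge_list vs ps) = m" by (simp add: edge_list_def m_def)
  have XY: "X j = fst (ps ! j)" "Y j = snd (ps ! j)" if "j < m" for j
    using that by (auto simp: X_def Y_def padded_def m_def)
  have XYn: "X j < n" "Y j < n" if "j < m" for j
    using idx[of "fst (ps ! j)" "snd (ps ! j)"] that XY[OF that] by (auto simp: m_def)
  have el: "el j = {vs ! X j, vs ! Y j}" if "j < m" for j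
    using that XY[OF that] by (simp add: el_def edge_list_def m_def case_prod_beta)
  have elE: "el j \<in> E" if "j < m" for j using that lel del by (auto simp: el_def)
  have Eel: "\<exists>j<m. e = el j" if "e \<in> E" for e
    using that lel del(2) by (auto simp: el_def in_set_conv_nth)
  have el_inj: "el i = el j \<longleftrightarrow> i = j" if "i < m" "j < m" for i j
    using that del(1) lel by (simp add: el_def nth_eq_iff_index_eq)
  have vs_inj: "vs ! i = vs ! j \<longleftrightarrow> i = j" if "i < n" "j < n" for i j
    using that dvs(1) by (simp add: n_def nth_eq_iff_index_eq)
  have vsV: "vs ! i \<in> V" if "i < n" for i using that dvs by (auto simp: n_def)
  have Vvs: "\<exists>i<n. v = vs ! i" if "v \<in> V" for v using that dvs(2) by (auto simp: n_def in_set_conv_nth)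
  have XneY: "X j \<noteq> Y j" if "j < m" for j
    using G elE[OF that] el[OF that] by (auto simp: simple_graph_def)
  interpret total_matching_prog n m X Y wv we
  proof
    fix i j assume ij: "i < m" "j < m" "{X i, Y i} = {X j, Y j}"
    then have "el i = el j" using el[of i] el[of j] by (auto simp: doubleton_eq_iff)
    then show "i = j" using el_inj ij by simp
  qed (use XYn XneY in auto)
  have inc_el: "vs ! v \<in> el j \<longleftrightarrow> inc j v" if "j < m" "v < n" for j v
    using that el[of j] vs_inj XYn by (auto simp: inc_def)
  have adjE: "{vs ! u, vs ! v} \<in> E \<longleftrightarrow> adj u v" if "u < n" "v < n" for u v
  proof
    assume "{vs ! u, vs ! v} \<in> E"
    then obtain j where j: "j < m" "{vs ! u, vs ! v} = el j" using Eel by blast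
    then have "{X j, Y j} = {u, v}" using el[OF j(1)] that XYn[OF j(1)] vs_inj by (auto simp: doubleton_eq_iff)
    then show "adj u v" using j by (auto simp: adj_def)
  next
    assume "adj u v"
    then obtain j where j: "j < m" "{X j, Y j} = {u, v}" unfolding adj_def by blast
    then have "el j = {vs ! u, vs ! v}" using el[OF j(1)] by (auto simp: doubleton_eq_iff)
    then show "{vs ! u, vs ! v} \<in> E" using elE[OF j(1)] by simp
  qed
  define \<phi> :: "elem \<Rightarrow> 'a element" where "\<phi> x = (case x of Inl i \<Rightarrow> Inl (vs ! i) | Inr j \<Rightarrow> Inr (el j))" for x
  let ?U = "{..<n} <+> {..<m} :: elem set"
  have inj: "inj_on \<phi> ?U" by (auto simp: inj_on_def \<phi>_def vs_inj el_inj)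
  have img: "\<phi> ` ?U = V <+> E"
  proof
    show "\<phi> ` ?U \<subseteq> V <+> E" using vsV elE by (auto simp: \<phi>_def)
    show "V <+> E \<subseteq> \<phi> ` ?U"
    proof
      fix x assume "x \<in> V <+> E"
      then show "x \<in> \<phi> ` ?U"
      proof
        fix v assume "x = Inl v" "v \<in> V"
        then obtain i where "i < n" "x = \<phi> (Inl i)" using Vvs[of v] by (auto simp: \<phi>_def)
        then show ?thesis by blast
      next
        fix e assume "x = Inr e" "e \<in> E"
        then obtain j where "j < m" "x = \<phi> (Inr j)" using Eel[of e] by (auto simp: \<phi>_def)
        then show ?thesis by blast
      qed
    qed
  qed
  have conf: "element_conf E (\<phi> x) (\<phi> y) \<longleftrightarrow> conf x y" if "x \<in> ?U" "y \<in> ?U" for x y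
  proof -
    have ee: "el i \<noteq> el j \<and> el i \<inter> el j \<noteq> {} \<longleftrightarrow> i \<noteq> j \<and> (\<exists>v. inc i v \<and> inc j v)" if "i < m" "j < m" for i j
    proof -
      have "el i \<inter> el j \<noteq> {} \<longleftrightarrow> (\<exists>v. inc i v \<and> inc j v)"
        using el[OF that(1)] el[OF that(2)] XYn[OF that(1)] XYn[OF that(2)] vs_inj by (auto simp: inc_def)
      then show ?thesis using el_inj[OF that] by simp
    qed
    show ?thesis
    proof (cases x)
      case (Inl u)
      then show ?thesis using that by (cases y) (auto simp: \<phi>_def adjE inc_el)
    next
      case (Inr i)
      then show ?thesis using that ee[of i] by (cases y) (auto simp: \<phi>_def inc_el simp del: Int_iff)
    qed
  qed
  have tm: "total_matching V E (\<phi> ` T) \<longleftrightarrow> tmatch T" if T: "T \<subseteq> ?U" for T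
  proof -
    have "\<phi> ` T \<subseteq> V <+> E" using T img by blast
    moreover have "(\<forall>x\<in>\<phi> ` T. \<forall>y\<in>\<phi> ` T. \<not> element_conf E x y) \<longleftrightarrow> (\<forall>x\<in>T. \<forall>y\<in>T. \<not> conf x y)"
      using conf T by blast
    ultimately show ?thesis unfolding total_matching_iff tmatch_def using T by simp
  qed
  have w\<phi>: "w (\<phi> x) = W x" if "x \<in> ?U" for x
    using that lel by (auto simp: \<phi>_def wv_def we_def padded_def n_def el_def)
  have sum\<phi>: "sum w (\<phi> ` T) = sum W T" if T: "T \<subseteq> ?U" for T
    using T w\<phi> by (subst sum.reindex) (auto intro!: sum.cong inj_on_subset[OF inj])
  have out\<phi>: "output_set vs ps s = \<phi> ` out s" for s
    unfolding output_set_def n_def[symmetric] m_def[symmetric] el_def[symmetric] out_def \<phi>_def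
    by (auto simp: Plus_def image_Un image_image)
  have outU: "out s \<subseteq> ?U" for s by (auto simp: out_def)
  have deg_eq: "degree_in E (vs ! v) = deg v" if v: "v < n" for v
  proof -
    have "{e \<in> E. vs ! v \<in> e} = el ` {j. j < m \<and> inc j v}"
      using elE Eel inc_el v by (auto simp: image_iff) metis
    moreover have "inj_on el {j. j < m \<and> inc j v}" by (auto simp: inj_on_def el_inj)
    ultimately show ?thesis by (simp add: degree_in_def card_image deg_def rk_def)
  qed
  have deg: "deg v \<le> d + 1" if "v < n" for v
    using degree_le[OF G d vsV[OF that]] deg_eq[OF that] by simp
  have high: "card {v. v < n \<and> \<not> low v} \<le> 2 * d"
  proof -
    have "(\<lambda>i. vs ! i) ` {v. v < n \<and> \<not> low v} \<subseteq> {v \<in> V. degree_in E v \<ge> 3}"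
      using vsV deg_eq by (auto simp: low_def)
    moreover have "finite {v \<in> V. degree_in E v \<ge> 3}" using G by (auto simp: simple_graph_def)
    moreover have "inj_on (\<lambda>i. vs ! i) {v. v < n \<and> \<not> low v}" by (auto simp: inj_on_def vs_inj)
    ultimately have "card {v. v < n \<and> \<not> low v} \<le> card {v \<in> V. degree_in E v \<ge> 3}"
      using card_inj_on_le[of "\<lambda>i. vs ! i"] by blast
    then show ?thesis using card_high_degree_le[OF G d] by simp
  qed
  have cyc: "length cs \<le> d" if cs: "disjoint_cycles cs Q" for cs Q
  proof -
    have cn: "x < n" if c: "c \<in> set cs" "x \<in> set c" for c x
    proof -
      have "is_cycle edge_sets c" using cs c by (simp add: disjoint_cycles_def)
      moreover obtain i where "i < length c" "x = c ! i" using c(2) by (auto simp: in_set_conv_nth)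
      ultimately have "adj x (c ! (Suc i mod length c))" by (auto simp: is_cycle_def adj_edge_sets)
      then show ?thesis using adj_less by blast
    qed
    have "is_cycle E (map ((!) vs) c)" if c: "c \<in> set cs" for c
      unfolding is_cycle_def
    proof (intro conjI allI impI)
      have cc: "is_cycle edge_sets c" using cs that by (simp add: disjoint_cycles_def)
      then show "3 \<le> length (map ((!) vs) c)" by (simp add: is_cycle_def)
      have "inj_on ((!) vs) (set c)" using cn[OF c] vs_inj by (auto simp: inj_on_def)
      then show "distinct (map ((!) vs) c)" using cc by (simp add: is_cycle_def distinct_map)
      fix i assume i: "i < length (map ((!) vs) c)"
      let ?j = "Suc i mod length c"
      have j: "?j < length c" using i by (auto intro: mod_less_divisor)
      have "adj (c ! i) (c ! ?j)" using cc i by (simp add: is_cycle_def adj_edge_sets)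
      then have "{vs ! (c ! i), vs ! (c ! ?j)} \<in> E" using adjE adj_less by blast
      then show "{map ((!) vs) c ! i, map ((!) vs) c ! (Suc i mod length (map ((!) vs) c))} \<in> E"
        using i j by simp
    qed
    moreover have "sorted_wrt (\<lambda>c c'. set c \<inter> set c' = {}) (map (map ((!) vs)) cs)"
      unfolding sorted_wrt_map
    proof (rule sorted_wrt_mono_rel[of _ "\<lambda>c c'. set c \<inter> set c' = {}"])
      show "sorted_wrt (\<lambda>c c'. set c \<inter> set c' = {}) cs" using cs by (simp add: disjoint_cycles_def)
      fix c c' assume c: "c \<in> set cs" "c' \<in> set cs" "set c \<inter> set c' = {}"
      have "False" if "x \<in> set c" "y \<in> set c'" "vs ! x = vs ! y" for x y
        using vs_inj[OF cn[OF c(1) that(1)] cn[OF c(2) that(2)]] that c(3) by auto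
      then show "set (map ((!) vs) c) \<inter> set (map ((!) vs) c') = {}" by auto
    qed
    ultimately have "2 ^ length (map (map ((!) vs)) cs) \<le> d"
      by (intro disjoint_cycles_le[OF G d]) auto
    \<comment> \<open>The logarithmic bound is relaxed to \<open>d\<close>, of the same order as the
      \<open>2 * d\<close> vertices of high degree.\<close>
    moreover have "length cs < 2 ^ length cs" by (rule less_exp)
    ultimately show ?thesis unfolding length_map by linarith
  qed
  have "run (main_prog d) (input_store vs ps w) (600 * (n + m + 1) * (6 * d + 22) ^ (3 * d))
    (\<lambda>s'. tmatch (out s') \<and> (\<forall>T. tmatch T \<longrightarrow> sum W T \<le> sum W (out s')))"
    by (rule run_main_prog) (simp_all add: input_store_def n_def[symmetric] m_def[symmetric] X_def[symmetric] Y_def[symmetric]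
        wv_def[symmetric] we_def[symmetric] deg[simplified] high cyc)
  then obtain t s where ts: "exec (main_prog d) (input_store vs ps w) t s"
    "t \<le> 600 * (n + m + 1) * (6 * d + 22) ^ (3 * d)" "tmatch (out s)"
    "\<And>T. tmatch T \<Longrightarrow> sum W T \<le> sum W (out s)" unfolding runP_def by auto
  have "max_weight_total_matching V E w (output_set vs ps s)"
    unfolding max_weight_total_matching_def out\<phi>
  proof (intro conjI allI impI)
    show "total_matching V E (\<phi> ` out s)" using tm[OF outU] ts(3) by simp
    fix T' assume T': "total_matching V E T'"
    then have "T' \<subseteq> \<phi> ` ?U" using img by (simp add: total_matching_iff)
    then obtain T where T: "T \<subseteq> ?U" "T' = \<phi> ` T" by (auto simp: subset_image_iff)
    then have "tmatch T" using tm T' by simp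
    then show "sum w T' \<le> sum w (\<phi> ` out s)" using ts(4) sum\<phi>[OF T(1)] sum\<phi>[OF outU] T(2) by simp
  qed
  moreover have "card V = n" "card E = m"
    using distinct_card[OF dvs(1)] distinct_card[OF del(1)] dvs(2) del(2) lel by (auto simp: n_def)
  ultimately show ?thesis using ts(1,2) by auto
qed

text \<open>For \<open>d \<ge> 2\<close>, \<open>6 * d + 22 \<le> 32 * d \<le> d ^ 6\<close>, so the
  logarithm is at most 6 times that of \<open>d\<close>; with the factor 3 of the exponent this
  gives 18.\<close>

lemma exponent_bigo: "(\<lambda>d. 3 * real d * log 2 (6 * real d + 22)) \<in> O(\<lambda>d. real d * log 2 (real d))"
proof (rule bigoI[where c = 18])
  show "\<forall>\<^sub>F d in at_top. norm (3 * real d * log 2 (6 * real d + 22)) \<le> 18 * norm (real d * log 2 (real d))"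
    using eventually_ge_at_top[of 2]
  proof eventually_elim
    case (elim d)
    have d: "2 \<le> real d" using elim by simp
    have "6 * real d + 22 \<le> 2 ^ 5 * real d" using d by simp
    also have "\<dots> \<le> real d ^ 5 * real d" using d by (intro mult_right_mono power_mono) auto
    also have "\<dots> = real d ^ 6" by (simp add: power_numeral_reduce)
    finally have "log 2 (6 * real d + 22) \<le> log 2 (real d ^ 6)" using d by (intro log_mono) auto
    also have "\<dots> = 6 * log 2 (real d)" using d by (simp add: log_nat_power)
    finally have "log 2 (6 * real d + 22) \<le> 6 * log 2 (real d)" .
    moreover have "0 \<le> log 2 (6 * real d + 22)" "0 \<le> log 2 (real d)" using d by (auto simp: zero_le_log_cancel_iff)
    moreover have "3 * real d * log 2 (6 * real d + 22) \<le> 3 * real d * (6 * log 2 (real d))"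
      using calculation(1) by (intro mult_left_mono) auto
    ultimately show ?case by (simp add: abs_mult)
  qed
qed

theorem theorem1:
  shows "\<exists>(C :: real) (f :: nat \<Rightarrow> real).
    f \<in> O(\<lambda>d. real d * log 2 (real d)) \<and>
    (\<forall>\<Delta> :: nat. \<Delta> \<ge> 1 \<longrightarrow>
      (\<exists>p :: prog. \<forall>(V :: 'a set) (E :: 'a set set) (w :: 'a element \<Rightarrow> real) vs ps.
        simple_graph V E \<and> max_subdet V E \<le> int \<Delta> \<and> presents vs ps V E \<longrightarrow>
        (\<exists>t s. exec p (input_store vs ps w) t s \<and>
          max_weight_total_matching V E w (output_set vs ps s) \<and>
          real t \<le> C * 2 powr f \<Delta> * max 1 (real (card V + card E)))))"
proof (rule exI[of _ 1200], rule exI[of _ "\<lambda>d. 3 * real d * log 2 (6 * real d + 22)"],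
    intro conjI allI impI exponent_bigo)
  fix d :: nat
  \<comment> \<open>The exponent is the binary logarithm of the bound on the number of cases, loop
    overhead included.\<close>
  have pw: "2 powr (3 * real d * log 2 (6 * real d + 22)) = real ((6 * d + 22) ^ (3 * d))"
  proof -
    have "2 powr (3 * real d * log 2 (6 * real d + 22)) = (2 powr log 2 (6 * real d + 22)) powr (3 * real d)"
      by (simp only: powr_powr mult.commute)
    also have "\<dots> = (6 * real d + 22) powr real (3 * d)" by simp
    also have "\<dots> = (6 * real d + 22) ^ (3 * d)" by (rule powr_realpow) simp
    finally show ?thesis by simp
  qed
  show "\<exists>p :: prog. \<forall>(V :: 'a set) (E :: 'a set set) (w :: 'a element \<Rightarrow> real) vs ps.
        simple_graph V E \<and> max_subdet V E \<le> int d \<and> presents vs ps V E \<longrightarrow>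
        (\<exists>t s. exec p (input_store vs ps w) t s \<and>
          max_weight_total_matching V E w (output_set vs ps s) \<and>
          real t \<le> 1200 * 2 powr (3 * real d * log 2 (6 * real d + 22)) * max 1 (real (card V + card E)))"
  proof (intro exI[of _ "main_prog d"] allI impI)
    fix V :: "'a set" and E w vs ps
    assume A: "simple_graph V E \<and> max_subdet V E \<le> int d \<and> presents vs ps V E"
    then obtain t s where ts: "exec (main_prog d) (input_store vs ps w) t s"
      "max_weight_total_matching V E w (output_set vs ps s)"
      "t \<le> 600 * (card V + card E + 1) * (6 * d + 22) ^ (3 * d)"
      using main_prog_correct[of V E d vs ps w] by blast
    let ?N = "real (card V + card E)" and ?P = "real ((6 * d + 22) ^ (3 * d))"
    \<comment> \<open>The additive constant costs a factor 2, whence 1200 from 600; the maximum with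
      1 covers the empty graph.\<close>
    have N: "?N + 1 \<le> 2 * max 1 ?N" by (simp add: max_def)
    have "real t \<le> real (600 * (card V + card E + 1) * (6 * d + 22) ^ (3 * d))" using ts(3) by (rule of_nat_mono)
    also have "\<dots> = 600 * (?N + 1) * ?P" by (simp only: of_nat_mult of_nat_add of_nat_numeral of_nat_1)
    also have "\<dots> \<le> 600 * (2 * max 1 ?N) * ?P" using N by (intro mult_right_mono mult_left_mono) auto
    also have "\<dots> = 1200 * 2 powr (3 * real d * log 2 (6 * real d + 22)) * max 1 ?N" unfolding pw by simp
    finally show "\<exists>t s. exec (main_prog d) (input_store vs ps w) t s \<and>
          max_weight_total_matching V E w (output_set vs ps s) \<and>
          real t \<le> 1200 * 2 powr (3 * real d * log 2 (6 * real d + 22)) * max 1 ?N"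
      using ts(1,2) by blast
  qed
qed

end
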